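(* Let $M$ be an infinite-dimensional manifold and $\theta\in\Omega^1(M)$ such that $(M,d\theta)$ is a weakly symplectic manifold. Consider $\mathbb{R}$ and $S^1$, both parametrised with the coordinate $z$ and equipped with the nowhere zero 1-form $dz$. Let $\pi_1,\pi_2$ be the projections of $\mathbb{R}\times M$ (respectively $S^1\times M$) onto the first and second factors, and let $\eta=\pi_1^*dz+\pi_2^*\theta$, a 1-form on $\mathbb{R}\times M$ (respectively $S^1\times M$). Then $(\mathbb{R}\times M,\eta)$ and $(S^1\times M,\eta)$ are contact manifolds.
   Context: Manifolds are modelled on convenient vector spaces (Hausdorff locally convex real topological vector spaces in which every smooth curve has a smooth antiderivative); smooth maps are those sending smooth curves to smooth curves. $TM$ is the kinematic tangent bundle (equivalence classes of smooth curves), $T'M$ the bundle with fibres the continuous duals $(T_pM)'$. $k$-forms are smooth sections of the bundle of continuous alternating $k$-linear forms on $TM$. $(M,\omega)$ with $\omega\in\Omega^2(M)$ is weakly symplectic if $d\omega=0$ and $v\mapsto\iota_v\omega$, $TM\to T'M$, is injective. Contact form on a manifold $N$: a 1-form $\eta\in\Omega^1(N)$ such that $d\eta$ has non-zero kernel at every point and, with $\mathcal{H}=\ker\eta$ and $\mathcal{V}=\ker d\eta=\{v: d\eta(v,\cdot)=0\}$, any (hence all) of the following equivalent conditions hold: (1) $TN=\mathcal{H}\oplus\mathcal{V}$; (2) $d\eta|_{\mathcal{H}}$ is weakly non-degenerate (has zero kernel); (3) $\flat\colon TN\to T'N$, $v\mapsto\iota_v d\eta+\eta(v)\eta$, is an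 injective bundle homomorphism. A contact manifold $(N,\eta)$ is a manifold with a (global) contact form. *)

theory Defs
  imports "HOL-Analysis.Analysis" "HOL-Library.Function_Algebras"
begin

section \<open>Convenient vector spaces and smooth maps\<close>

text \<open>A topological vector space is given by a topology whose underlying set is a subspace of the
  ambient type, so that charts of one manifold may have different model spaces.\<close>

definition topological_vector_space :: "'e::real_vector topology \<Rightarrow> bool" where
  "topological_vector_space E \<longleftrightarrow>
     subspace (topspace E) \<and>
     continuous_map (prod_topology E E) E (\<lambda>(x, y). x + y) \<and>
     continuous_map (prod_topology euclideanreal E) E (\<lambda>(a, x). a *\<^sub>R x)"

definition locally_convex_space :: "'e::real_vector topology \<Rightarrow> bool" where
  "locally_convex_space E \<longleftrightarrow>
     topological_vector_space E \<and>
     (\<forall>U. openin E U \<and> 0 \<in> U \<longrightarrow> (\<exists>V. openin E V \<and> convex V \<and> 0 \<in> V \<and> V \<subseteq> U))"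

definition has_curve_derivative ::
    "'e::real_vector topology \<Rightarrow> (real \<Rightarrow> 'e) \<Rightarrow> 'e \<Rightarrow> real \<Rightarrow> bool" where
  "has_curve_derivative E c v t \<longleftrightarrow> limitin E (\<lambda>h. (c (t + h) - c t) /\<^sub>R h) v (at 0)"

text \<open>For open \<open>J\<close>; \<open>d n\<close> is the \<open>n\<close>-th derivative of \<open>c\<close>.\<close>

definition smooth_curve_on ::
    "real set \<Rightarrow> 'e::real_vector topology \<Rightarrow> (real \<Rightarrow> 'e) \<Rightarrow> bool" where
  "smooth_curve_on J E c \<longleftrightarrow>
     (\<exists>d :: nat \<Rightarrow> real \<Rightarrow> 'e.
        d 0 = c \<and>
        (\<forall>n. \<forall>t\<in>J. d n t \<in> topspace E \<and> has_curve_derivative E (d n) (d (Suc n) t) t))"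

definition convenient_space :: "'e::real_vector topology \<Rightarrow> bool" where
  "convenient_space E \<longleftrightarrow>
     locally_convex_space E \<and> Hausdorff_space E \<and>
     (\<forall>c. smooth_curve_on UNIV E c \<longrightarrow>
        (\<exists>C. smooth_curve_on UNIV E C \<and> (\<forall>t. has_curve_derivative E C (c t) t)))"

text \<open>Open sets of the \<open>c\<^sup>\<infinity>\<close>-topology, i.e. the final topology for the smooth curves.\<close>

definition cinf_open :: "'e::real_vector topology \<Rightarrow> 'e set \<Rightarrow> bool" where
  "cinf_open E U \<longleftrightarrow> U \<subseteq> topspace E \<and> (\<forall>c. smooth_curve_on UNIV E c \<longrightarrow> open (c -` U))"

definition smooth_map_on ::
    "'e::real_vector set \<Rightarrow> 'e topology \<Rightarrow> 'f::real_vector topology \<Rightarrow> ('e \<Rightarrow> 'f) \<Rightarrow> bool" where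
  "smooth_map_on U E F f \<longleftrightarrow>
     (\<forall>c. smooth_curve_on UNIV E c \<and> range c \<subseteq> U \<longrightarrow> smooth_curve_on UNIV F (f \<circ> c))"

definition bounded_in :: "'e::real_vector topology \<Rightarrow> 'e set \<Rightarrow> bool" where
  "bounded_in E B \<longleftrightarrow>
     B \<subseteq> topspace E \<and>
     (\<forall>U. openin E U \<and> 0 \<in> U \<longrightarrow> (\<exists>r>0. \<forall>s. r \<le> \<bar>s\<bar> \<longrightarrow> B \<subseteq> (\<lambda>x. s *\<^sub>R x) ` U))"


section \<open>Spaces of continuous alternating multilinear forms\<close>

instantiation "fun" :: (type, real_vector) real_vector
begin

definition scaleR_fun :: "real \<Rightarrow> ('a \<Rightarrow> 'b) \<Rightarrow> 'a \<Rightarrow> 'b" where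
  "scaleR_fun a f = (\<lambda>x. a *\<^sub>R f x)"

instance
  by standard (auto simp: scaleR_fun_def fun_eq_iff scaleR_add_right scaleR_add_left)

end

definition tuples :: "nat \<Rightarrow> 'a set \<Rightarrow> 'a list set" where
  "tuples k A = {xs. length xs = k \<and> set xs \<subseteq> A}"

text \<open>Forms take lists of vectors as arguments and are extended by \<open>0\<close> outside of \<open>E\<^sup>k\<close>.\<close>

definition alt_forms :: "nat \<Rightarrow> 'e::real_vector topology \<Rightarrow> ('e list \<Rightarrow> real) set" where
  "alt_forms k E = {\<alpha>.
     (\<forall>vs. vs \<notin> tuples k (topspace E) \<longrightarrow> \<alpha> vs = 0) \<and>
     (\<forall>vs \<in> tuples k (topspace E). \<forall>i<k. \<forall>v \<in> topspace E. \<forall>w \<in> topspace E. \<forall>a b.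
        \<alpha> (vs[i := a *\<^sub>R v + b *\<^sub>R w]) = a * \<alpha> (vs[i := v]) + b * \<alpha> (vs[i := w])) \<and>
     (\<forall>vs \<in> tuples k (topspace E). \<not> distinct vs \<longrightarrow> \<alpha> vs = 0) \<and>
     continuous_map (product_topology (\<lambda>_. E) {..<k}) euclideanreal (\<lambda>f. \<alpha> (map f [0..<k]))}"

text \<open>The topology of uniform convergence on bounded sets.\<close>

definition alt_forms_open :: "nat \<Rightarrow> 'e::real_vector topology \<Rightarrow> ('e list \<Rightarrow> real) set \<Rightarrow> bool" where
  "alt_forms_open k E T \<longleftrightarrow>
     T \<subseteq> alt_forms k E \<and>
     (\<forall>\<alpha>\<in>T. \<exists>B \<epsilon>. bounded_in E B \<and> 0 < \<epsilon> \<and>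
        (\<forall>\<beta> \<in> alt_forms k E. (\<forall>vs \<in> tuples k B. \<bar>\<beta> vs - \<alpha> vs\<bar> < \<epsilon>) \<longrightarrow> \<beta> \<in> T))"

definition alt_forms_topology :: "nat \<Rightarrow> 'e::real_vector topology \<Rightarrow> ('e list \<Rightarrow> real) topology" where
  "alt_forms_topology k E = topology (alt_forms_open k E)"

lemma bounded_in_Un:
  assumes "bounded_in E A" and "bounded_in E B"
  shows "bounded_in E (A \<union> B)"
  unfolding bounded_in_def
proof (intro conjI allI impI)
  show "A \<union> B \<subseteq> topspace E"
    using assms by (auto simp: bounded_in_def)
next
  fix U assume U: "openin E U \<and> 0 \<in> U"
  obtain r where r: "r > 0" "\<forall>s. r \<le> \<bar>s\<bar> \<longrightarrow> A \<subseteq> (\<lambda>x. s *\<^sub>R x) ` U"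
    using assms(1) U unfolding bounded_in_def by metis
  obtain r' where r': "r' > 0" "\<forall>s. r' \<le> \<bar>s\<bar> \<longrightarrow> B \<subseteq> (\<lambda>x. s *\<^sub>R x) ` U"
    using assms(2) U unfolding bounded_in_def by metis
  have "max r r' > 0 \<and> (\<forall>s. max r r' \<le> \<bar>s\<bar> \<longrightarrow> A \<union> B \<subseteq> (\<lambda>x. s *\<^sub>R x) ` U)"
    using r r' by (meson max.bounded_iff less_max_iff_disj Un_least)
  then show "\<exists>r>0. \<forall>s. r \<le> \<bar>s\<bar> \<longrightarrow> A \<union> B \<subseteq> (\<lambda>x. s *\<^sub>R x) ` U"
    by blast
qed

lemma istopology_alt_forms_open: "istopology (alt_forms_open k E)"
  unfolding istopology_def
proof (intro conjI allI impI)
  fix S T assume S: "alt_forms_open k E S" and T: "alt_forms_open k E T"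
  show "alt_forms_open k E (S \<inter> T)"
    unfolding alt_forms_open_def
  proof (intro conjI ballI)
    show "S \<inter> T \<subseteq> alt_forms k E"
      using S by (auto simp: alt_forms_open_def)
  next
    fix \<alpha> assume \<alpha>: "\<alpha> \<in> S \<inter> T"
    obtain A a where A: "bounded_in E A" "0 < a"
        "\<And>\<beta>. \<beta> \<in> alt_forms k E \<Longrightarrow> \<forall>vs \<in> tuples k A. \<bar>\<beta> vs - \<alpha> vs\<bar> < a \<Longrightarrow> \<beta> \<in> S"
      using S \<alpha> unfolding alt_forms_open_def by (metis IntD1)
    obtain B b where B: "bounded_in E B" "0 < b"
        "\<And>\<beta>. \<beta> \<in> alt_forms k E \<Longrightarrow> \<forall>vs \<in> tuples k B. \<bar>\<beta> vs - \<alpha> vs\<bar> < b \<Longrightarrow> \<beta> \<in> T"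
      using T \<alpha> unfolding alt_forms_open_def by (metis IntD2)
    have "tuples k A \<subseteq> tuples k (A \<union> B)" "tuples k B \<subseteq> tuples k (A \<union> B)"
      by (auto simp: tuples_def)
    then have "\<beta> \<in> S \<inter> T"
      if "\<beta> \<in> alt_forms k E" "\<forall>vs \<in> tuples k (A \<union> B). \<bar>\<beta> vs - \<alpha> vs\<bar> < min a b" for \<beta>
      using that A(3)[of \<beta>] B(3)[of \<beta>] by (auto simp: subset_iff)
    moreover have "0 < min a b"
      using A(2) B(2) by simp
    ultimately show "\<exists>B \<epsilon>. bounded_in E B \<and> 0 < \<epsilon> \<and>
        (\<forall>\<beta> \<in> alt_forms k E. (\<forall>vs \<in> tuples k B. \<bar>\<beta> vs - \<alpha> vs\<bar> < \<epsilon>) \<longrightarrow> \<beta> \<in> S \<inter> T)"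
      using bounded_in_Un[OF A(1) B(1)] by blast
  qed
next
  fix K assume K: "\<forall>T\<in>K. alt_forms_open k E T"
  show "alt_forms_open k E (\<Union>K)"
    unfolding alt_forms_open_def
  proof (intro conjI ballI)
    show "\<Union>K \<subseteq> alt_forms k E"
      using K by (auto simp: alt_forms_open_def)
  next
    fix \<alpha> assume "\<alpha> \<in> \<Union>K"
    then obtain T where T: "T \<in> K" "\<alpha> \<in> T" by blast
    with K have "\<exists>B \<epsilon>. bounded_in E B \<and> 0 < \<epsilon> \<and>
        (\<forall>\<beta> \<in> alt_forms k E. (\<forall>vs \<in> tuples k B. \<bar>\<beta> vs - \<alpha> vs\<bar> < \<epsilon>) \<longrightarrow> \<beta> \<in> T)"
      unfolding alt_forms_open_def by blast
    then show "\<exists>B \<epsilon>. bounded_in E B \<and> 0 < \<epsilon> \<and>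
        (\<forall>\<beta> \<in> alt_forms k E. (\<forall>vs \<in> tuples k B. \<bar>\<beta> vs - \<alpha> vs\<bar> < \<epsilon>) \<longrightarrow> \<beta> \<in> \<Union>K)"
      using T(1) by blast
  qed
qed

lemma openin_alt_forms_topology:
  "openin (alt_forms_topology k E) T \<longleftrightarrow> alt_forms_open k E T"
  by (simp add: alt_forms_topology_def topology_inverse' istopology_alt_forms_open)


section \<open>Manifolds modelled on convenient vector spaces\<close>

record ('m, 'e) chart =
  chart_dom :: "'m set"
  chart_map :: "'m \<Rightarrow> 'e"
  chart_model :: "'e topology"

record ('m, 'e) manifold =
  points :: "'m set"
  atlas :: "('m, 'e) chart set"

abbreviation chart_inv :: "('m, 'e) chart \<Rightarrow> 'e \<Rightarrow> 'm" where
  "chart_inv u \<equiv> the_inv_into (chart_dom u) (chart_map u)"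

definition charts_at :: "('m, 'e) manifold \<Rightarrow> 'm \<Rightarrow> ('m, 'e) chart set" where
  "charts_at M p = {u \<in> atlas M. p \<in> chart_dom u}"

definition chart_on :: "'m set \<Rightarrow> ('m, 'e::real_vector) chart \<Rightarrow> bool" where
  "chart_on X u \<longleftrightarrow>
     chart_dom u \<subseteq> X \<and> convenient_space (chart_model u) \<and>
     inj_on (chart_map u) (chart_dom u) \<and>
     cinf_open (chart_model u) (chart_map u ` chart_dom u)"

text \<open>Smoothness of the inverse transition map is the same condition with \<open>u\<close> and \<open>v\<close> exchanged.\<close>

definition charts_compatible ::
    "('m, 'e::real_vector) chart \<Rightarrow> ('m, 'e) chart \<Rightarrow> bool" where
  "charts_compatible u v \<longleftrightarrow>
     cinf_open (chart_model u) (chart_map u ` (chart_dom u \<inter> chart_dom v)) \<and>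
     smooth_map_on (chart_map u ` (chart_dom u \<inter> chart_dom v)) (chart_model u) (chart_model v)
       (chart_map v \<circ> chart_inv u)"

definition manifold_open :: "('m, 'e::real_vector) manifold \<Rightarrow> 'm set \<Rightarrow> bool" where
  "manifold_open M A \<longleftrightarrow>
     A \<subseteq> points M \<and>
     (\<forall>u \<in> atlas M. cinf_open (chart_model u) (chart_map u ` (A \<inter> chart_dom u)))"

definition is_manifold :: "('m, 'e::real_vector) manifold \<Rightarrow> bool" where
  "is_manifold M \<longleftrightarrow>
     (\<forall>u \<in> atlas M. chart_on (points M) u) \<and>
     (\<Union>u \<in> atlas M. chart_dom u) = points M \<and>
     (\<forall>u \<in> atlas M. \<forall>v \<in> atlas M. charts_compatible u v) \<and>
     (\<forall>p \<in> points M. \<forall>q \<in> points M. p \<noteq> q \<longrightarrow>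
        (\<exists>A B. manifold_open M A \<and> manifold_open M B \<and> p \<in> A \<and> q \<in> B \<and> A \<inter> B = {}))"

definition infinite_dimensional :: "('m, 'e::real_vector) manifold \<Rightarrow> bool" where
  "infinite_dimensional M \<longleftrightarrow>
     (\<forall>u \<in> atlas M. chart_dom u \<noteq> {} \<longrightarrow>
        \<not> (\<exists>B. finite B \<and> span B = topspace (chart_model u)))"

definition prod_chart ::
    "('m, 'e) chart \<Rightarrow> ('n, 'f) chart \<Rightarrow> ('m \<times> 'n, 'e \<times> 'f) chart" where
  "prod_chart u v =
     \<lparr>chart_dom = chart_dom u \<times> chart_dom v,
      chart_map = map_prod (chart_map u) (chart_map v),
      chart_model = prod_topology (chart_model u) (chart_model v)\<rparr>"

definition prod_manifold ::
    "('m, 'e) manifold \<Rightarrow> ('n, 'f) manifold \<Rightarrow> ('m \<times> 'n, 'e \<times> 'f) manifold" where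
  "prod_manifold M N =
     \<lparr>points = points M \<times> points N,
      atlas = {prod_chart u v | u v. u \<in> atlas M \<and> v \<in> atlas N}\<rparr>"


section \<open>The kinematic tangent bundle\<close>

definition manifold_curve :: "('m, 'e::real_vector) manifold \<Rightarrow> (real \<Rightarrow> 'm) \<Rightarrow> bool" where
  "manifold_curve M c \<longleftrightarrow>
     range c \<subseteq> points M \<and>
     (\<forall>u \<in> atlas M. open (c -` chart_dom u) \<and>
        smooth_curve_on (c -` chart_dom u) (chart_model u) (chart_map u \<circ> c))"

text \<open>By the chain rule, the derivatives of two curves agree in all charts at a point as soon as
  they agree in one. Likewise \<open>tangent_lincomb\<close> and \<open>has_ext_derivative\<close> below, which are also stated
  for all charts, do not depend on the chart.\<close>

definition tangent_rel ::
    "('m, 'e::real_vector) manifold \<Rightarrow> ((real \<Rightarrow> 'm) \<times> (real \<Rightarrow> 'm)) set" where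
  "tangent_rel M = {(c, c').
     manifold_curve M c \<and> manifold_curve M c' \<and> c 0 = c' 0 \<and>
     (\<forall>u \<in> charts_at M (c 0). \<exists>v.
        has_curve_derivative (chart_model u) (chart_map u \<circ> c) v 0 \<and>
        has_curve_derivative (chart_model u) (chart_map u \<circ> c') v 0)}"

type_synonym 'm tangent = "(real \<Rightarrow> 'm) set"

definition tangent_space :: "('m, 'e::real_vector) manifold \<Rightarrow> 'm \<Rightarrow> 'm tangent set" where
  "tangent_space M p = {c. manifold_curve M c \<and> c 0 = p} // tangent_rel M"

definition tangent_zero :: "('m, 'e::real_vector) manifold \<Rightarrow> 'm \<Rightarrow> 'm tangent" where
  "tangent_zero M p = tangent_rel M `` {\<lambda>_. p}"

definition chart_velocity :: "('m, 'e::real_vector) chart \<Rightarrow> 'm tangent \<Rightarrow> 'e" where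
  "chart_velocity u X =
     (THE v. \<forall>c\<in>X. has_curve_derivative (chart_model u) (chart_map u \<circ> c) v 0)"

text \<open>The tangent vector at \<open>p\<close> represented by \<open>v\<close> in the chart \<open>u\<close>: the class of the curves that
  coincide near \<open>0\<close> with the coordinate line through \<open>p\<close> in direction \<open>v\<close>.\<close>

definition chart_tangent ::
    "('m, 'e::real_vector) manifold \<Rightarrow> ('m, 'e) chart \<Rightarrow> 'm \<Rightarrow> 'e \<Rightarrow> 'm tangent" where
  "chart_tangent M u p v =
     (THE X. X \<in> tangent_space M p \<and>
        (\<exists>c\<in>X. \<forall>\<^sub>F t in nhds 0. c t \<in> chart_dom u \<and> chart_map u (c t) = chart_map u p + t *\<^sub>R v))"

text \<open>\<open>X = a Y + b Z\<close> in the vector space structure that the charts induce on \<open>T\<^sub>pM\<close>.\<close>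

definition tangent_lincomb ::
    "('m, 'e::real_vector) manifold \<Rightarrow> 'm \<Rightarrow> 'm tangent \<Rightarrow> real \<Rightarrow> 'm tangent \<Rightarrow> real \<Rightarrow> 'm tangent
      \<Rightarrow> bool" where
  "tangent_lincomb M p X a Y b Z \<longleftrightarrow>
     X \<in> tangent_space M p \<and> Y \<in> tangent_space M p \<and> Z \<in> tangent_space M p \<and>
     (\<forall>u \<in> charts_at M p.
        chart_velocity u X = a *\<^sub>R chart_velocity u Y + b *\<^sub>R chart_velocity u Z)"

text \<open>On the class of \<open>c\<close>, for smooth \<open>f\<close> into \<open>N\<close>, this is the class of \<open>f \<circ> c\<close>.\<close>

definition tangent_map ::
    "('n, 'f::real_vector) manifold \<Rightarrow> ('m \<Rightarrow> 'n) \<Rightarrow> 'm tangent \<Rightarrow> 'n tangent" where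
  "tangent_map N f X = tangent_rel N `` ((\<lambda>c. f \<circ> c) ` X)"


section \<open>Differential forms\<close>

definition chart_form ::
    "('m, 'e::real_vector) manifold \<Rightarrow> ('m, 'e) chart \<Rightarrow> nat \<Rightarrow> 'm \<Rightarrow> ('m tangent list \<Rightarrow> real)
      \<Rightarrow> 'e list \<Rightarrow> real" where
  "chart_form M u k p \<alpha> vs =
     (if vs \<in> tuples k (topspace (chart_model u)) then \<alpha> (map (chart_tangent M u p) vs) else 0)"

text \<open>Continuous alternating \<open>k\<close>-linear forms on \<open>T\<^sub>pM\<close>; for \<open>k = 1\<close> this is the dual \<open>(T\<^sub>pM)'\<close>.
  Values outside of \<open>(T\<^sub>pM)\<^sup>k\<close> are irrelevant.\<close>

definition form_at ::
    "('m, 'e::real_vector) manifold \<Rightarrow> nat \<Rightarrow> 'm \<Rightarrow> ('m tangent list \<Rightarrow> real) \<Rightarrow> bool" where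
  "form_at M k p \<alpha> \<longleftrightarrow>
     (\<forall>Xs \<in> tuples k (tangent_space M p). \<forall>i<k. \<forall>X a Y b Z. tangent_lincomb M p X a Y b Z \<longrightarrow>
        \<alpha> (Xs[i := X]) = a * \<alpha> (Xs[i := Y]) + b * \<alpha> (Xs[i := Z])) \<and>
     (\<forall>Xs \<in> tuples k (tangent_space M p). \<not> distinct Xs \<longrightarrow> \<alpha> Xs = 0) \<and>
     (\<forall>u \<in> charts_at M p. chart_form M u k p \<alpha> \<in> alt_forms k (chart_model u))"

type_synonym 'm form = "'m \<Rightarrow> 'm tangent list \<Rightarrow> real"

definition local_form ::
    "('m, 'e::real_vector) manifold \<Rightarrow> ('m, 'e) chart \<Rightarrow> nat \<Rightarrow> 'm form \<Rightarrow> 'e \<Rightarrow> 'e list \<Rightarrow> real" where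
  "local_form M u k \<omega> x = chart_form M u k (chart_inv u x) (\<omega> (chart_inv u x))"

definition Forms :: "('m, 'e::real_vector) manifold \<Rightarrow> nat \<Rightarrow> 'm form set" where
  "Forms M k = {\<omega>.
     (\<forall>p \<in> points M. form_at M k p (\<omega> p)) \<and>
     (\<forall>u \<in> atlas M. smooth_map_on (chart_map u ` chart_dom u) (chart_model u)
        (alt_forms_topology k (chart_model u)) (local_form M u k \<omega>))}"

definition pullback ::
    "('n, 'f::real_vector) manifold \<Rightarrow> ('m \<Rightarrow> 'n) \<Rightarrow> 'n form \<Rightarrow> 'm form" where
  "pullback N f \<omega> = (\<lambda>p Xs. \<omega> (f p) (map (tangent_map N f) Xs))"

text \<open>\<open>\<zeta> = d\<omega>\<close> for a \<open>k\<close>-form \<open>\<omega>\<close>: in every chart,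
  \<open>\<zeta>(x)(v\<^sub>0,\<dots>,v\<^sub>k) = \<Sum>\<^sub>i (-1)\<^sup>i D\<omega>(x)(v\<^sub>i)(v\<^sub>0,\<dots>,v\<^sub>i\<^sub>-\<^sub>1,v\<^sub>i\<^sub>+\<^sub>1,\<dots>,v\<^sub>k)\<close>.\<close>

definition has_ext_derivative ::
    "('m, 'e::real_vector) manifold \<Rightarrow> nat \<Rightarrow> 'm form \<Rightarrow> 'm form \<Rightarrow> bool" where
  "has_ext_derivative M k \<omega> \<zeta> \<longleftrightarrow>
     (\<forall>u \<in> atlas M. \<forall>x \<in> chart_map u ` chart_dom u. \<forall>vs \<in> tuples (Suc k) (topspace (chart_model u)).
        local_form M u (Suc k) \<zeta> x vs =
          (\<Sum>i\<le>k. (-1) ^ i *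
             deriv (\<lambda>t. local_form M u k \<omega> (x + t *\<^sub>R vs ! i) (take i vs @ drop (Suc i) vs)) 0))"


section \<open>Weakly symplectic and contact manifolds\<close>

definition weakly_symplectic :: "('m, 'e::real_vector) manifold \<Rightarrow> 'm form \<Rightarrow> bool" where
  "weakly_symplectic M \<omega> \<longleftrightarrow>
     is_manifold M \<and> \<omega> \<in> Forms M 2 \<and> has_ext_derivative M 2 \<omega> (\<lambda>_ _. 0) \<and>
     (\<forall>p \<in> points M.
        (\<forall>X \<in> tangent_space M p. form_at M 1 p (\<lambda>Ys. \<omega> p (X # Ys))) \<and>
        (\<forall>X \<in> tangent_space M p. \<forall>X' \<in> tangent_space M p.
           (\<forall>Y \<in> tangent_space M p. \<omega> p [X, Y] = \<omega> p [X', Y]) \<longrightarrow> X = X'))"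

definition horizontal :: "('m, 'e::real_vector) manifold \<Rightarrow> 'm form \<Rightarrow> 'm \<Rightarrow> 'm tangent set" where
  "horizontal N \<eta> p = {X \<in> tangent_space N p. \<eta> p [X] = 0}"

definition vertical :: "('m, 'e::real_vector) manifold \<Rightarrow> 'm form \<Rightarrow> 'm \<Rightarrow> 'm tangent set" where
  "vertical N \<zeta> p = {X \<in> tangent_space N p. \<forall>Y \<in> tangent_space N p. \<zeta> p [X, Y] = 0}"

definition splits_tangent ::
    "('m, 'e::real_vector) manifold \<Rightarrow> 'm form \<Rightarrow> 'm form \<Rightarrow> 'm \<Rightarrow> bool" where
  "splits_tangent N \<eta> \<zeta> p \<longleftrightarrow>
     (\<forall>X \<in> tangent_space N p.
        \<exists>!(Y, Z). Y \<in> horizontal N \<eta> p \<and> Z \<in> vertical N \<zeta> p \<and> tangent_lincomb N p X 1 Y 1 Z)"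

definition nondegenerate_on_horizontal ::
    "('m, 'e::real_vector) manifold \<Rightarrow> 'm form \<Rightarrow> 'm form \<Rightarrow> 'm \<Rightarrow> bool" where
  "nondegenerate_on_horizontal N \<eta> \<zeta> p \<longleftrightarrow>
     (\<forall>X \<in> horizontal N \<eta> p. (\<forall>Y \<in> horizontal N \<eta> p. \<zeta> p [X, Y] = 0) \<longrightarrow> X = tangent_zero N p)"

definition flat :: "'m form \<Rightarrow> 'm form \<Rightarrow> 'm \<Rightarrow> 'm tangent \<Rightarrow> 'm tangent list \<Rightarrow> real" where
  "flat \<eta> \<zeta> p X = (\<lambda>Ys. \<zeta> p (X # Ys) + \<eta> p [X] * \<eta> p Ys)"

definition flat_injective ::
    "('m, 'e::real_vector) manifold \<Rightarrow> 'm form \<Rightarrow> 'm form \<Rightarrow> 'm \<Rightarrow> bool" where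
  "flat_injective N \<eta> \<zeta> p \<longleftrightarrow>
     (\<forall>X \<in> tangent_space N p. form_at N 1 p (flat \<eta> \<zeta> p X)) \<and>
     (\<forall>X a Y b Z. tangent_lincomb N p X a Y b Z \<longrightarrow>
        (\<forall>W \<in> tangent_space N p.
           flat \<eta> \<zeta> p X [W] = a * flat \<eta> \<zeta> p Y [W] + b * flat \<eta> \<zeta> p Z [W])) \<and>
     (\<forall>X \<in> tangent_space N p. \<forall>X' \<in> tangent_space N p.
        (\<forall>W \<in> tangent_space N p. flat \<eta> \<zeta> p X [W] = flat \<eta> \<zeta> p X' [W]) \<longrightarrow> X = X')"

text \<open>Given that \<open>d\<eta>\<close> has non-zero kernel, the last three conditions are equivalent; we
  require all of them. Smoothness of \<open>flat\<close> as a bundle map follows from that of \<open>\<eta>\<close> and \<open>d\<eta>\<close>.\<close>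

definition contact_form :: "('m, 'e::real_vector) manifold \<Rightarrow> 'm form \<Rightarrow> bool" where
  "contact_form N \<eta> \<longleftrightarrow>
     \<eta> \<in> Forms N 1 \<and>
     (\<exists>\<zeta> \<in> Forms N 2. has_ext_derivative N 1 \<eta> \<zeta> \<and>
        (\<forall>p \<in> points N.
           vertical N \<zeta> p - {tangent_zero N p} \<noteq> {} \<and>
           splits_tangent N \<eta> \<zeta> p \<and>
           nondegenerate_on_horizontal N \<eta> \<zeta> p \<and>
           flat_injective N \<eta> \<zeta> p))"

definition contact_manifold :: "('m, 'e::real_vector) manifold \<Rightarrow> 'm form \<Rightarrow> bool" where
  "contact_manifold N \<eta> \<longleftrightarrow> is_manifold N \<and> contact_form N \<eta>"


section \<open>The line and the circle\<close>

definition real_line :: "(real, real) manifold" where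
  "real_line =
     \<lparr>points = UNIV,
      atlas = {\<lparr>chart_dom = UNIV, chart_map = (\<lambda>z. z), chart_model = euclideanreal\<rparr>}\<rparr>"

text \<open>The coordinate \<open>z\<close> on the circle is the angle, determined up to multiples of \<open>2\<pi>\<close>; the charts
  are its branches.\<close>

definition angle_chart :: "real \<Rightarrow> (complex, real) chart" where
  "angle_chart a =
     \<lparr>chart_dom = cis ` {a<..<a + 2 * pi},
      chart_map = the_inv_into {a<..<a + 2 * pi} cis,
      chart_model = euclideanreal\<rparr>"

definition circle :: "(complex, real) manifold" where
  "circle = \<lparr>points = sphere 0 1, atlas = range angle_chart\<rparr>"

text \<open>The 1-form \<open>dz\<close>, which is the same for all charts \<open>z\<close> of \<open>real_line\<close> resp. \<open>circle\<close>, as these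
  differ by constants.\<close>

definition coord_form :: "('m, real) manifold \<Rightarrow> 'm form" where
  "coord_form L p Xs = (THE r. \<forall>z \<in> charts_at L p. chart_velocity z (Xs ! 0) = r)"

definition contactization_form ::
    "('l, real) manifold \<Rightarrow> ('m, 'e::real_vector) manifold \<Rightarrow> 'm form \<Rightarrow> ('l \<times> 'm) form" where
  "contactization_form L M \<theta> =
     (\<lambda>p Xs. pullback L fst (coord_form L) p Xs + pullback M snd \<theta> p Xs)"

end

theory Submission
  imports Defs
begin

text \<open>Write \<open>dz\<close> for the coordinate form and \<open>\<omega> = d\<theta>\<close>. The tangent space of the product at \<open>(p, q)\<close>
  is \<open>T\<^sub>pL \<times> T\<^sub>qM\<close>, and \<open>dz\<close> identifies \<open>T\<^sub>pL\<close> with the reals. As \<open>dz\<close> is constant in the charts,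
  \<open>d\<eta>\<close> is the pullback of \<open>\<omega>\<close>, so by weak nondegeneracy of \<open>\<omega>\<close> its kernel is \<open>T\<^sub>pL \<times> 0\<close>, and
  \<open>\<eta> (Z, X) = dz Z + \<theta> X\<close> shows that \<open>ker \<eta>\<close> is the graph of \<open>- \<theta>\<close> over \<open>T\<^sub>qM\<close>, a complement of
  that kernel. The chain rule for smooth maps between convenient spaces is never needed: only the
  projections are differentiated, and these are linear in product charts. What is needed is that
  every vector in a chart is the velocity of a globally defined curve, which is obtained by
  reparametrising coordinate lines with a bounded smooth function that is the identity near \<open>0\<close>.\<close>

section \<open>Calculus of curves\<close>

text \<open>In the coordinates \<open>z\<close> (the value of dz) and \<open>\<pi>\<close> (the
  component tangent to M) of a tangent vector of the product, all conditions become linear algebra.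
  The vector \<open>V\<close> with \<open>z V = 1\<close> and \<open>\<pi> V = O2\<close> is the
  Reeb vector: it spans the kernel of d\<eta>, \<eta> is \<open>1\<close> on it, and every X is the
  sum of a horizontal vector over \<open>\<pi> X\<close> and \<eta>(X) times \<open>V\<close>.
  Testing \<open>flat\<close> on \<open>V\<close> returns \<eta>(X), after which weak nondegeneracy
  of \<omega> returns \<open>\<pi> X\<close>. The obstacle is to reach these coordinates. A tangent
  space is a set of classes of curves without operations of its own: linear combinations are a
  relation, and velocities are compared in all charts at once. On the product this is harmless
  because its atlas holds only product charts, in which a velocity is the pair of the velocities of
  the projections. For forms, smoothness means smoothness of curves in a space of forms with uniform
  convergence on bounded sets; such curves are only ever added, held constant or moved by a
  continuous linear map, and each of these keeps smoothness for an elementary reason.\<close>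

lemma has_curve_derivative_real_iff:
  "has_curve_derivative euclideanreal c v t \<longleftrightarrow> (c has_real_derivative v) (at t)"
  by (simp add: has_curve_derivative_def DERIV_def divide_inverse mult.commute)

lemma has_curve_derivative_unique:
  assumes "Hausdorff_space E" "has_curve_derivative E c v t" "has_curve_derivative E c w t"
  shows "v = w"
  using assms limitin_Hausdorff_unique[of E _ v "at (0::real)" w]
  by (auto simp: has_curve_derivative_def)

lemma has_curve_derivative_topspace: "has_curve_derivative E c v t \<Longrightarrow> v \<in> topspace E"
  unfolding has_curve_derivative_def by (rule limitin_topspace)

lemma has_curve_derivative_cong:
  assumes "has_curve_derivative E c v t" and eq: "\<forall>\<^sub>F s in nhds t. c s = c' s"
  shows "has_curve_derivative E c' v t"
proof -
  have "((\<lambda>h. t + h) \<longlongrightarrow> t) (at 0)"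
    by (auto intro!: tendsto_eq_intros)
  then have "\<forall>\<^sub>F h in at 0. c (t + h) = c' (t + h)"
    by (rule eventually_compose_filterlim[OF eq])
  moreover have "c t = c' t"
    using eq by (rule eventually_nhds_x_imp_x)
  ultimately have "\<forall>\<^sub>F h in at 0. (c (t + h) - c t) /\<^sub>R h = (c' (t + h) - c' t) /\<^sub>R h"
    by (simp add: eventually_mono)
  then show ?thesis
    using assms(1) unfolding has_curve_derivative_def by (rule limitin_transform_eventually)
qed

lemma has_curve_derivative_linear:
  assumes "has_curve_derivative E c v t" "linear P" "continuous_map E F P"
  shows "has_curve_derivative F (P \<circ> c) (P v) t"
proof -
  have "limitin F (P \<circ> (\<lambda>h. (c (t + h) - c t) /\<^sub>R h)) (P v) (at 0)"
    using assms unfolding has_curve_derivative_def by (blast intro: continuous_map_limit)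
  then show ?thesis
    by (simp add: has_curve_derivative_def o_def linear_cmul[OF assms(2)] linear_diff[OF assms(2)])
qed

lemma smooth_curve_on_linear:
  assumes "smooth_curve_on J E c" "linear P" "continuous_map E F P"
  shows "smooth_curve_on J F (P \<circ> c)"
proof -
  obtain d where d: "d 0 = c"
    "\<And>n t. t \<in> J \<Longrightarrow> d n t \<in> topspace E \<and> has_curve_derivative E (d n) (d (Suc n) t) t"
    using assms(1) unfolding smooth_curve_on_def by blast
  have "P v \<in> topspace F" if "v \<in> topspace E" for v
    using assms(3) that by (auto simp: continuous_map_def)
  then show ?thesis
    unfolding smooth_curve_on_def
    using d has_curve_derivative_linear[OF _ assms(2,3)]
    by (intro exI[of _ "\<lambda>n. P \<circ> d n"]) (auto simp: o_def)
qed

lemma has_curve_derivative_prod_iff: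
  "has_curve_derivative (prod_topology E F) c v t \<longleftrightarrow>
     has_curve_derivative E (fst \<circ> c) (fst v) t \<and> has_curve_derivative F (snd \<circ> c) (snd v) t"
  by (simp add: has_curve_derivative_def limitin_pairwise o_def)

lemma smooth_curve_on_prod_iff:
  "smooth_curve_on J (prod_topology E F) c \<longleftrightarrow>
     smooth_curve_on J E (fst \<circ> c) \<and> smooth_curve_on J F (snd \<circ> c)" (is "?L \<longleftrightarrow> ?R")
proof
  assume ?L
  then show ?R
    using smooth_curve_on_linear[OF \<open>?L\<close> linear_fst continuous_map_fst]
      smooth_curve_on_linear[OF \<open>?L\<close> linear_snd continuous_map_snd] by blast
next
  assume ?R
  then obtain d d' where d: "d 0 = fst \<circ> c" "d' 0 = snd \<circ> c"
    "\<And>n t. t \<in> J \<Longrightarrow> d n t \<in> topspace E \<and> has_curve_derivative E (d n) (d (Suc n) t) t"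
    "\<And>n t. t \<in> J \<Longrightarrow> d' n t \<in> topspace F \<and> has_curve_derivative F (d' n) (d' (Suc n) t) t"
    unfolding smooth_curve_on_def by auto
  show ?L
    unfolding smooth_curve_on_def
    by (rule exI[of _ "\<lambda>n t. (d n t, d' n t)"])
      (use d in \<open>auto simp: has_curve_derivative_prod_iff o_def\<close>)
qed

lemma smooth_curve_on_subset: "smooth_curve_on J E c \<Longrightarrow> I \<subseteq> J \<Longrightarrow> smooth_curve_on I E c"
  unfolding smooth_curve_on_def by blast

section \<open>Canonical iterated derivatives and locality of smoothness\<close>

definition curve_deriv :: "'e::real_vector topology \<Rightarrow> (real \<Rightarrow> 'e) \<Rightarrow> real \<Rightarrow> 'e" where
  "curve_deriv E c t = (SOME v. has_curve_derivative E c v t)"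

lemma curve_deriv_eq:
  assumes "Hausdorff_space E" "has_curve_derivative E c v t"
  shows "curve_deriv E c t = v"
  unfolding curve_deriv_def
  using assms by (blast intro: some_equality has_curve_derivative_unique)

text \<open>The sequence \<open>d\<close> in \<open>smooth_curve_on\<close> is chosen for the whole
  of \<open>J\<close>. In a Hausdorff space derivatives are unique, so over an open \<open>J\<close>
  it must agree there with the iterates of \<open>curve_deriv\<close>, which do not refer to
  \<open>J\<close>; smoothness thereby becomes a condition at each single time.\<close>

lemma smooth_curve_on_iff:
  assumes E: "Hausdorff_space E" and J: "open J"
  shows "smooth_curve_on J E c \<longleftrightarrow>
    (\<forall>n. \<forall>t\<in>J. (curve_deriv E ^^ n) c t \<in> topspace E \<and>
       has_curve_derivative E ((curve_deriv E ^^ n) c) ((curve_deriv E ^^ Suc n) c t) t)"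
    (is "?L \<longleftrightarrow> ?R")
proof
  assume ?R
  then show ?L
    unfolding smooth_curve_on_def by (intro exI[of _ "\<lambda>n. (curve_deriv E ^^ n) c"]) simp
next
  assume ?L
  then obtain d where d: "d 0 = c"
    "\<And>n t. t \<in> J \<Longrightarrow> d n t \<in> topspace E \<and> has_curve_derivative E (d n) (d (Suc n) t) t"
    unfolding smooth_curve_on_def by auto
  have step: "has_curve_derivative E ((curve_deriv E ^^ n) c) (d (Suc n) t) t"
    if "\<forall>s\<in>J. (curve_deriv E ^^ n) c s = d n s" "t \<in> J" for n t
  proof (rule has_curve_derivative_cong)
    show "has_curve_derivative E (d n) (d (Suc n) t) t"
      using d that by blast
    show "\<forall>\<^sub>F s in nhds t. d n s = (curve_deriv E ^^ n) c s"
      using that eventually_nhds_in_open[OF J] by (force elim: eventually_mono)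
  qed
  have eq: "\<forall>t\<in>J. (curve_deriv E ^^ n) c t = d n t" for n
  proof (induction n)
    case (Suc n)
    then show ?case
      using curve_deriv_eq[OF E step] by simp
  qed (simp add: d)
  show ?R
  proof (intro allI ballI)
    fix n t assume "t \<in> J"
    then show "(curve_deriv E ^^ n) c t \<in> topspace E \<and>
        has_curve_derivative E ((curve_deriv E ^^ n) c) ((curve_deriv E ^^ Suc n) c t) t"
      using step[OF eq, of t n] eq[of n] eq[of "Suc n"] d by metis
  qed
qed

lemma smooth_curve_on_cong:
  assumes "Hausdorff_space E" "open J" "smooth_curve_on J E c" "\<And>t. t \<in> J \<Longrightarrow> c t = c' t"
  shows "smooth_curve_on J E c'"
proof -
  obtain d where d: "d 0 = c"
    "\<And>n t. t \<in> J \<Longrightarrow> d n t \<in> topspace E \<and> has_curve_derivative E (d n) (d (Suc n) t) t"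
    using assms(3) unfolding smooth_curve_on_def by auto
  have "\<forall>\<^sub>F s in nhds t. c s = c' s" if "t \<in> J" for t
    using eventually_nhds_in_open[OF assms(2) that] assms(4) by (force elim: eventually_mono)
  then have "has_curve_derivative E c' (d (Suc 0) t) t" if "t \<in> J" for t
    using has_curve_derivative_cong d that by metis
  \<comment> \<open>Only entry \<open>0\<close> is replaced: it has to equal \<open>c'\<close> also
    outside \<open>J\<close>, while on the open set \<open>J\<close> the derivatives of
    \<open>c'\<close> are those of \<open>c\<close>.\<close>
  then have "(d(0 := c')) n t \<in> topspace E \<and>
      has_curve_derivative E ((d(0 := c')) n) ((d(0 := c')) (Suc n) t) t" if "t \<in> J" for n t
    using d(2)[OF that, of n] d(1) assms(4)[OF that] that by (cases n) auto
  then show ?thesis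
    unfolding smooth_curve_on_def by (intro exI[of _ "d(0 := c')"]) simp
qed

text \<open>Instead of gluing local derivative sequences, \<open>smooth_curve_on_iff\<close> reduces
  the claim to single times, where the canonical derivatives of \<open>c\<close> can be read off any
  neighbourhood on which \<open>c\<close> agrees with a smooth curve.\<close>

lemma smooth_curve_on_local:
  assumes E: "Hausdorff_space E" and "open J"
    and loc: "\<And>t. t \<in> J \<Longrightarrow> \<exists>I c'. open I \<and> t \<in> I \<and> smooth_curve_on I E c' \<and> (\<forall>s\<in>I. c' s = c s)"
  shows "smooth_curve_on J E c"
proof (subst smooth_curve_on_iff[OF E \<open>open J\<close>], intro allI ballI)
  fix n t assume "t \<in> J"
  then obtain I c' where I: "open I" "t \<in> I" "smooth_curve_on I E c'" "\<forall>s\<in>I. c' s = c s"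
    using loc by blast
  then have "smooth_curve_on I E c"
    using smooth_curve_on_cong[OF E] by blast
  then show "(curve_deriv E ^^ n) c t \<in> topspace E \<and>
      has_curve_derivative E ((curve_deriv E ^^ n) c) ((curve_deriv E ^^ Suc n) c t) t"
    using smooth_curve_on_iff[OF E \<open>open I\<close>] I by blast
qed

text \<open>Differentiability of finite order on the whole line. Unlike the sequence in
  \<open>smooth_curve_on\<close> it is recursive in the order, so sums, products and composites can
  be treated by induction on \<open>n\<close> without formulas for higher derivatives.\<close>

fun times_differentiable :: "nat \<Rightarrow> 'e::real_vector topology \<Rightarrow> (real \<Rightarrow> 'e) \<Rightarrow> bool" where
  "times_differentiable 0 E c \<longleftrightarrow> range c \<subseteq> topspace E"
| "times_differentiable (Suc n) E c \<longleftrightarrow> range c \<subseteq> topspace E \<and>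
     (\<exists>c'. (\<forall>t. has_curve_derivative E c (c' t) t) \<and> times_differentiable n E c')"

lemma smooth_curve_times_differentiable:
  assumes "smooth_curve_on UNIV E c"
  shows "times_differentiable n E c"
proof -
  obtain d where d: "d 0 = c"
    "\<And>n t. d n t \<in> topspace E \<and> has_curve_derivative E (d n) (d (Suc n) t) t"
    using assms unfolding smooth_curve_on_def by auto
  have "times_differentiable n E (d m)" for m
    by (induction n arbitrary: m) (use d in auto)
  from this[of 0] show ?thesis
    by (simp add: d)
qed

text \<open>The witnesses \<open>c'\<close> for different orders are unrelated a priori; by
  uniqueness of derivatives in a Hausdorff space each of them is \<open>curve_deriv\<close>, so they
  form one sequence.\<close>

lemma times_differentiable_smooth_curve:
  assumes E: "Hausdorff_space E" and "\<And>n. times_differentiable n E c"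
  shows "smooth_curve_on UNIV E c"
proof (subst smooth_curve_on_iff[OF E open_UNIV], intro allI ballI)
  fix n t
  have *: "times_differentiable m E ((curve_deriv E ^^ n) c)" for m
  proof (induction n arbitrary: m)
    case (Suc n)
    then have "times_differentiable (Suc m) E ((curve_deriv E ^^ n) c)"
      by blast
    then obtain c' where c': "\<forall>t. has_curve_derivative E ((curve_deriv E ^^ n) c) (c' t) t"
      "times_differentiable m E c'"
      by auto
    then have "curve_deriv E ((curve_deriv E ^^ n) c) = c'"
      using curve_deriv_eq[OF E] by blast
    then show ?case
      using c' by simp
  qed (simp add: assms)
  from *[of 1] obtain c' where c': "\<forall>t. has_curve_derivative E ((curve_deriv E ^^ n) c) (c' t) t"
    by auto
  then have "curve_deriv E ((curve_deriv E ^^ n) c) = c'"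
    using curve_deriv_eq[OF E] by blast
  then show "(curve_deriv E ^^ n) c t \<in> topspace E \<and>
      has_curve_derivative E ((curve_deriv E ^^ n) c) ((curve_deriv E ^^ Suc n) c t) t"
    using c' *[of 0] by auto
qed

lemma times_differentiable_Suc_imp: "times_differentiable (Suc n) E c \<Longrightarrow> times_differentiable n E c"
  by (induction n arbitrary: c) (simp, metis times_differentiable.simps(2))

lemma limitin_add:
  assumes "topological_vector_space E" "limitin E f l F" "limitin E g m F"
  shows "limitin E (\<lambda>x. f x + g x) (l + m) F"
proof -
  have "limitin (prod_topology E E) (\<lambda>x. (f x, g x)) (l, m) F"
    using assms by (simp add: limitin_pairwise o_def)
  moreover have "continuous_map (prod_topology E E) E (\<lambda>(x, y). x + y)"
    using assms by (simp add: topological_vector_space_def)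
  ultimately show ?thesis
    using continuous_map_limit by (fastforce simp: o_def)
qed

lemma limitin_scaleR:
  assumes "topological_vector_space E" "(a \<longlongrightarrow> b) F" "limitin E f l F"
  shows "limitin E (\<lambda>x. a x *\<^sub>R f x) (b *\<^sub>R l) F"
proof -
  have "limitin (prod_topology euclideanreal E) (\<lambda>x. (a x, f x)) (b, l) F"
    using assms by (simp add: limitin_pairwise o_def)
  moreover have "continuous_map (prod_topology euclideanreal E) E (\<lambda>(a, x). a *\<^sub>R x)"
    using assms by (simp add: topological_vector_space_def)
  ultimately show ?thesis
    using continuous_map_limit by (fastforce simp: o_def)
qed

lemma times_differentiable_add:
  assumes E: "topological_vector_space E"
    and "times_differentiable n E f" "times_differentiable n E g"
  shows "times_differentiable n E (\<lambda>t. f t + g t)"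
  using assms(2,3)
proof (induction n arbitrary: f g)
  case 0
  then show ?case
    using E by (auto simp: topological_vector_space_def intro!: subspace_add)
next
  case (Suc n)
  then obtain f' g' where "\<forall>t. has_curve_derivative E f (f' t) t" "times_differentiable n E f'"
    "\<forall>t. has_curve_derivative E g (g' t) t" "times_differentiable n E g'"
    by auto
  moreover have "has_curve_derivative E (\<lambda>t. f t + g t) (f' t + g' t) t"
    if "has_curve_derivative E f (f' t) t" "has_curve_derivative E g (g' t) t" for t
    using limitin_add[OF E that[unfolded has_curve_derivative_def]]
    by (simp add: has_curve_derivative_def algebra_simps)
  moreover have "range (\<lambda>t. f t + g t) \<subseteq> topspace E"
    using Suc.prems E by (auto simp: topological_vector_space_def intro!: subspace_add)
  ultimately show ?case
    using Suc.IH[of f' g'] by (auto intro!: exI[of _ "\<lambda>t. f' t + g' t"])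
qed

lemma times_differentiable_scaleR:
  assumes E: "topological_vector_space E"
    and "times_differentiable n euclideanreal a" "times_differentiable n E c"
  shows "times_differentiable n E (\<lambda>t. a t *\<^sub>R c t)"
  using assms(2,3)
proof (induction n arbitrary: a c)
  case 0
  then show ?case
    using E by (auto simp: topological_vector_space_def subspace_scale)
next
  case (Suc n)
  then obtain a' c' where d: "\<And>t. (a has_real_derivative a' t) (at t)"
    "times_differentiable n euclideanreal a'"
    "\<And>t. has_curve_derivative E c (c' t) t" "times_differentiable n E c'"
    by (auto simp: has_curve_derivative_real_iff)
  have top: "c t \<in> topspace E" for t
    using Suc.prems by auto
  have "has_curve_derivative E (\<lambda>t. a t *\<^sub>R c t) (a t *\<^sub>R c' t + a' t *\<^sub>R c t) t" for t
  proof -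
    \<comment> \<open>The difference quotient of the product splits into a(t + h) times that of
      \<open>c\<close> plus that of \<open>a\<close> times c(t).\<close>
    have "((\<lambda>h. a (t + h)) \<longlongrightarrow> a t) (at 0)"
      using DERIV_isCont[OF d(1)[of t]] by (simp add: isCont_iff)
    then have "limitin E (\<lambda>h. a (t + h) *\<^sub>R ((c (t + h) - c t) /\<^sub>R h)) (a t *\<^sub>R c' t) (at 0)"
      using d(3)[of t] unfolding has_curve_derivative_def by (rule limitin_scaleR[OF E])
    moreover have "((\<lambda>h. (a (t + h) - a t) / h) \<longlongrightarrow> a' t) (at 0)"
      using d(1)[of t] by (simp add: DERIV_def)
    then have "limitin E (\<lambda>h. ((a (t + h) - a t) / h) *\<^sub>R c t) (a' t *\<^sub>R c t) (at 0)"
      using top by (intro limitin_scaleR[OF E]) auto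
    ultimately have "limitin E (\<lambda>h. a (t + h) *\<^sub>R ((c (t + h) - c t) /\<^sub>R h) +
        ((a (t + h) - a t) / h) *\<^sub>R c t) (a t *\<^sub>R c' t + a' t *\<^sub>R c t) (at 0)"
      by (rule limitin_add[OF E])
    then show ?thesis
      by (simp add: has_curve_derivative_def divide_inverse algebra_simps)
  qed
  moreover have "times_differentiable n E (\<lambda>t. a t *\<^sub>R c' t + a' t *\<^sub>R c t)"
    using Suc.IH[of a c'] Suc.IH[of a' c] d times_differentiable_Suc_imp[OF Suc.prems(1)]
      times_differentiable_Suc_imp[OF Suc.prems(2)]
    by (intro times_differentiable_add[OF E]) auto
  moreover have "range (\<lambda>t. a t *\<^sub>R c t) \<subseteq> topspace E"
    using top E by (auto simp: topological_vector_space_def subspace_scale)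
  ultimately show ?case
    by (auto intro!: exI[of _ "\<lambda>t. a t *\<^sub>R c' t + a' t *\<^sub>R c t"])
qed

lemma has_curve_derivative_chain:
  assumes E: "topological_vector_space E"
    and c: "has_curve_derivative E c v (f t)" and f: "(f has_real_derivative r) (at t)"
  shows "has_curve_derivative E (c \<circ> f) (r *\<^sub>R v) t"
proof -
  \<comment> \<open>Caratheodory's form of the difference quotient: with the value \<open>v\<close>
    at \<open>0\<close> it can be composed with \<open>f (t + h) - f t\<close>, which may vanish for
    \<open>h \<noteq> 0\<close>.\<close>
  define q where "q k = (if k = 0 then v else (c (f t + k) - c (f t)) /\<^sub>R k)" for k
  have "v \<in> topspace E"
    using c by (rule has_curve_derivative_topspace)
  have "\<forall>\<^sub>F k in at 0. (c (f t + k) - c (f t)) /\<^sub>R k = q k"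
    by (simp add: eventually_at_filter q_def)
  then have q: "limitin E q v (at 0)"
    using c unfolding has_curve_derivative_def by (rule limitin_transform_eventually)
  have lim: "((\<lambda>h. f (t + h) - f t) \<longlongrightarrow> 0) (at 0)"
    using DERIV_isCont[OF f] by (simp add: isCont_iff LIM_zero)
  have "limitin E (\<lambda>h. q (f (t + h) - f t)) v (at 0)"
    unfolding limitin_def
  proof (intro conjI allI impI)
    fix U assume U: "openin E U \<and> v \<in> U"
    then have "\<forall>\<^sub>F k in at 0. q k \<in> U"
      using q by (simp add: limitin_def)
    then have "\<forall>\<^sub>F k in nhds 0. q k \<in> U"
      using U by (auto simp: eventually_at_filter q_def elim: eventually_mono)
    then show "\<forall>\<^sub>F h in at 0. q (f (t + h) - f t) \<in> U"
      by (rule eventually_compose_filterlim[OF _ lim])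
  qed fact
  moreover have "((\<lambda>h. (f (t + h) - f t) / h) \<longlongrightarrow> r) (at 0)"
    using f by (simp add: DERIV_def)
  ultimately have "limitin E (\<lambda>h. ((f (t + h) - f t) / h) *\<^sub>R q (f (t + h) - f t)) (r *\<^sub>R v) (at 0)"
    by (intro limitin_scaleR[OF E])
  moreover have "((f (t + h) - f t) / h) *\<^sub>R q (f (t + h) - f t) = (c (f (t + h)) - c (f t)) /\<^sub>R h" for h
    by (simp add: q_def divide_inverse)
  ultimately show ?thesis
    by (simp add: has_curve_derivative_def)
qed

lemma times_differentiable_compose:
  assumes E: "topological_vector_space E"
    and "times_differentiable n E c" "times_differentiable n euclideanreal f"
  shows "times_differentiable n E (c \<circ> f)"
  using assms(2,3)
proof (induction n arbitrary: c f)
  case (Suc n)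
  then obtain f' c' where d: "\<And>t. (f has_real_derivative f' t) (at t)"
    "times_differentiable n euclideanreal f'"
    "\<And>t. has_curve_derivative E c (c' t) t" "times_differentiable n E c'"
    by (auto simp: has_curve_derivative_real_iff)
  have "has_curve_derivative E (c \<circ> f) (f' t *\<^sub>R (c' \<circ> f) t) t" for t
    using has_curve_derivative_chain[OF E d(3) d(1)] by simp
  moreover have "times_differentiable n E (\<lambda>t. f' t *\<^sub>R (c' \<circ> f) t)"
    using Suc.IH[of c' f] d times_differentiable_Suc_imp[OF Suc.prems(2)]
    by (intro times_differentiable_scaleR[OF E]) auto
  moreover have "range (c \<circ> f) \<subseteq> topspace E"
    using Suc.prems by auto
  ultimately show ?case
    by (auto simp: o_def intro!: exI[of _ "\<lambda>t. f' t *\<^sub>R (c' \<circ> f) t"])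
qed auto

lemma topological_vector_space_euclideanreal: "topological_vector_space euclideanreal"
proof -
  have "continuous_on UNIV (\<lambda>p :: real \<times> real. fst p + snd p)"
    "continuous_on UNIV (\<lambda>p :: real \<times> real. fst p * snd p)"
    by (rule continuous_on_add continuous_on_mult continuous_on_fst continuous_on_snd continuous_on_id)+
  then show ?thesis
    by (simp add: topological_vector_space_def case_prod_unfold)
qed

lemma smooth_curve_on_compose:
  assumes "topological_vector_space E" "Hausdorff_space E"
    and "smooth_curve_on UNIV E c" "smooth_curve_on UNIV euclideanreal f"
  shows "smooth_curve_on UNIV E (c \<circ> f)"
  by (rule times_differentiable_smooth_curve[OF assms(2)])
    (rule times_differentiable_compose[OF assms(1) smooth_curve_times_differentiable[OF assms(3)]
        smooth_curve_times_differentiable[OF assms(4)]])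

text \<open>For \<open>p = 1\<close> this is the standard function that is smooth but not analytic
  at \<open>0\<close>. The polynomial in 1/x makes the family closed under differentiation.\<close>

definition flat_at_0 :: "real poly \<Rightarrow> real \<Rightarrow> real" where
  "flat_at_0 p x = (if 0 < x then poly p (1 / x) * exp (- (1 / x)) else 0)"

lemma poly_over_exp_tendsto_0: "((\<lambda>x. poly p x / exp x) \<longlongrightarrow> (0::real)) at_top"
proof -
  have "((\<lambda>x. \<Sum>i\<le>degree p. coeff p i * (x ^ i / exp x)) \<longlongrightarrow> (\<Sum>i\<le>degree p. coeff p i * 0)) at_top"
    by (intro tendsto_intros tendsto_power_div_exp_0)
  then show ?thesis
    by (simp add: poly_altdef sum_divide_distrib)
qed

text \<open>For x > 0 the derivative of p(1/x) exp(-1/x) is (1/x)^2 (p - p')(1/x) exp(-1/x), and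
  \<open>[:0, 0, 1:]\<close> is the square of the indeterminate.\<close>

lemma flat_at_0_has_derivative:
  "(flat_at_0 p has_real_derivative flat_at_0 ([:0, 0, 1:] * (p - pderiv p)) x) (at x)"
proof -
  consider "x > 0" | "x = 0" | "x < 0"
    by linarith
  then show ?thesis
  proof cases
    case 1
    have "((\<lambda>x. poly p (1 / x) * exp (- (1 / x))) has_real_derivative
        flat_at_0 ([:0, 0, 1:] * (p - pderiv p)) x) (at x)"
      using 1 by (auto intro!: derivative_eq_intros simp: flat_at_0_def field_simps power2_eq_square)
    then show ?thesis
      using eventually_nhds_in_open[of "{0<..}" x] 1
      by (subst DERIV_cong_ev[OF refl _ refl, where g = "\<lambda>x. poly p (1 / x) * exp (- (1 / x))"])
        (auto simp: flat_at_0_def elim: eventually_mono)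
  next
    case 2
    \<comment> \<open>The division by h in the difference quotient becomes one more factor 1/h, that
      is \<open>[:0, 1:]\<close>.\<close>
    have "((\<lambda>h. poly ([:0, 1:] * p) (inverse h) / exp (inverse h)) \<longlongrightarrow> 0) (at_right (0::real))"
      by (rule filterlim_compose[OF poly_over_exp_tendsto_0 filterlim_inverse_at_top_right])
    then have "((\<lambda>h. (flat_at_0 p (0 + h) - flat_at_0 p 0) / h) \<longlongrightarrow> 0) (at_right 0)"
      by (rule Lim_transform_eventually)
        (auto simp: eventually_at_filter flat_at_0_def exp_minus field_simps)
    moreover have "((\<lambda>h. (flat_at_0 p (0 + h) - flat_at_0 p 0) / h) \<longlongrightarrow> 0) (at_left 0)"
      by (rule Lim_transform_eventually[OF tendsto_const])
        (auto simp: eventually_at_filter flat_at_0_def)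
    ultimately show ?thesis
      unfolding DERIV_def 2 by (auto simp: flat_at_0_def intro: filterlim_split_at)
  next
    case 3
    have "((\<lambda>x. 0) has_real_derivative 0) (at x)"
      by simp
    then show ?thesis
      using eventually_nhds_in_open[of "{..<0}" x] 3
      by (subst DERIV_cong_ev[OF refl _ refl, where g = "\<lambda>x. 0"])
        (auto simp: flat_at_0_def elim: eventually_mono)
  qed
qed

lemma times_differentiable_real_Suc:
  assumes "\<And>t. (f has_real_derivative f' t) (at t)" "times_differentiable n euclideanreal f'"
  shows "times_differentiable (Suc n) euclideanreal f"
  using assms by (auto simp: has_curve_derivative_real_iff)

lemma times_differentiable_flat_at_0: "times_differentiable n euclideanreal (flat_at_0 p)"
  by (induction n arbitrary: p)
    (simp, blast intro: times_differentiable_real_Suc flat_at_0_has_derivative)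

lemma times_differentiable_const: "times_differentiable n euclideanreal (\<lambda>_. r)"
proof (induction n arbitrary: r)
  case (Suc n)
  show ?case
    by (rule times_differentiable_real_Suc[of _ "\<lambda>_. 0"]) (auto intro: Suc)
qed simp

lemma times_differentiable_ident: "times_differentiable n euclideanreal (\<lambda>t. t)"
  by (cases n) (auto intro: times_differentiable_real_Suc[of _ "\<lambda>_. 1"] times_differentiable_const
    simp del: times_differentiable.simps(2))

lemma times_differentiable_exp: "times_differentiable n euclideanreal exp"
proof (induction n)
  case (Suc n)
  show ?case
    by (rule times_differentiable_real_Suc[of _ exp]) (auto intro: Suc DERIV_exp)
qed simp

lemmas times_differentiable_real_add =
  times_differentiable_add[OF topological_vector_space_euclideanreal]

lemmas times_differentiable_real_mult =
  times_differentiable_scaleR[OF topological_vector_space_euclideanreal, unfolded real_scaleR_def]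

lemma times_differentiable_real_compose:
  assumes "times_differentiable n euclideanreal g" "times_differentiable n euclideanreal f"
  shows "times_differentiable n euclideanreal (\<lambda>t. g (f t))"
  using times_differentiable_compose[OF topological_vector_space_euclideanreal assms]
  by (simp add: o_def)

text \<open>The factor \<open>exp (- f (t\<^sup>2 - 1) * t\<^sup>2)\<close> is \<open>1\<close> for \<open>\<bar>t\<bar> \<le> 1\<close>, where \<open>f\<close> vanishes, and makes
  the product decay at infinity, since \<open>exp (- a) \<le> 1 / (1 + a)\<close>.\<close>

lemma smooth_truncation_exists:
  obtains \<phi> where "smooth_curve_on UNIV euclideanreal \<phi>" "\<And>t. \<bar>\<phi> t\<bar> \<le> 2" "\<And>t. \<bar>t\<bar> \<le> 1 \<Longrightarrow> \<phi> t = t"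
proof
  define a where "a t = flat_at_0 1 (t * t + -1) * (t * t)" for t
  define \<phi> where "\<phi> t = t * exp (-1 * a t)" for t
  note td_square = times_differentiable_real_mult[OF times_differentiable_ident times_differentiable_ident]
  have a: "times_differentiable n euclideanreal a" for n
    unfolding a_def
    by (rule times_differentiable_real_mult[OF
          times_differentiable_real_compose[OF times_differentiable_flat_at_0
            times_differentiable_real_add[OF td_square times_differentiable_const]] td_square])
  have "times_differentiable n euclideanreal \<phi>" for n
    unfolding \<phi>_def
    by (rule times_differentiable_real_mult[OF times_differentiable_ident
          times_differentiable_real_compose[OF times_differentiable_exp
            times_differentiable_real_mult[OF times_differentiable_const a]]])
  then show "smooth_curve_on UNIV euclideanreal \<phi>"
    by (intro times_differentiable_smooth_curve) auto
  show "\<phi> t = t" if "\<bar>t\<bar> \<le> 1" for t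
  proof -
    have "t * t \<le> 1"
      using that abs_square_le_1[of t] by (simp add: power2_eq_square)
    then show ?thesis
      by (simp add: \<phi>_def a_def flat_at_0_def)
  qed
  show "\<bar>\<phi> t\<bar> \<le> 2" for t
  proof -
    have a0: "0 \<le> a t"
      by (simp add: a_def flat_at_0_def)
    have abs: "\<bar>\<phi> t\<bar> = \<bar>t\<bar> * exp (- a t)"
      by (simp add: \<phi>_def abs_mult)
    show ?thesis
    proof (cases "\<bar>t\<bar> \<le> 2")
      case True
      then have "\<bar>t\<bar> * exp (- a t) \<le> 2 * 1"
        using a0 by (intro mult_mono) auto
      then show ?thesis
        by (simp add: abs)
    next
      case False
      \<comment> \<open>From \<open>4 \<le> t * t\<close> on, the flat factor of \<open>a t\<close>
        is at least 1 - 1/3. As t^2 is also at least 2 \<bar>t\<bar>, \<open>a t\<close> is at least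
        \<bar>t\<bar>, hence so is \<open>exp (a t)\<close>, which bounds the product by 1.\<close>
      have "2 * 2 \<le> \<bar>t\<bar> * \<bar>t\<bar>"
        using False by (intro mult_mono) auto
      then have t: "4 \<le> t * t"
        by simp
      then have "1 / (t * t - 1) \<le> 1 / 3"
        by (intro divide_left_mono) auto
      then have "2 / 3 \<le> 1 + - (1 / (t * t - 1))"
        by simp
      also have "\<dots> \<le> exp (- (1 / (t * t - 1)))"
        by (rule exp_ge_add_one_self)
      also have "\<dots> = flat_at_0 1 (t * t + -1)"
        using t by (simp add: flat_at_0_def)
      finally have "2 / 3 * (t * t) \<le> a t"
        unfolding a_def by (intro mult_right_mono) auto
      moreover have "2 * \<bar>t\<bar> \<le> \<bar>t\<bar> * \<bar>t\<bar>"
        using False by (intro mult_right_mono) auto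
      ultimately have "\<bar>t\<bar> \<le> 1 + a t"
        by simp
      also have "\<dots> \<le> exp (a t)"
        by (rule exp_ge_add_one_self)
      finally have "\<bar>t\<bar> * exp (- a t) \<le> exp (a t) * exp (- a t)"
        by (intro mult_right_mono) auto
      then show ?thesis
        by (simp add: abs flip: exp_add)
    qed
  qed
qed

lemma smooth_localization:
  assumes "open J" "t0 \<in> J"
  obtains \<psi> where "smooth_curve_on UNIV euclideanreal \<psi>" "range \<psi> \<subseteq> J"
    "\<forall>\<^sub>F t in nhds t0. \<psi> t = t"
proof -
  obtain \<phi> where \<phi>: "smooth_curve_on UNIV euclideanreal \<phi>" "\<And>t. \<bar>\<phi> t\<bar> \<le> 2"
    "\<And>t. \<bar>t\<bar> \<le> 1 \<Longrightarrow> \<phi> t = t"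
    by (rule smooth_truncation_exists) blast
  obtain e where e: "e > 0" "ball t0 e \<subseteq> J"
    using assms open_contains_ball by blast
  \<comment> \<open>The factor \<open>e / 3\<close> turns the bound \<open>2\<close> of
    \<open>\<phi>\<close> into a distance of at most 2e/3 < e from \<open>t0\<close>; the inverse
    factor inside makes \<open>\<psi>\<close> the identity for \<bar>t - t0\<bar> \<le> e/3.\<close>
  define \<psi> where "\<psi> t = t0 + e / 3 * \<phi> (3 / e * (t + - t0))" for t
  have "times_differentiable n euclideanreal \<psi>" for n
    unfolding \<psi>_def
    by (rule times_differentiable_real_add[OF times_differentiable_const
          times_differentiable_real_mult[OF times_differentiable_const
            times_differentiable_real_compose[OF smooth_curve_times_differentiable[OF \<phi>(1)]
              times_differentiable_real_mult[OF times_differentiable_const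
                times_differentiable_real_add[OF times_differentiable_ident times_differentiable_const]]]]])
  then have "smooth_curve_on UNIV euclideanreal \<psi>"
    by (intro times_differentiable_smooth_curve) auto
  moreover have "\<psi> t \<in> J" for t
  proof -
    have "\<bar>e / 3 * \<phi> (3 / e * (t + - t0))\<bar> \<le> e / 3 * 2"
      unfolding abs_mult using e \<phi>(2) by (intro mult_mono) auto
    then have "dist t0 (\<psi> t) < e"
      using e by (simp add: \<psi>_def dist_real_def)
    then show ?thesis
      using e by auto
  qed
  moreover have "\<psi> t = t" if "t \<in> ball t0 (e / 3)" for t
  proof -
    have "\<bar>t + - t0\<bar> \<le> e / 3"
      using that by (simp add: dist_real_def abs_minus_commute)
    then have "\<bar>3 / e\<bar> * \<bar>t + - t0\<bar> \<le> 3 / e * (e / 3)"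
      using e by (intro mult_mono) auto
    then have "\<bar>3 / e * (t + - t0)\<bar> \<le> 1"
      using e by (simp only: abs_mult) simp
    then show ?thesis
      using e \<phi>(3) by (simp add: \<psi>_def field_simps)
  qed
  then have "\<forall>\<^sub>F t in nhds t0. \<psi> t = t"
    using e eventually_nhds_in_open[of "ball t0 (e / 3)" t0] by (auto elim: eventually_mono)
  ultimately show ?thesis
    using that by blast
qed

section \<open>Products of convenient spaces and of manifolds\<close>

lemma topological_vector_space_prod:
  assumes "topological_vector_space E" "topological_vector_space F"
  shows "topological_vector_space (prod_topology E F)"
proof -
  have E: "continuous_map (prod_topology E E) E (\<lambda>z. fst z + snd z)"
    "continuous_map (prod_topology euclideanreal E) E (\<lambda>z. fst z *\<^sub>R snd z)"
    and F: "continuous_map (prod_topology F F) F (\<lambda>z. fst z + snd z)"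
    "continuous_map (prod_topology euclideanreal F) F (\<lambda>z. fst z *\<^sub>R snd z)"
    using assms by (auto simp: topological_vector_space_def case_prod_unfold)
  have "subspace (topspace E \<times> topspace F)"
    using assms by (auto simp: topological_vector_space_def subspace_def zero_prod_def)
  moreover have "continuous_map (prod_topology (prod_topology E F) (prod_topology E F))
      (prod_topology E F) (\<lambda>z. fst z + snd z)"
    using continuous_map_compose[OF _ E(1), OF continuous_map_pairedI[OF
          continuous_map_compose[OF continuous_map_fst continuous_map_fst]
          continuous_map_compose[OF continuous_map_snd continuous_map_fst]]]
      continuous_map_compose[OF _ F(1), OF continuous_map_pairedI[OF
          continuous_map_compose[OF continuous_map_fst continuous_map_snd]
          continuous_map_compose[OF continuous_map_snd continuous_map_snd]]]
    by (auto simp: continuous_map_pairwise o_def)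
  moreover have "continuous_map (prod_topology euclideanreal (prod_topology E F))
      (prod_topology E F) (\<lambda>z. fst z *\<^sub>R snd z)"
    using continuous_map_compose[OF _ E(2), OF continuous_map_pairedI[OF continuous_map_fst
          continuous_map_compose[OF continuous_map_snd continuous_map_fst]]]
      continuous_map_compose[OF _ F(2), OF continuous_map_pairedI[OF continuous_map_fst
          continuous_map_compose[OF continuous_map_snd continuous_map_snd]]]
    by (auto simp: continuous_map_pairwise o_def)
  ultimately show ?thesis
    by (simp add: topological_vector_space_def case_prod_unfold)
qed

lemma locally_convex_space_prod:
  assumes E: "locally_convex_space E" and F: "locally_convex_space F"
  shows "locally_convex_space (prod_topology E F)"
  unfolding locally_convex_space_def
proof (intro conjI allI impI)
  show "topological_vector_space (prod_topology E F)"
    using assms by (simp add: locally_convex_space_def topological_vector_space_prod)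
  fix U assume U: "openin (prod_topology E F) U \<and> 0 \<in> U"
  then obtain A B where "openin E A" "openin F B" "0 \<in> A" "0 \<in> B" and sub: "A \<times> B \<subseteq> U"
    unfolding openin_prod_topology_alt zero_prod_def by blast
  then obtain A' B' where "openin E A'" "convex A'" "0 \<in> A'" "A' \<subseteq> A"
    "openin F B'" "convex B'" "0 \<in> B'" "B' \<subseteq> B"
    using E F unfolding locally_convex_space_def by metis
  with sub show "\<exists>V. openin (prod_topology E F) V \<and> convex V \<and> 0 \<in> V \<and> V \<subseteq> U"
    by (intro exI[of _ "A' \<times> B'"])
      (auto simp: openin_prod_Times_iff convex_Times zero_prod_def)
qed

lemma convenient_space_prod:
  assumes E: "convenient_space E" and F: "convenient_space F"
  shows "convenient_space (prod_topology E F)"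
  unfolding convenient_space_def
proof (intro conjI allI impI)
  show "locally_convex_space (prod_topology E F)" "Hausdorff_space (prod_topology E F)"
    using assms
    by (simp_all add: convenient_space_def locally_convex_space_prod Hausdorff_space_prod_topology)
  fix c assume "smooth_curve_on UNIV (prod_topology E F) c"
  then obtain C D where "smooth_curve_on UNIV E C" "\<forall>t. has_curve_derivative E C ((fst \<circ> c) t) t"
    "smooth_curve_on UNIV F D" "\<forall>t. has_curve_derivative F D ((snd \<circ> c) t) t"
    using assms unfolding convenient_space_def smooth_curve_on_prod_iff by metis
  then show "\<exists>C. smooth_curve_on UNIV (prod_topology E F) C \<and>
      (\<forall>t. has_curve_derivative (prod_topology E F) C (c t) t)"
    by (intro exI[of _ "\<lambda>t. (C t, D t)"])
      (auto simp: smooth_curve_on_prod_iff has_curve_derivative_prod_iff o_def)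
qed

lemma smooth_curve_on_real_isCont:
  assumes "smooth_curve_on J euclideanreal c" "t \<in> J"
  shows "isCont c t"
  using assms unfolding smooth_curve_on_def has_curve_derivative_real_iff
  by (metis DERIV_isCont)

lemma convenient_space_euclideanreal: "convenient_space euclideanreal"
  unfolding convenient_space_def locally_convex_space_def
proof (intro conjI allI impI)
  show "topological_vector_space euclideanreal"
    by (rule topological_vector_space_euclideanreal)
  fix U :: "real set" assume "openin euclideanreal U \<and> 0 \<in> U"
  then obtain e where "e > 0" "ball 0 e \<subseteq> U"
    using open_contains_ball[of U] by auto
  then show "\<exists>V. openin euclideanreal V \<and> convex V \<and> 0 \<in> V \<and> V \<subseteq> U"
    by (intro exI[of _ "ball 0 e"]) auto
next
  fix c :: "real \<Rightarrow> real" assume c: "smooth_curve_on UNIV euclideanreal c"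
  \<comment> \<open>A smooth curve is continuous, so the fundamental theorem of calculus on the
    whole line, taken as the interval from -\<infinity> to \<infinity>, gives an
    antiderivative.\<close>
  obtain C where C: "\<And>t. (C has_real_derivative c t) (at t)"
    using einterval_antiderivative[of "-\<infinity>" "\<infinity>" c] smooth_curve_on_real_isCont[OF c]
    by (auto simp: has_real_derivative_iff_has_vector_derivative)
  have "times_differentiable n euclideanreal C" for n
    using C smooth_curve_times_differentiable[OF c]
    by (cases n) (auto simp: has_curve_derivative_real_iff)
  then show "\<exists>C. smooth_curve_on UNIV euclideanreal C \<and>
      (\<forall>t. has_curve_derivative euclideanreal C (c t) t)"
    using C times_differentiable_smooth_curve[of euclideanreal C]
    by (auto simp: has_curve_derivative_real_iff intro!: exI[of _ C])
qed auto

lemma cinf_open_euclideanreal: "open U \<Longrightarrow> cinf_open euclideanreal U"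
  unfolding cinf_open_def
  by (auto intro: continuous_open_vimage smooth_curve_on_real_isCont)

lemma cinf_open_Times:
  assumes "cinf_open E U" "cinf_open F V"
  shows "cinf_open (prod_topology E F) (U \<times> V)"
  unfolding cinf_open_def
proof (intro conjI allI impI)
  show "U \<times> V \<subseteq> topspace (prod_topology E F)"
    using assms by (auto simp: cinf_open_def)
  fix c assume "smooth_curve_on UNIV (prod_topology E F) c"
  then have "open ((fst \<circ> c) -` U \<inter> (snd \<circ> c) -` V)"
    using assms unfolding smooth_curve_on_prod_iff cinf_open_def by blast
  moreover have "c -` (U \<times> V) = (fst \<circ> c) -` U \<inter> (snd \<circ> c) -` V"
    by (auto simp: mem_Times_iff)
  ultimately show "open (c -` (U \<times> V))"
    by simp
qed

section \<open>Product charts and the product manifold\<close>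

lemma prod_chart_simps [simp]:
  "chart_dom (prod_chart u v) = chart_dom u \<times> chart_dom v"
  "chart_map (prod_chart u v) = map_prod (chart_map u) (chart_map v)"
  "chart_model (prod_chart u v) = prod_topology (chart_model u) (chart_model v)"
  by (simp_all add: prod_chart_def)

lemma chart_inv_prod_chart:
  assumes "inj_on (chart_map u) (chart_dom u)" "inj_on (chart_map v) (chart_dom v)"
    and "x \<in> chart_map u ` chart_dom u" "y \<in> chart_map v ` chart_dom v"
  shows "chart_inv (prod_chart u v) (x, y) = (chart_inv u x, chart_inv v y)"
proof -
  obtain p q where "p \<in> chart_dom u" "x = chart_map u p" "q \<in> chart_dom v" "y = chart_map v q"
    using assms by blast
  then show ?thesis
    using the_inv_into_f_f[OF map_prod_inj_on[OF assms(1,2)], of "(p, q)"] assms(1,2)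
    by (simp add: the_inv_into_f_f)
qed

lemma manifold_open_Times:
  assumes "manifold_open M A" "manifold_open N B"
  shows "manifold_open (prod_manifold M N) (A \<times> B)"
proof -
  have "map_prod f g ` (A \<times> B \<inter> C \<times> D) = f ` (A \<inter> C) \<times> g ` (B \<inter> D)"
    for f :: "'a \<Rightarrow> 'b" and g :: "'c \<Rightarrow> 'd" and C D
    by (auto simp: Times_Int_Times)
  then show ?thesis
    using assms by (auto simp: manifold_open_def prod_manifold_def cinf_open_Times)
qed

lemma map_prod_image_Times: "map_prod f g ` (A \<times> B) = f ` A \<times> g ` B"
  by auto

lemma chart_on_prod_chart:
  assumes "chart_on X u" "chart_on Y v"
  shows "chart_on (X \<times> Y) (prod_chart u v)"
  using assms unfolding chart_on_def
  by (auto simp: convenient_space_prod map_prod_inj_on cinf_open_Times map_prod_image_Times)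

lemma charts_compatible_prod_chart:
  assumes "charts_compatible u u'" "charts_compatible v v'"
    and inj: "inj_on (chart_map u) (chart_dom u)" "inj_on (chart_map v) (chart_dom v)"
  shows "charts_compatible (prod_chart u v) (prod_chart u' v')"
proof -
  let ?U = "chart_map u ` (chart_dom u \<inter> chart_dom u')"
  let ?V = "chart_map v ` (chart_dom v \<inter> chart_dom v')"
  let ?I = "chart_inv (prod_chart u v)"
  have img: "map_prod (chart_map u) (chart_map v) `
      (chart_dom u \<times> chart_dom v \<inter> chart_dom u' \<times> chart_dom v') = ?U \<times> ?V"
    by (auto simp: Times_Int_Times)
  have "smooth_map_on (?U \<times> ?V) (prod_topology (chart_model u) (chart_model v))
     (prod_topology (chart_model u') (chart_model v')) (map_prod (chart_map u') (chart_map v') \<circ> ?I)"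
    unfolding smooth_map_on_def
  proof (intro allI impI, elim conjE)
    fix c assume c: "smooth_curve_on UNIV (prod_topology (chart_model u) (chart_model v)) c"
      "range c \<subseteq> ?U \<times> ?V"
    \<comment> \<open>\<open>the_inv_into\<close> is unspecified off the image of a chart, so the
      inverse of the product chart is computed only along \<open>c\<close>, which stays in the
      image.\<close>
    have "?I (c t) = (chart_inv u (fst (c t)), chart_inv v (snd (c t)))" for t
    proof -
      have "c t \<in> ?U \<times> ?V"
        using c(2) by blast
      then have "fst (c t) \<in> chart_map u ` chart_dom u" "snd (c t) \<in> chart_map v ` chart_dom v"
        by (auto simp: mem_Times_iff)
      then show ?thesis
        using chart_inv_prod_chart[OF inj] by (metis prod.collapse)
    qed
    moreover have "range (fst \<circ> c) \<subseteq> ?U" "range (snd \<circ> c) \<subseteq> ?V"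
      using c(2) unfolding image_subset_iff mem_Times_iff by simp_all
    ultimately show "smooth_curve_on UNIV (prod_topology (chart_model u') (chart_model v'))
        (map_prod (chart_map u') (chart_map v') \<circ> ?I \<circ> c)"
      using assms(1,2) c(1)
      by (auto simp: smooth_curve_on_prod_iff charts_compatible_def smooth_map_on_def o_def)
  qed
  moreover have "cinf_open (prod_topology (chart_model u) (chart_model v)) (?U \<times> ?V)"
    using assms by (simp add: charts_compatible_def cinf_open_Times)
  ultimately show ?thesis
    unfolding charts_compatible_def by (simp add: img)
qed

lemma is_manifoldD:
  assumes "is_manifold M"
  shows is_manifold_chart_on: "u \<in> atlas M \<Longrightarrow> chart_on (points M) u"
    and is_manifold_points: "(\<Union>u \<in> atlas M. chart_dom u) = points M"
    and is_manifold_compatible: "u \<in> atlas M \<Longrightarrow> v \<in> atlas M \<Longrightarrow> charts_compatible u v"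
  using assms by (simp_all add: is_manifold_def)

lemma manifold_open_points:
  assumes "is_manifold M"
  shows "manifold_open M (points M)"
proof -
  have "points M \<inter> chart_dom u = chart_dom u" if "u \<in> atlas M" for u
    using is_manifold_chart_on[OF assms that] by (auto simp: chart_on_def)
  then show ?thesis
    using is_manifold_chart_on[OF assms] by (simp add: manifold_open_def chart_on_def)
qed

text \<open>For the Hausdorff property, distinct points differ in one factor; a separating pair
  there is multiplied with the whole other factor, so openness of rectangles suffices.\<close>

lemma is_manifold_prod:
  assumes L: "is_manifold L" and M: "is_manifold M"
  shows "is_manifold (prod_manifold L M)"
proof -
  have "\<exists>A B. manifold_open (prod_manifold L M) A \<and> manifold_open (prod_manifold L M) B \<and>
      (p, q) \<in> A \<and> (p', q') \<in> B \<and> A \<inter> B = {}"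
    if pts: "p \<in> points L" "p' \<in> points L" "q \<in> points M" "q' \<in> points M" and ne: "(p, q) \<noteq> (p', q')"
    for p p' q q'
  proof (cases "p = p'")
    case False
    then obtain A B where "manifold_open L A" "manifold_open L B" "p \<in> A" "p' \<in> B" "A \<inter> B = {}"
      using L pts unfolding is_manifold_def by metis
    then show ?thesis
      using pts manifold_open_Times[OF _ manifold_open_points[OF M]]
      by (intro exI[of _ "A \<times> points M"] exI[of _ "B \<times> points M"]) auto
  next
    case True
    then obtain A B where "manifold_open M A" "manifold_open M B" "q \<in> A" "q' \<in> B" "A \<inter> B = {}"
      using M pts ne unfolding is_manifold_def by metis
    then show ?thesis
      using pts manifold_open_Times[OF manifold_open_points[OF L]]
      by (intro exI[of _ "points L \<times> A"] exI[of _ "points L \<times> B"]) auto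
  qed
  moreover have "(\<Union>u \<in> atlas (prod_manifold L M). chart_dom u) = points L \<times> points M"
    unfolding is_manifold_points[OF L, symmetric] is_manifold_points[OF M, symmetric]
    by (force simp: prod_manifold_def)
  moreover have "inj_on (chart_map u) (chart_dom u)" if "u \<in> atlas L" for u
    using is_manifold_chart_on[OF L that] by (simp add: chart_on_def)
  moreover have "inj_on (chart_map u) (chart_dom u)" if "u \<in> atlas M" for u
    using is_manifold_chart_on[OF M that] by (simp add: chart_on_def)
  ultimately show ?thesis
    unfolding is_manifold_def
    using is_manifold_chart_on[OF L] is_manifold_chart_on[OF M]
      is_manifold_compatible[OF L] is_manifold_compatible[OF M]
    by (auto simp: prod_manifold_def chart_on_prod_chart charts_compatible_prod_chart)
qed

section \<open>Tangent spaces\<close>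

lemma smooth_curve_on_const:
  assumes "topological_vector_space E" "x \<in> topspace E"
  shows "smooth_curve_on J E (\<lambda>_. x)"
proof -
  have "0 \<in> topspace E"
    using assms by (simp add: topological_vector_space_def subspace_0)
  then show ?thesis
    unfolding smooth_curve_on_def has_curve_derivative_def
    using assms by (intro exI[of _ "\<lambda>n _. if n = 0 then x else 0"]) auto
qed

lemma has_curve_derivative_line:
  assumes "v \<in> topspace E"
  shows "has_curve_derivative E (\<lambda>t. x + t *\<^sub>R v) v t"
  unfolding has_curve_derivative_def
proof (rule limitin_transform_eventually)
  show "limitin E (\<lambda>_. v) v (at 0)"
    using assms by simp
  show "\<forall>\<^sub>F h in at 0. v = (x + (t + h) *\<^sub>R v - (x + t *\<^sub>R v)) /\<^sub>R h"
    by (simp add: eventually_at_filter scaleR_add_left)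
qed

lemma smooth_curve_on_line:
  assumes E: "topological_vector_space E" and v: "x \<in> topspace E" "v \<in> topspace E"
  shows "smooth_curve_on J E (\<lambda>t. x + t *\<^sub>R v)"
proof -
  obtain d where d: "d 0 = (\<lambda>_. v)"
    "\<And>n t. t \<in> J \<Longrightarrow> d n t \<in> topspace E \<and> has_curve_derivative E (d n) (d (Suc n) t) t"
    using smooth_curve_on_const[OF E v(2), of J] unfolding smooth_curve_on_def by auto
  have "x + t *\<^sub>R v \<in> topspace E" for t
    using E v by (auto simp: topological_vector_space_def intro!: subspace_add subspace_scale)
  then show ?thesis
    unfolding smooth_curve_on_def
    using d has_curve_derivative_line[OF v(2), of x]
    by (intro exI[of _ "case_nat (\<lambda>t. x + t *\<^sub>R v) d"]) (auto split: nat.split)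
qed

lemma chart_onD:
  assumes "chart_on X u"
  shows chart_on_Hausdorff: "Hausdorff_space (chart_model u)"
    and chart_on_topological_vector_space: "topological_vector_space (chart_model u)"
    and chart_on_inj: "inj_on (chart_map u) (chart_dom u)"
    and chart_on_subset: "chart_dom u \<subseteq> X"
    and chart_on_cinf_open: "cinf_open (chart_model u) (chart_map u ` chart_dom u)"
    and chart_on_in_topspace: "p \<in> chart_dom u \<Longrightarrow> chart_map u p \<in> topspace (chart_model u)"
    and chart_on_inv: "p \<in> chart_dom u \<Longrightarrow> chart_inv u (chart_map u p) = p"
  using assms
  by (auto simp: chart_on_def convenient_space_def locally_convex_space_def cinf_open_def
      the_inv_into_f_f)

text \<open>A set is open in this sense when its preimages under smooth curves are open, and a
  straight line is a smooth curve.\<close>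

lemma cinf_open_line_eventually:
  assumes E: "topological_vector_space E" and U: "cinf_open E U" "x \<in> U" and v: "v \<in> topspace E"
  shows "\<forall>\<^sub>F t in nhds 0. x + t *\<^sub>R v \<in> U"
proof -
  have "x \<in> topspace E"
    using U by (auto simp: cinf_open_def)
  then have "open ((\<lambda>t. x + t *\<^sub>R v) -` U)"
    using U smooth_curve_on_line[OF E _ v] by (simp add: cinf_open_def)
  then show ?thesis
    using eventually_nhds_in_open[of "(\<lambda>t. x + t *\<^sub>R v) -` U" 0] U(2) by simp
qed

lemma manifold_curveD:
  assumes "manifold_curve M c" "u \<in> atlas M"
  shows manifold_curve_open_vimage: "open (c -` chart_dom u)"
    and manifold_curve_smooth_curve_on:
      "smooth_curve_on (c -` chart_dom u) (chart_model u) (chart_map u \<circ> c)"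
  using assms by (simp_all add: manifold_curve_def)

lemma manifold_curve_has_derivative:
  assumes "manifold_curve M c" "u \<in> charts_at M (c t)"
  shows "\<exists>v. has_curve_derivative (chart_model u) (chart_map u \<circ> c) v t"
  using manifold_curve_smooth_curve_on[OF assms(1), of u] assms(2)
  unfolding smooth_curve_on_def charts_at_def by (metis (mono_tags, lifting) mem_Collect_eq vimageI)

lemma manifold_curve_eventually:
  assumes "manifold_curve M c" "u \<in> charts_at M (c t)"
  shows "\<forall>\<^sub>F s in nhds t. c s \<in> chart_dom u"
  using eventually_nhds_in_open[OF manifold_curve_open_vimage[OF assms(1), of u], of t] assms(2)
  by (simp add: charts_at_def)

lemma tangent_relD:
  assumes "(c, c') \<in> tangent_rel M"
  shows "manifold_curve M c" "manifold_curve M c'" "c 0 = c' 0"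
    "u \<in> charts_at M (c 0) \<Longrightarrow>
      \<exists>v. has_curve_derivative (chart_model u) (chart_map u \<circ> c) v 0 \<and>
          has_curve_derivative (chart_model u) (chart_map u \<circ> c') v 0"
  using assms by (auto simp: tangent_rel_def)

lemma tangent_rel_refl: "manifold_curve M c \<Longrightarrow> (c, c) \<in> tangent_rel M"
  by (simp add: tangent_rel_def manifold_curve_has_derivative)

lemma tangent_rel_sym: "(c, c') \<in> tangent_rel M \<Longrightarrow> (c', c) \<in> tangent_rel M"
  unfolding tangent_rel_def by auto

text \<open>This makes the class in \<open>chart_tangent\<close> well defined, where a curve is
  prescribed only near \<open>0\<close>.\<close>

lemma tangent_rel_eventually_eq:
  assumes "manifold_curve M c" "manifold_curve M c'" and eq: "\<forall>\<^sub>F t in nhds 0. c t = c' t"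
  shows "(c, c') \<in> tangent_rel M"
proof -
  have c0: "c 0 = c' 0"
    using eq by (rule eventually_nhds_x_imp_x)
  have "\<exists>v. has_curve_derivative (chart_model u) (chart_map u \<circ> c) v 0 \<and>
          has_curve_derivative (chart_model u) (chart_map u \<circ> c') v 0"
    if "u \<in> charts_at M (c 0)" for u
  proof -
    have "\<forall>\<^sub>F t in nhds 0. (chart_map u \<circ> c) t = (chart_map u \<circ> c') t"
      using eq by (rule eventually_mono) simp
    then show ?thesis
      using manifold_curve_has_derivative[OF assms(1) that] has_curve_derivative_cong by blast
  qed
  then show ?thesis
    using assms c0 by (simp add: tangent_rel_def)
qed

context
  fixes M :: "('m, 'e::real_vector) manifold"
  assumes M: "is_manifold M"
begin

lemma charts_at_chart_on: "u \<in> charts_at M p \<Longrightarrow> chart_on (points M) u"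
  using is_manifold_chart_on[OF M] by (simp add: charts_at_def)

lemma charts_at_nonempty: "p \<in> points M \<Longrightarrow> charts_at M p \<noteq> {}"
  using is_manifold_points[OF M] by (auto simp: charts_at_def)

text \<open>Each of the two pairs comes with its own common velocity; these agree because the middle
  curve \<open>b\<close> has only one in a Hausdorff model space.\<close>

lemma tangent_rel_trans:
  assumes "(a, b) \<in> tangent_rel M" "(b, c) \<in> tangent_rel M"
  shows "(a, c) \<in> tangent_rel M"
proof -
  have "\<exists>v. has_curve_derivative (chart_model u) (chart_map u \<circ> a) v 0 \<and>
          has_curve_derivative (chart_model u) (chart_map u \<circ> c) v 0"
    if u: "u \<in> charts_at M (a 0)" for u
    using tangent_relD(4)[OF assms(1) u] tangent_relD(4)[OF assms(2), of u] u tangent_relD(3)[OF assms(1)]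
      has_curve_derivative_unique[OF chart_on_Hausdorff[OF charts_at_chart_on[OF u]]]
    by metis
  then show ?thesis
    using tangent_relD(1-3)[OF assms(1)] tangent_relD(1-3)[OF assms(2)] by (simp add: tangent_rel_def)
qed

lemma tangent_rel_Image_eq:
  assumes "(c, c') \<in> tangent_rel M"
  shows "tangent_rel M `` {c} = tangent_rel M `` {c'}"
  using assms by (blast intro: tangent_rel_trans tangent_rel_sym)

lemma tangent_spaceI:
  "manifold_curve M c \<Longrightarrow> tangent_rel M `` {c} \<in> tangent_space M (c 0)"
  by (auto simp: tangent_space_def intro: quotientI)

lemma tangent_space_memD:
  assumes "X \<in> tangent_space M p" "c \<in> X"
  shows "manifold_curve M c" "c 0 = p" "X = tangent_rel M `` {c}"
proof -
  obtain c' where c': "manifold_curve M c'" "c' 0 = p" "X = tangent_rel M `` {c'}"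
    using assms(1) by (auto simp: tangent_space_def elim: quotientE)
  then have "(c', c) \<in> tangent_rel M"
    using assms(2) by simp
  then show "manifold_curve M c" "c 0 = p" "X = tangent_rel M `` {c}"
    using c' tangent_relD(2,3) tangent_rel_Image_eq by force+
qed

lemma tangent_space_obtain:
  assumes "X \<in> tangent_space M p"
  obtains c where "c \<in> X" "manifold_curve M c" "c 0 = p" "X = tangent_rel M `` {c}"
proof -
  obtain c where "c \<in> X"
    using assms tangent_rel_refl by (fastforce simp: tangent_space_def elim: quotientE)
  then show ?thesis
    using that tangent_space_memD[OF assms] by blast
qed

lemma tangent_space_points: "X \<in> tangent_space M p \<Longrightarrow> p \<in> points M"
  by (erule tangent_space_obtain) (auto simp: manifold_curve_def)

text \<open>\<open>chart_velocity\<close> quantifies over all representatives; one of them suffices,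
  since related curves share their velocity in each chart at the point.\<close>

lemma chart_velocity_eqI:
  assumes X: "X \<in> tangent_space M p" "c \<in> X" and u: "u \<in> charts_at M p"
    and v: "has_curve_derivative (chart_model u) (chart_map u \<circ> c) v 0"
  shows "chart_velocity u X = v"
  unfolding chart_velocity_def
proof (rule the_equality)
  note unique = has_curve_derivative_unique[OF chart_on_Hausdorff[OF charts_at_chart_on[OF u]]]
  show "\<forall>c'\<in>X. has_curve_derivative (chart_model u) (chart_map u \<circ> c') v 0"
  proof
    fix c' assume "c' \<in> X"
    then have "(c, c') \<in> tangent_rel M"
      using tangent_space_memD(3)[OF X] by simp
    then show "has_curve_derivative (chart_model u) (chart_map u \<circ> c') v 0"
      using tangent_relD(4)[of c c' M u] unique[OF v] u tangent_space_memD(2)[OF X] by metis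
  qed
  show "w = v" if "\<forall>c\<in>X. has_curve_derivative (chart_model u) (chart_map u \<circ> c) w 0" for w
    using that X(2) v unique by blast
qed

lemma has_curve_derivative_chart_velocity:
  assumes X: "X \<in> tangent_space M p" "c \<in> X" and u: "u \<in> charts_at M p"
  shows "has_curve_derivative (chart_model u) (chart_map u \<circ> c) (chart_velocity u X) 0"
proof -
  obtain v where "has_curve_derivative (chart_model u) (chart_map u \<circ> c) v 0"
    using manifold_curve_has_derivative[of M c u 0] tangent_space_memD[OF X] u by auto
  then show ?thesis
    using chart_velocity_eqI[OF assms] by simp
qed

text \<open>The hypothesis ranges over all charts at \<open>p\<close>, exactly as
  \<open>tangent_rel\<close> does; to pass from one chart to the others would take the chain rule
  for the transition map.\<close>

lemma tangent_space_eqI: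
  assumes X: "X \<in> tangent_space M p" and Y: "Y \<in> tangent_space M p"
    and eq: "\<And>u. u \<in> charts_at M p \<Longrightarrow> chart_velocity u X = chart_velocity u Y"
  shows "X = Y"
proof -
  obtain c d where c: "c \<in> X" "manifold_curve M c" "c 0 = p" "X = tangent_rel M `` {c}"
    and d: "d \<in> Y" "manifold_curve M d" "d 0 = p" "Y = tangent_rel M `` {d}"
    using tangent_space_obtain[OF X] tangent_space_obtain[OF Y] by metis
  then have "(c, d) \<in> tangent_rel M"
    using has_curve_derivative_chart_velocity[OF X c(1)] has_curve_derivative_chart_velocity[OF Y d(1)] eq
    unfolding tangent_rel_def by fastforce
  then show ?thesis
    unfolding c(4) d(4) by (rule tangent_rel_Image_eq)
qed

lemma manifold_curve_const:
  assumes "p \<in> points M"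
  shows "manifold_curve M (\<lambda>_. p)"
proof -
  have "smooth_curve_on ((\<lambda>_. p) -` chart_dom u) (chart_model u) (\<lambda>_. chart_map u p)"
    if "u \<in> atlas M" for u
  proof (cases "p \<in> chart_dom u")
    case True
    then show ?thesis
      using is_manifold_chart_on[OF M that]
      by (intro smooth_curve_on_const) (auto intro: chart_onD)
  qed (auto simp: smooth_curve_on_def)
  then show ?thesis
    using assms by (auto simp: manifold_curve_def o_def vimage_def)
qed

lemma tangent_zero_mem:
  "p \<in> points M \<Longrightarrow> tangent_zero M p \<in> tangent_space M p"
  unfolding tangent_zero_def using tangent_spaceI manifold_curve_const by fastforce

lemma chart_velocity_tangent_zero:
  assumes "p \<in> points M" "u \<in> charts_at M p"
  shows "chart_velocity u (tangent_zero M p) = 0"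
proof (rule chart_velocity_eqI[OF tangent_zero_mem[OF assms(1)] _ assms(2)])
  show "(\<lambda>_. p) \<in> tangent_zero M p"
    unfolding tangent_zero_def using tangent_rel_refl manifold_curve_const assms by blast
  show "has_curve_derivative (chart_model u) (chart_map u \<circ> (\<lambda>_. p)) 0 0"
    using chart_on_topological_vector_space[OF charts_at_chart_on[OF assms(2)]]
    by (simp add: has_curve_derivative_def o_def topological_vector_space_def subspace_0)
qed

text \<open>Compatibility of charts only concerns curves that stay in the overlap for all times,
  hence the curve is reparametrised to one that does and coincides with the given one near \<open>t0\<close>.\<close>

lemma manifold_curve_chart_inv:
  assumes u: "u \<in> atlas M" and \<gamma>: "smooth_curve_on UNIV (chart_model u) \<gamma>"
    and ran: "range \<gamma> \<subseteq> chart_map u ` chart_dom u"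
  shows "manifold_curve M (chart_inv u \<circ> \<gamma>)"
  unfolding manifold_curve_def
proof (intro conjI ballI)
  have cu: "chart_on (points M) u"
    using is_manifold_chart_on[OF M u] .
  have dom: "chart_inv u (\<gamma> t) \<in> chart_dom u" for t
  proof -
    obtain q where "q \<in> chart_dom u" "\<gamma> t = chart_map u q"
      using ran by blast
    then show ?thesis
      by (simp add: chart_on_inv[OF cu])
  qed
  then show "range (chart_inv u \<circ> \<gamma>) \<subseteq> points M"
    using chart_on_subset[OF cu] by auto
  fix w assume w: "w \<in> atlas M"
  define J where "J = \<gamma> -` (chart_map u ` (chart_dom u \<inter> chart_dom w))"
  have J: "(chart_inv u \<circ> \<gamma>) -` chart_dom w = J"
  proof -
    have "chart_inv u (\<gamma> t) \<in> chart_dom w \<longleftrightarrow> \<gamma> t \<in> chart_map u ` (chart_dom u \<inter> chart_dom w)" for t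
    proof -
      obtain q where "q \<in> chart_dom u" "\<gamma> t = chart_map u q"
        using ran by blast
      then show ?thesis
        using chart_on_inv[OF cu] inj_on_image_mem_iff[OF chart_on_inj[OF cu], of q]
        by simp
    qed
    then show ?thesis
      by (simp add: J_def vimage_def)
  qed
  have comp: "charts_compatible u w"
    by (rule is_manifold_compatible[OF M u w])
  then have "open J"
    using \<gamma> by (simp add: charts_compatible_def cinf_open_def J_def)
  then show "open ((chart_inv u \<circ> \<gamma>) -` chart_dom w)"
    by (simp add: J)
  show "smooth_curve_on ((chart_inv u \<circ> \<gamma>) -` chart_dom w) (chart_model w)
      (chart_map w \<circ> (chart_inv u \<circ> \<gamma>))"
    unfolding J
  proof (rule smooth_curve_on_local[OF chart_on_Hausdorff[OF is_manifold_chart_on[OF M w]] \<open>open J\<close>])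
    fix t0 assume "t0 \<in> J"
    then obtain \<psi> where \<psi>: "smooth_curve_on UNIV euclideanreal \<psi>" "range \<psi> \<subseteq> J"
      "\<forall>\<^sub>F t in nhds t0. \<psi> t = t"
      using smooth_localization[OF \<open>open J\<close>] by blast
    have "smooth_curve_on UNIV (chart_model u) (\<gamma> \<circ> \<psi>)"
      using smooth_curve_on_compose[OF _ _ \<gamma> \<psi>(1)] chart_onD(1,2)[OF cu] by blast
    moreover have "range (\<gamma> \<circ> \<psi>) \<subseteq> chart_map u ` (chart_dom u \<inter> chart_dom w)"
      using \<psi>(2) by (auto simp: J_def)
    ultimately have "smooth_curve_on UNIV (chart_model w) ((chart_map w \<circ> chart_inv u) \<circ> (\<gamma> \<circ> \<psi>))"
      using comp unfolding charts_compatible_def smooth_map_on_def by blast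
    moreover obtain I where "open I" "t0 \<in> I" "\<forall>t\<in>I. \<psi> t = t"
      using \<psi>(3) unfolding eventually_nhds by blast
    ultimately show "\<exists>I c'. open I \<and> t0 \<in> I \<and> smooth_curve_on I (chart_model w) c' \<and>
        (\<forall>s\<in>I. c' s = (chart_map w \<circ> (chart_inv u \<circ> \<gamma>)) s)"
      by (intro exI[of _ I] exI[of _ "(chart_map w \<circ> chart_inv u) \<circ> (\<gamma> \<circ> \<psi>)"])
        (auto intro: smooth_curve_on_subset)
  qed
qed

lemma coordinate_line_curve:
  assumes u: "u \<in> charts_at M p" and v: "v \<in> topspace (chart_model u)"
  obtains c where "manifold_curve M c" "c 0 = p"
    "\<forall>\<^sub>F t in nhds 0. c t \<in> chart_dom u \<and> chart_map u (c t) = chart_map u p + t *\<^sub>R v"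
proof -
  have u': "u \<in> atlas M" "p \<in> chart_dom u"
    using u by (auto simp: charts_at_def)
  have cu: "chart_on (points M) u"
    by (rule charts_at_chart_on[OF u])
  note E = chart_on_topological_vector_space[OF cu]
  define l where "l t = chart_map u p + t *\<^sub>R v" for t
  have l: "smooth_curve_on UNIV (chart_model u) l"
    unfolding l_def by (rule smooth_curve_on_line[OF E chart_on_in_topspace[OF cu u'(2)] v])
  have "open (l -` (chart_map u ` chart_dom u))"
    using l chart_on_cinf_open[OF cu] by (simp add: cinf_open_def)
  moreover have "0 \<in> l -` (chart_map u ` chart_dom u)"
    using u' by (simp add: l_def)
  ultimately obtain \<psi> where \<psi>: "smooth_curve_on UNIV euclideanreal \<psi>"
    "range \<psi> \<subseteq> l -` (chart_map u ` chart_dom u)" "\<forall>\<^sub>F t in nhds 0. \<psi> t = t"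
    by (rule smooth_localization)
  define c where "c = chart_inv u \<circ> (l \<circ> \<psi>)"
  have ran: "range (l \<circ> \<psi>) \<subseteq> chart_map u ` chart_dom u"
    using \<psi>(2) by auto
  have "manifold_curve M c"
    unfolding c_def
    using smooth_curve_on_compose[OF E chart_on_Hausdorff[OF cu] l \<psi>(1)] ran
    by (rule manifold_curve_chart_inv[OF u'(1)])
  moreover have c: "c t \<in> chart_dom u \<and> chart_map u (c t) = l (\<psi> t)" for t
  proof -
    obtain q where "q \<in> chart_dom u" "l (\<psi> t) = chart_map u q"
      using ran by force
    then show ?thesis
      by (simp add: c_def chart_on_inv[OF cu])
  qed
  have "\<psi> 0 = 0"
    using \<psi>(3) by (rule eventually_nhds_x_imp_x)
  then have "c 0 = p"
    by (simp add: c_def l_def chart_on_inv[OF cu u'(2)])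
  moreover have "\<forall>\<^sub>F t in nhds 0. c t \<in> chart_dom u \<and> chart_map u (c t) = chart_map u p + t *\<^sub>R v"
    using \<psi>(3) by (rule eventually_mono) (simp add: c l_def)
  ultimately show ?thesis
    using that by blast
qed

text \<open>Two curves that follow the same coordinate line near \<open>0\<close> coincide there,
  since charts are injective; hence the description in \<open>chart_tangent\<close> fits one class
  only.\<close>

lemma chart_tangent_eqI:
  assumes u: "u \<in> charts_at M p" and X: "X \<in> tangent_space M p" "c \<in> X"
    and line: "\<forall>\<^sub>F t in nhds 0. c t \<in> chart_dom u \<and> chart_map u (c t) = chart_map u p + t *\<^sub>R v"
  shows "chart_tangent M u p v = X"
  unfolding chart_tangent_def
proof (rule the_equality)
  show "X \<in> tangent_space M p \<and>
      (\<exists>c\<in>X. \<forall>\<^sub>F t in nhds 0. c t \<in> chart_dom u \<and> chart_map u (c t) = chart_map u p + t *\<^sub>R v)"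
    using X line by blast
  fix Y assume "Y \<in> tangent_space M p \<and>
      (\<exists>c\<in>Y. \<forall>\<^sub>F t in nhds 0. c t \<in> chart_dom u \<and> chart_map u (c t) = chart_map u p + t *\<^sub>R v)"
  then obtain d where Y: "Y \<in> tangent_space M p" "d \<in> Y"
    and d: "\<forall>\<^sub>F t in nhds 0. d t \<in> chart_dom u \<and> chart_map u (d t) = chart_map u p + t *\<^sub>R v"
    by blast
  have "\<forall>\<^sub>F t in nhds 0. d t = c t"
    using line d
    by eventually_elim (metis chart_on_inj[OF charts_at_chart_on[OF u]] inj_on_eq_iff)
  then have "(d, c) \<in> tangent_rel M"
    using tangent_space_memD(1)[OF X] tangent_space_memD(1)[OF Y]
    by (intro tangent_rel_eventually_eq)
  then show "Y = X"
    using tangent_rel_Image_eq tangent_space_memD(3)[OF X] tangent_space_memD(3)[OF Y] by metis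
qed

lemma chart_tangent_obtain:
  assumes u: "u \<in> charts_at M p" and v: "v \<in> topspace (chart_model u)"
  obtains c where "chart_tangent M u p v \<in> tangent_space M p" "c \<in> chart_tangent M u p v"
    "\<forall>\<^sub>F t in nhds 0. c t \<in> chart_dom u \<and> chart_map u (c t) = chart_map u p + t *\<^sub>R v"
proof -
  obtain c where c: "manifold_curve M c" "c 0 = p"
    "\<forall>\<^sub>F t in nhds 0. c t \<in> chart_dom u \<and> chart_map u (c t) = chart_map u p + t *\<^sub>R v"
    using coordinate_line_curve[OF assms] .
  have X: "tangent_rel M `` {c} \<in> tangent_space M p" "c \<in> tangent_rel M `` {c}"
    using tangent_spaceI[OF c(1)] c(2) tangent_rel_refl[OF c(1)] by auto
  show ?thesis
    by (rule that[of c]) (use X c(3) chart_tangent_eqI[OF u X c(3)] in simp_all)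
qed

lemma chart_tangent_mem:
  "u \<in> charts_at M p \<Longrightarrow> v \<in> topspace (chart_model u) \<Longrightarrow> chart_tangent M u p v \<in> tangent_space M p"
  by (rule chart_tangent_obtain)

lemma chart_velocity_chart_tangent:
  assumes u: "u \<in> charts_at M p" and v: "v \<in> topspace (chart_model u)"
  shows "chart_velocity u (chart_tangent M u p v) = v"
proof -
  obtain c where c: "chart_tangent M u p v \<in> tangent_space M p" "c \<in> chart_tangent M u p v"
    "\<forall>\<^sub>F t in nhds 0. c t \<in> chart_dom u \<and> chart_map u (c t) = chart_map u p + t *\<^sub>R v"
    by (rule chart_tangent_obtain[OF assms])
  have "\<forall>\<^sub>F t in nhds 0. chart_map u p + t *\<^sub>R v = (chart_map u \<circ> c) t"
    using c(3) by (rule eventually_mono) simp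
  with has_curve_derivative_line[OF v]
  have "has_curve_derivative (chart_model u) (chart_map u \<circ> c) v 0"
    by (rule has_curve_derivative_cong)
  then show ?thesis
    by (rule chart_velocity_eqI[OF c(1,2) u])
qed

end

section \<open>Maps that are linear in charts\<close>

definition chart_projection ::
    "('n \<Rightarrow> 'm) \<Rightarrow> ('f::real_vector \<Rightarrow> 'e::real_vector) \<Rightarrow> ('n, 'f) chart \<Rightarrow> ('m, 'e) chart \<Rightarrow> bool" where
  "chart_projection f P U v \<longleftrightarrow>
     f ` chart_dom U \<subseteq> chart_dom v \<and> linear P \<and>
     continuous_map (chart_model U) (chart_model v) P \<and>
     (\<forall>q \<in> chart_dom U. chart_map v (f q) = P (chart_map U q))"

text \<open>The maps \<open>fst\<close> and \<open>snd\<close> on a product are treated uniformly as maps that are linear in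
  suitable charts; for these the chain rule is immediate.\<close>

definition linear_in_charts ::
    "('n, 'f::real_vector) manifold \<Rightarrow> ('m, 'e::real_vector) manifold \<Rightarrow> ('n \<Rightarrow> 'm) \<Rightarrow> bool" where
  "linear_in_charts N M f \<longleftrightarrow>
     (\<forall>U \<in> atlas N. \<exists>v \<in> atlas M. \<exists>P. chart_projection f P U v) \<and>
     (\<forall>p \<in> points N. \<forall>v \<in> charts_at M (f p). \<exists>U \<in> charts_at N p. \<exists>P. chart_projection f P U v)"

lemma chart_projection_fst:
  "chart_projection fst fst (prod_chart u v) u"
  by (auto simp: chart_projection_def linear_fst continuous_map_fst)

lemma chart_projection_snd:
  "chart_projection snd snd (prod_chart u v) v"
  by (auto simp: chart_projection_def linear_snd continuous_map_snd)

lemma charts_at_prod_manifold: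
  "charts_at (prod_manifold L M) (p, q) = {prod_chart u v | u v. u \<in> charts_at L p \<and> v \<in> charts_at M q}"
  by (force simp: charts_at_def prod_manifold_def)

lemma points_prod_manifold [simp]: "points (prod_manifold L M) = points L \<times> points M"
  by (simp add: prod_manifold_def)

text \<open>The two clauses of \<open>linear_in_charts\<close> serve different ends: local
  expressions of forms start from a chart of the product, velocities in the factor from a chart of
  the factor. For the second, a chart of the other factor around its component has to be supplied,
  and it exists because the charts of \<open>M\<close> cover \<open>M\<close>.\<close>

lemma linear_in_charts_fst:
  assumes "is_manifold M"
  shows "linear_in_charts (prod_manifold L M) L fst"
proof -
  have "\<exists>U \<in> charts_at (prod_manifold L M) (p, q). \<exists>P. chart_projection fst P U u"
    if "q \<in> points M" "u \<in> charts_at L p" for p q u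
    using charts_at_nonempty[OF assms that(1)] that(2) chart_projection_fst
    unfolding charts_at_prod_manifold by fast
  moreover have "\<exists>u \<in> atlas L. \<exists>P. chart_projection fst P U u" if "U \<in> atlas (prod_manifold L M)" for U
    using that chart_projection_fst unfolding prod_manifold_def by fastforce
  ultimately show ?thesis
    unfolding linear_in_charts_def by auto
qed

lemma linear_in_charts_snd:
  assumes "is_manifold L"
  shows "linear_in_charts (prod_manifold L M) M snd"
proof -
  have "\<exists>U \<in> charts_at (prod_manifold L M) (p, q). \<exists>P. chart_projection snd P U v"
    if "p \<in> points L" "v \<in> charts_at M q" for p q v
    using charts_at_nonempty[OF assms that(1)] that(2) chart_projection_snd
    unfolding charts_at_prod_manifold by fast
  moreover have "\<exists>v \<in> atlas M. \<exists>P. chart_projection snd P U v" if "U \<in> atlas (prod_manifold L M)" for U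
    using that chart_projection_snd unfolding prod_manifold_def by fastforce
  ultimately show ?thesis
    unfolding linear_in_charts_def by auto
qed

lemma chart_projection_charts_at:
  assumes "chart_projection f P U v" "U \<in> charts_at N p" "v \<in> atlas M"
  shows "v \<in> charts_at M (f p)"
  using assms by (auto simp: chart_projection_def charts_at_def)

lemma chart_projection_has_derivative:
  assumes "manifold_curve N c" "U \<in> charts_at N (c t)" and P: "chart_projection f P U v"
    and "has_curve_derivative (chart_model U) (chart_map U \<circ> c) w t"
  shows "has_curve_derivative (chart_model v) (chart_map v \<circ> (f \<circ> c)) (P w) t"
proof (rule has_curve_derivative_cong)
  show "has_curve_derivative (chart_model v) (P \<circ> (chart_map U \<circ> c)) (P w) t"
    using assms by (auto simp: chart_projection_def intro: has_curve_derivative_linear)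
  show "\<forall>\<^sub>F s in nhds t. (P \<circ> (chart_map U \<circ> c)) s = (chart_map v \<circ> (f \<circ> c)) s"
    using manifold_curve_eventually[OF assms(1,2)]
    by (rule eventually_mono) (use P in \<open>simp add: chart_projection_def\<close>)
qed

context
  fixes N :: "('n, 'f::real_vector) manifold" and M :: "('m, 'e::real_vector) manifold"
    and f :: "'n \<Rightarrow> 'm"
  assumes N: "is_manifold N" and M: "is_manifold M" and f: "linear_in_charts N M f"
begin

lemma linear_in_charts_points:
  assumes "p \<in> points N"
  shows "f p \<in> points M"
proof -
  obtain U where "U \<in> atlas N" "p \<in> chart_dom U"
    using is_manifold_points[OF N] assms by blast
  moreover obtain v P where "v \<in> atlas M" "chart_projection f P U v"
    using f calculation(1) unfolding linear_in_charts_def by blast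
  ultimately show ?thesis
    using is_manifold_points[OF M] by (auto simp: chart_projection_def)
qed

text \<open>Around each time some chart of \<open>N\<close> is mapped linearly into the given chart
  of \<open>M\<close>; openness and smoothness are therefore verified locally, the latter through
  \<open>smooth_curve_on_local\<close>.\<close>

lemma manifold_curve_compose:
  assumes c: "manifold_curve N c"
  shows "manifold_curve M (f \<circ> c)"
  unfolding manifold_curve_def
proof (intro conjI ballI)
  show "range (f \<circ> c) \<subseteq> points M"
    using c linear_in_charts_points by (auto simp: manifold_curve_def)
  fix v assume v: "v \<in> atlas M"
  have loc: "\<exists>U P. U \<in> atlas N \<and> chart_projection f P U v \<and> t \<in> c -` chart_dom U"
    if "t \<in> (f \<circ> c) -` chart_dom v" for t
  proof -
    have "c t \<in> points N" "v \<in> charts_at M (f (c t))"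
      using that v c by (auto simp: manifold_curve_def charts_at_def)
    then show ?thesis
      using f unfolding linear_in_charts_def charts_at_def by fastforce
  qed
  have sub: "c -` chart_dom U \<subseteq> (f \<circ> c) -` chart_dom v" if "chart_projection f P U v" for U P
    using that by (auto simp: chart_projection_def)
  show "open ((f \<circ> c) -` chart_dom v)"
  proof (subst open_subopen, rule ballI)
    fix t assume "t \<in> (f \<circ> c) -` chart_dom v"
    from loc[OF this] obtain U P where "U \<in> atlas N" "chart_projection f P U v" "t \<in> c -` chart_dom U"
      by auto
    then show "\<exists>T. open T \<and> t \<in> T \<and> T \<subseteq> (f \<circ> c) -` chart_dom v"
      using manifold_curve_open_vimage[OF c] sub[of P U] by blast
  qed
  then show "smooth_curve_on ((f \<circ> c) -` chart_dom v) (chart_model v) (chart_map v \<circ> (f \<circ> c))"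
  proof (rule smooth_curve_on_local[OF chart_on_Hausdorff[OF is_manifold_chart_on[OF M v]]])
    fix t assume "t \<in> (f \<circ> c) -` chart_dom v"
    from loc[OF this] obtain U P where U: "U \<in> atlas N" "chart_projection f P U v" "t \<in> c -` chart_dom U"
      by auto
    then have "smooth_curve_on (c -` chart_dom U) (chart_model v) (P \<circ> (chart_map U \<circ> c))"
      using manifold_curve_smooth_curve_on[OF c U(1)]
      by (auto simp: chart_projection_def intro: smooth_curve_on_linear)
    then show "\<exists>I c'. open I \<and> t \<in> I \<and> smooth_curve_on I (chart_model v) c' \<and>
        (\<forall>s\<in>I. c' s = (chart_map v \<circ> (f \<circ> c)) s)"
      using U manifold_curve_open_vimage[OF c U(1)]
      by (intro exI[of _ "c -` chart_dom U"] exI[of _ "P \<circ> (chart_map U \<circ> c)"])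
        (auto simp: chart_projection_def)
  qed
qed

lemma tangent_rel_compose:
  assumes "(c, d) \<in> tangent_rel N"
  shows "(f \<circ> c, f \<circ> d) \<in> tangent_rel M"
proof -
  note c = tangent_relD[OF assms]
  have "\<exists>w. has_curve_derivative (chart_model v) (chart_map v \<circ> (f \<circ> c)) w 0 \<and>
      has_curve_derivative (chart_model v) (chart_map v \<circ> (f \<circ> d)) w 0"
    if v: "v \<in> charts_at M (f (c 0))" for v
  proof -
    have "c 0 \<in> points N"
      using c(1) by (auto simp: manifold_curve_def)
    then obtain U P where U: "U \<in> charts_at N (c 0)" "chart_projection f P U v"
      using v f unfolding linear_in_charts_def by blast
    then have U': "U \<in> charts_at N (d 0)"
      using c(3) by simp
    show ?thesis
      using c(4)[OF U(1)] chart_projection_has_derivative[OF c(1) U]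
        chart_projection_has_derivative[OF c(2) U' U(2)] by blast
  qed
  then show ?thesis
    using c(1-3) by (simp add: tangent_rel_def manifold_curve_compose)
qed

text \<open>\<open>tangent_map\<close> unites the classes of \<open>f \<circ> c\<close> over all
  representatives; they coincide, because composition with \<open>f\<close> respects
  \<open>tangent_rel\<close>.\<close>

lemma tangent_map_eq:
  assumes X: "X \<in> tangent_space N p" "c \<in> X"
  shows "tangent_map M f X = tangent_rel M `` {f \<circ> c}"
proof -
  have "(f \<circ> c, f \<circ> d) \<in> tangent_rel M" if "d \<in> X" for d
    using tangent_space_memD(3)[OF N X] that by (blast intro: tangent_rel_compose)
  then have "tangent_rel M `` {f \<circ> d} = tangent_rel M `` {f \<circ> c}" if "d \<in> X" for d
    using tangent_rel_Image_eq[OF M] that by blast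
  then show ?thesis
    unfolding tangent_map_def using X(2) by blast
qed

lemma tangent_map_mem:
  assumes X: "X \<in> tangent_space N p"
  shows "tangent_map M f X \<in> tangent_space M (f p)"
    and "c \<in> X \<Longrightarrow> f \<circ> c \<in> tangent_map M f X"
proof -
  show "f \<circ> c \<in> tangent_map M f X" if "c \<in> X" for c
    using tangent_map_eq[OF X that] tangent_rel_refl manifold_curve_compose
      tangent_space_memD(1)[OF N X that] by blast
  obtain c where "c \<in> X" "manifold_curve N c" "c 0 = p"
    using tangent_space_obtain[OF N X] by metis
  then show "tangent_map M f X \<in> tangent_space M (f p)"
    using tangent_spaceI[OF M manifold_curve_compose, of c] tangent_map_eq[OF X] by simp
qed

lemma chart_velocity_tangent_map:
  assumes X: "X \<in> tangent_space N p" and U: "U \<in> charts_at N p" and v: "v \<in> charts_at M (f p)"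
    and P: "chart_projection f P U v"
  shows "chart_velocity v (tangent_map M f X) = P (chart_velocity U X)"
proof -
  obtain c where c: "c \<in> X" "manifold_curve N c" "c 0 = p"
    using tangent_space_obtain[OF N X] by metis
  have "U \<in> charts_at N (c 0)"
    using U c(3) by simp
  from chart_projection_has_derivative[OF c(2) this P has_curve_derivative_chart_velocity[OF N X c(1) U]]
  show ?thesis
    by (rule chart_velocity_eqI[OF M tangent_map_mem(1)[OF X] tangent_map_mem(2)[OF X c(1)] v])
qed

text \<open>A linear \<open>P\<close> takes the coordinate line in direction \<open>w\<close> to the
  coordinate line in direction \<open>P w\<close>, so a representative of the one tangent vector is
  mapped to a representative of the other.\<close>

lemma tangent_map_chart_tangent:
  assumes U: "U \<in> charts_at N p" and v: "v \<in> charts_at M (f p)"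
    and P: "chart_projection f P U v" and w: "w \<in> topspace (chart_model U)"
  shows "tangent_map M f (chart_tangent N U p w) = chart_tangent M v (f p) (P w)"
proof -
  obtain c where c: "chart_tangent N U p w \<in> tangent_space N p" "c \<in> chart_tangent N U p w"
    "\<forall>\<^sub>F t in nhds 0. c t \<in> chart_dom U \<and> chart_map U (c t) = chart_map U p + t *\<^sub>R w"
    by (rule chart_tangent_obtain[OF N U w])
  have "\<forall>\<^sub>F t in nhds 0. (f \<circ> c) t \<in> chart_dom v \<and>
      chart_map v ((f \<circ> c) t) = chart_map v (f p) + t *\<^sub>R P w"
    using c(3)
  proof (rule eventually_mono)
    fix t assume t: "c t \<in> chart_dom U \<and> chart_map U (c t) = chart_map U p + t *\<^sub>R w"
    moreover have "p \<in> chart_dom U" "linear P"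
      using U P by (auto simp: charts_at_def chart_projection_def)
    ultimately show "(f \<circ> c) t \<in> chart_dom v \<and>
        chart_map v ((f \<circ> c) t) = chart_map v (f p) + t *\<^sub>R P w"
      using P by (auto simp: chart_projection_def linear_add linear_cmul)
  qed
  then show ?thesis
    using chart_tangent_eqI[OF M v tangent_map_mem(1)[OF c(1)] tangent_map_mem(2)[OF c(1,2)]] by simp
qed

lemma tangent_lincomb_tangent_map:
  assumes "tangent_lincomb N p X a Y b Z"
  shows "tangent_lincomb M (f p) (tangent_map M f X) a (tangent_map M f Y) b (tangent_map M f Z)"
proof -
  have T: "X \<in> tangent_space N p" "Y \<in> tangent_space N p" "Z \<in> tangent_space N p"
    and eq: "\<And>U. U \<in> charts_at N p \<Longrightarrow>
      chart_velocity U X = a *\<^sub>R chart_velocity U Y + b *\<^sub>R chart_velocity U Z"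
    using assms by (auto simp: tangent_lincomb_def)
  have "chart_velocity v (tangent_map M f X) =
      a *\<^sub>R chart_velocity v (tangent_map M f Y) + b *\<^sub>R chart_velocity v (tangent_map M f Z)"
    if v: "v \<in> charts_at M (f p)" for v
  proof -
    obtain U P where U: "U \<in> charts_at N p" "chart_projection f P U v"
      using f v tangent_space_points[OF N T(1)] unfolding linear_in_charts_def by blast
    then have "linear P"
      by (simp add: chart_projection_def)
    then show ?thesis
      using chart_velocity_tangent_map[OF _ U(1) v U(2)] T eq[OF U(1)]
      by (simp add: linear_add linear_cmul)
  qed
  then show ?thesis
    using T by (simp add: tangent_lincomb_def tangent_map_mem(1))
qed

end

section \<open>Differential forms under pullback\<close>

lemma tuplesD: "vs \<in> tuples k A \<Longrightarrow> length vs = k" "vs \<in> tuples k A \<Longrightarrow> i < k \<Longrightarrow> vs ! i \<in> A"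
  by (auto simp: tuples_def)

lemma tuples_map: "vs \<in> tuples k A \<Longrightarrow> f ` A \<subseteq> B \<Longrightarrow> map f vs \<in> tuples k B"
  by (auto simp: tuples_def)

lemma tuples_list_update: "vs \<in> tuples k A \<Longrightarrow> x \<in> A \<Longrightarrow> vs[i := x] \<in> tuples k A"
  using set_update_subset_insert[of vs i x] by (auto simp: tuples_def)

lemma tuples_delete: "vs \<in> tuples (Suc k) A \<Longrightarrow> i \<le> k \<Longrightarrow> take i vs @ drop (Suc i) vs \<in> tuples k A"
  using set_take_subset[of i vs] set_drop_subset[of "Suc i" vs] by (auto simp: tuples_def)

lemma tuples_Suc_0: "tuples (Suc 0) A = (\<lambda>x. [x]) ` A"
  by (auto simp: tuples_def length_Suc_conv)

section \<open>Convergence of forms uniformly on bounded sets\<close>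

lemma openin_alt_forms: "openin (alt_forms_topology k E) (alt_forms k E)"
  unfolding openin_alt_forms_topology alt_forms_open_def
proof (intro conjI ballI exI)
  show "bounded_in E {}"
    unfolding bounded_in_def by (auto intro: exI[of _ 1])
  show "(0::real) < 1"
    by simp
qed auto

lemma topspace_alt_forms_topology: "topspace (alt_forms_topology k E) = alt_forms k E"
proof
  show "topspace (alt_forms_topology k E) \<subseteq> alt_forms k E"
    using openin_topspace[of "alt_forms_topology k E"]
    unfolding openin_alt_forms_topology alt_forms_open_def by blast
qed (rule openin_subset[OF openin_alt_forms])

text \<open>The condition \<open>\<exists>\<delta><\<epsilon>\<close> in the proof is what makes the neighbourhood open: a strict pointwise
  inequality does not bound the supremum over \<open>B\<close> away from \<open>\<epsilon>\<close>.\<close>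

lemma limitin_alt_forms_iff:
  "limitin (alt_forms_topology k E) f l F \<longleftrightarrow>
     l \<in> alt_forms k E \<and> (\<forall>\<^sub>F x in F. f x \<in> alt_forms k E) \<and>
     (\<forall>B \<epsilon>. bounded_in E B \<longrightarrow> 0 < \<epsilon> \<longrightarrow> (\<forall>\<^sub>F x in F. \<forall>vs \<in> tuples k B. \<bar>f x vs - l vs\<bar> < \<epsilon>))"
    (is "?L \<longleftrightarrow> ?R")
proof
  assume L: ?L
  have l: "l \<in> alt_forms k E"
    using limitin_topspace[OF L] by (simp add: topspace_alt_forms_topology)
  have "\<forall>\<^sub>F x in F. \<forall>vs \<in> tuples k B. \<bar>f x vs - l vs\<bar> < \<epsilon>" if B: "bounded_in E B" "0 < \<epsilon>" for B \<epsilon>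
  proof -
    define T where "T = {\<beta> \<in> alt_forms k E. \<exists>\<delta><\<epsilon>. \<forall>vs \<in> tuples k B. \<bar>\<beta> vs - l vs\<bar> \<le> \<delta>}"
    have "alt_forms_open k E T"
      unfolding alt_forms_open_def
    proof (intro conjI ballI)
      fix \<alpha> assume "\<alpha> \<in> T"
      then obtain \<delta> where \<delta>: "\<delta> < \<epsilon>" "\<forall>vs \<in> tuples k B. \<bar>\<alpha> vs - l vs\<bar> \<le> \<delta>"
        by (auto simp: T_def)
      \<comment> \<open>Half of the gap between \<delta> and \<epsilon> as radius leaves the bound
        (\<epsilon> + \<delta>)/2, still below \<epsilon>.\<close>
      have "\<beta> \<in> T" if "\<beta> \<in> alt_forms k E" "\<forall>vs \<in> tuples k B. \<bar>\<beta> vs - \<alpha> vs\<bar> < (\<epsilon> - \<delta>) / 2" for \<beta>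
        unfolding T_def
      proof (intro CollectI conjI exI ballI)
        fix vs assume "vs \<in> tuples k B"
        then have *: "\<bar>\<beta> vs - \<alpha> vs\<bar> < (\<epsilon> - \<delta>) / 2" "\<bar>\<alpha> vs - l vs\<bar> \<le> \<delta>"
          using that(2) \<delta>(2) by blast+
        have "\<bar>\<beta> vs - \<alpha> vs + (\<alpha> vs - l vs)\<bar> \<le> (\<epsilon> - \<delta>) / 2 + \<delta>"
          by (rule order_trans[OF abs_triangle_ineq add_mono[OF less_imp_le[OF *(1)] *(2)]])
        moreover have "(\<epsilon> - \<delta>) / 2 + \<delta> = (\<epsilon> + \<delta>) / 2"
          by (simp add: field_simps)
        ultimately show "\<bar>\<beta> vs - l vs\<bar> \<le> (\<epsilon> + \<delta>) / 2"
          by simp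
      qed (use \<delta>(1) that(1) in auto)
      then show "\<exists>B \<epsilon>. bounded_in E B \<and> 0 < \<epsilon> \<and>
          (\<forall>\<beta>\<in>alt_forms k E. (\<forall>vs\<in>tuples k B. \<bar>\<beta> vs - \<alpha> vs\<bar> < \<epsilon>) \<longrightarrow> \<beta> \<in> T)"
        using B(1) \<delta>(1) by (intro exI[of _ B] exI[of _ "(\<epsilon> - \<delta>) / 2"]) auto
    qed (auto simp: T_def)
    moreover have "l \<in> T"
      using l B(2) by (auto simp: T_def)
    ultimately have "\<forall>\<^sub>F x in F. f x \<in> T"
      using limitinD[OF L] by (simp add: openin_alt_forms_topology)
    then show ?thesis
      by (rule eventually_mono) (fastforce simp: T_def)
  qed
  then show ?R
    using l limitinD[OF L openin_alt_forms l] by blast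
next
  assume R: ?R
  show ?L
    unfolding limitin_def topspace_alt_forms_topology openin_alt_forms_topology
  proof (intro conjI allI impI)
    fix U assume U: "alt_forms_open k E U \<and> l \<in> U"
    then obtain B \<epsilon> where B: "bounded_in E B" "0 < \<epsilon>"
      "\<forall>\<beta> \<in> alt_forms k E. (\<forall>vs \<in> tuples k B. \<bar>\<beta> vs - l vs\<bar> < \<epsilon>) \<longrightarrow> \<beta> \<in> U"
      unfolding alt_forms_open_def by blast
    then have "\<forall>\<^sub>F x in F. \<forall>vs \<in> tuples k B. \<bar>f x vs - l vs\<bar> < \<epsilon>" "\<forall>\<^sub>F x in F. f x \<in> alt_forms k E"
      using R by blast+
    then show "\<forall>\<^sub>F x in F. f x \<in> U"
      by eventually_elim (use B(3) in blast)
  qed (use R in blast)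
qed

lemma alt_formsD:
  assumes "\<alpha> \<in> alt_forms k E"
  shows "vs \<notin> tuples k (topspace E) \<Longrightarrow> \<alpha> vs = 0"
    and "vs \<in> tuples k (topspace E) \<Longrightarrow> i < k \<Longrightarrow> v \<in> topspace E \<Longrightarrow> w \<in> topspace E \<Longrightarrow>
      \<alpha> (vs[i := a *\<^sub>R v + b *\<^sub>R w]) = a * \<alpha> (vs[i := v]) + b * \<alpha> (vs[i := w])"
    and "vs \<in> tuples k (topspace E) \<Longrightarrow> \<not> distinct vs \<Longrightarrow> \<alpha> vs = 0"
    and "continuous_map (product_topology (\<lambda>_. E) {..<k}) euclideanreal (\<lambda>f. \<alpha> (map f [0..<k]))"
  using assms unfolding alt_forms_def by blast+

lemma alt_forms_add:
  assumes "\<alpha> \<in> alt_forms k E" "\<beta> \<in> alt_forms k E"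
  shows "\<alpha> + \<beta> \<in> alt_forms k E"
  using alt_formsD[OF assms(1)] alt_formsD[OF assms(2)]
  by (auto simp: alt_forms_def algebra_simps intro: continuous_map_add)

lemma alt_forms_scaleR:
  assumes "\<alpha> \<in> alt_forms k E"
  shows "r *\<^sub>R \<alpha> \<in> alt_forms k E"
  using alt_formsD[OF assms]
  by (auto simp: alt_forms_def scaleR_fun_def algebra_simps intro: continuous_map_real_mult_left)

lemma zero_in_alt_forms: "0 \<in> alt_forms k E"
  by (auto simp: alt_forms_def)

text \<open>Both errors are kept below half of \<epsilon> on the same bounded set. The explicit
  description of convergence takes the place of joint continuity of addition on the space of
  forms.\<close>

lemma limitin_alt_forms_add:
  assumes "limitin (alt_forms_topology k E) f l F" "limitin (alt_forms_topology k E) g m F"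
  shows "limitin (alt_forms_topology k E) (\<lambda>x. f x + g x) (l + m) F"
  unfolding limitin_alt_forms_iff
proof (intro conjI allI impI)
  note f = assms(1)[unfolded limitin_alt_forms_iff] and g = assms(2)[unfolded limitin_alt_forms_iff]
  show "l + m \<in> alt_forms k E"
    using f g by (simp add: alt_forms_add)
  have "\<forall>\<^sub>F x in F. f x \<in> alt_forms k E" "\<forall>\<^sub>F x in F. g x \<in> alt_forms k E"
    using f g by blast+
  then show "\<forall>\<^sub>F x in F. f x + g x \<in> alt_forms k E"
    by eventually_elim (rule alt_forms_add)
  fix B and \<epsilon> :: real assume "bounded_in E B" "0 < \<epsilon>"
  then have "\<forall>\<^sub>F x in F. \<forall>vs \<in> tuples k B. \<bar>f x vs - l vs\<bar> < \<epsilon> / 2"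
    "\<forall>\<^sub>F x in F. \<forall>vs \<in> tuples k B. \<bar>g x vs - m vs\<bar> < \<epsilon> / 2"
    using f g half_gt_zero by blast+
  then show "\<forall>\<^sub>F x in F. \<forall>vs \<in> tuples k B. \<bar>(f x + g x) vs - (l + m) vs\<bar> < \<epsilon>"
  proof eventually_elim
    case (elim x)
    show ?case
    proof
      fix vs assume "vs \<in> tuples k B"
      then have "\<bar>f x vs - l vs\<bar> < \<epsilon> / 2" "\<bar>g x vs - m vs\<bar> < \<epsilon> / 2"
        using elim by blast+
      then have "\<bar>f x vs - l vs + (g x vs - m vs)\<bar> < \<epsilon> / 2 + \<epsilon> / 2"
        by (intro order.strict_trans1[OF abs_triangle_ineq] add_strict_mono)
      then show "\<bar>(f x + g x) vs - (l + m) vs\<bar> < \<epsilon>"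
        by (simp add: algebra_simps)
    qed
  qed
qed

lemma smooth_curve_on_alt_forms_add:
  assumes "smooth_curve_on J (alt_forms_topology k E) c" "smooth_curve_on J (alt_forms_topology k E) c'"
  shows "smooth_curve_on J (alt_forms_topology k E) (\<lambda>t. c t + c' t)"
proof -
  obtain d d' where d: "d 0 = c" "d' 0 = c'"
    "\<And>n t. t \<in> J \<Longrightarrow> d n t \<in> alt_forms k E \<and> has_curve_derivative (alt_forms_topology k E) (d n) (d (Suc n) t) t"
    "\<And>n t. t \<in> J \<Longrightarrow> d' n t \<in> alt_forms k E \<and> has_curve_derivative (alt_forms_topology k E) (d' n) (d' (Suc n) t) t"
    using assms unfolding smooth_curve_on_def topspace_alt_forms_topology by metis
  have "has_curve_derivative (alt_forms_topology k E) (\<lambda>t. d n t + d' n t) (d (Suc n) t + d' (Suc n) t) t"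
    if "t \<in> J" for n t
  proof -
    have "(d n (t + h) + d' n (t + h) - (d n t + d' n t)) /\<^sub>R h =
        (d n (t + h) - d n t) /\<^sub>R h + (d' n (t + h) - d' n t) /\<^sub>R h" for h
      by (simp add: add_diff_add flip: scaleR_add_right)
    then show ?thesis
      using d(3)[OF that, of n] d(4)[OF that, of n]
      by (simp add: has_curve_derivative_def limitin_alt_forms_add)
  qed
  then show ?thesis
    unfolding smooth_curve_on_def topspace_alt_forms_topology
    using d by (intro exI[of _ "\<lambda>n t. d n t + d' n t"]) (auto simp: alt_forms_add)
qed

text \<open>The local expression of a pullback in charts where the map is \<open>P\<close>. The case
  distinction keeps the default value \<open>0\<close> off the model space, where the image under
  \<open>P\<close> may still be an admissible argument of \<open>\<alpha>\<close>.\<close>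

definition alt_form_pullback ::
    "nat \<Rightarrow> 'e::real_vector topology \<Rightarrow> ('e \<Rightarrow> 'f::real_vector) \<Rightarrow> ('f list \<Rightarrow> real) \<Rightarrow> 'e list \<Rightarrow> real" where
  "alt_form_pullback k E P \<alpha> vs = (if vs \<in> tuples k (topspace E) then \<alpha> (map P vs) else 0)"

lemma linear_alt_form_pullback: "linear (alt_form_pullback k E P)"
  by (rule linearI) (auto simp: alt_form_pullback_def scaleR_fun_def)

context
  fixes E :: "'e::real_vector topology" and F :: "'f::real_vector topology" and P :: "'e \<Rightarrow> 'f"
  assumes E: "topological_vector_space E" and P: "linear P" "continuous_map E F P"
begin

lemma image_topspace_subset: "P ` topspace E \<subseteq> topspace F"
  using P(2) by (rule continuous_map_image_subset_topspace)

lemma bounded_in_image: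
  assumes B: "bounded_in E B"
  shows "bounded_in F (P ` B)"
  unfolding bounded_in_def
proof (intro conjI allI impI)
  show "P ` B \<subseteq> topspace F"
    using B image_topspace_subset by (auto simp: bounded_in_def)
  fix U assume U: "openin F U \<and> 0 \<in> U"
  define V where "V = {x \<in> topspace E. P x \<in> U}"
  have "openin E V"
    using P(2) U unfolding V_def by (simp add: openin_continuous_map_preimage)
  moreover have "0 \<in> V"
    using E U linear_0[OF P(1)] by (simp add: V_def topological_vector_space_def subspace_0)
  ultimately obtain r where r: "r > 0" "\<forall>s. r \<le> \<bar>s\<bar> \<longrightarrow> B \<subseteq> (\<lambda>x. s *\<^sub>R x) ` V"
    using B unfolding bounded_in_def by blast
  have "P ` B \<subseteq> (\<lambda>x. s *\<^sub>R x) ` U" if "r \<le> \<bar>s\<bar>" for s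
    using r(2) that linear_cmul[OF P(1)] by (fastforce simp: V_def)
  then show "\<exists>r>0. \<forall>s. r \<le> \<bar>s\<bar> \<longrightarrow> P ` B \<subseteq> (\<lambda>x. s *\<^sub>R x) ` U"
    using r(1) by blast
qed

lemma alt_form_pullback_mem:
  assumes \<alpha>: "\<alpha> \<in> alt_forms k F"
  shows "alt_form_pullback k E P \<alpha> \<in> alt_forms k E"
proof -
  have "alt_form_pullback k E P \<alpha> (vs[i := a *\<^sub>R v + b *\<^sub>R w]) =
      a * alt_form_pullback k E P \<alpha> (vs[i := v]) + b * alt_form_pullback k E P \<alpha> (vs[i := w])"
    if "vs \<in> tuples k (topspace E)" "i < k" "v \<in> topspace E" "w \<in> topspace E" for vs i a b v w
  proof -
    have "a *\<^sub>R v + b *\<^sub>R w \<in> topspace E"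
      using E that by (auto simp: topological_vector_space_def intro!: subspace_add subspace_scale)
    moreover have "map P vs \<in> tuples k (topspace F)" "P v \<in> topspace F" "P w \<in> topspace F"
      using that image_topspace_subset by (auto intro: tuples_map)
    ultimately show ?thesis
      using that alt_formsD(2)[OF \<alpha>, of "map P vs" i "P v" "P w" a b]
      by (simp add: alt_form_pullback_def tuples_list_update map_update linear_add[OF P(1)] linear_cmul[OF P(1)])
  qed
  moreover have "alt_form_pullback k E P \<alpha> vs = 0"
    if "vs \<in> tuples k (topspace E)" "\<not> distinct vs" for vs
    using alt_formsD(3)[OF \<alpha> tuples_map[OF that(1) image_topspace_subset]] that
    by (simp add: alt_form_pullback_def distinct_map)
  moreover have "continuous_map (product_topology (\<lambda>_. E) {..<k}) euclideanreal
      (\<lambda>f. alt_form_pullback k E P \<alpha> (map f [0..<k]))"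
  proof (rule continuous_map_eq)
    have "continuous_map (product_topology (\<lambda>_. E) {..<k}) F (\<lambda>f. P (f i))" if "i < k" for i
      using continuous_map_compose[of "product_topology (\<lambda>_. E) {..<k}" E "\<lambda>f. f i" F P] P(2) that
        continuous_map_product_projection[of i "{..<k}" "\<lambda>_. E"]
      by (simp add: o_def)
    \<comment> \<open>Points of a product topology are undefined off the index set, hence the
      restriction to \<open>{..<k}\<close>; the list \<open>map _ [0..<k]\<close> does not see
      it.\<close>
    then have "continuous_map (product_topology (\<lambda>_. E) {..<k}) (product_topology (\<lambda>_. F) {..<k})
        (\<lambda>f. \<lambda>i\<in>{..<k}. P (f i))"
      by (auto simp: continuous_map_componentwise)
    from continuous_map_compose[OF this alt_formsD(4)[OF \<alpha>]]
    show "continuous_map (product_topology (\<lambda>_. E) {..<k}) euclideanreal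
        ((\<lambda>f. \<alpha> (map f [0..<k])) \<circ> (\<lambda>f. \<lambda>i\<in>{..<k}. P (f i)))" .
    fix f assume "f \<in> topspace (product_topology (\<lambda>_. E) {..<k})"
    then have "map f [0..<k] \<in> tuples k (topspace E)"
      by (auto simp: tuples_def PiE_def Pi_def)
    moreover have "map (\<lambda>i\<in>{..<k}. P (f i)) [0..<k] = map P (map f [0..<k])"
      by simp
    ultimately show "((\<lambda>f. \<alpha> (map f [0..<k])) \<circ> (\<lambda>f. \<lambda>i\<in>{..<k}. P (f i))) f =
        alt_form_pullback k E P \<alpha> (map f [0..<k])"
      unfolding alt_form_pullback_def o_def by presburger
  qed
  ultimately show ?thesis
    unfolding alt_forms_def by (auto simp: alt_form_pullback_def)
qed

text \<open>Continuous linear maps preserve bounded sets, so closeness of two forms on the bounded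
  image of \<open>B\<close> gives closeness of their pullbacks on \<open>B\<close>. With linearity
  this lets \<open>smooth_curve_on_linear\<close> carry smooth curves of forms along the
  pullback.\<close>

lemma continuous_map_alt_form_pullback:
  "continuous_map (alt_forms_topology k F) (alt_forms_topology k E) (alt_form_pullback k E P)"
  unfolding continuous_map_def topspace_alt_forms_topology openin_alt_forms_topology
proof (intro conjI allI impI)
  show "alt_form_pullback k E P \<in> alt_forms k F \<rightarrow> alt_forms k E"
    by (auto intro: alt_form_pullback_mem)
  fix T assume T: "alt_forms_open k E T"
  show "alt_forms_open k F {\<alpha> \<in> alt_forms k F. alt_form_pullback k E P \<alpha> \<in> T}"
    unfolding alt_forms_open_def
  proof (intro conjI ballI)
    fix \<alpha> assume "\<alpha> \<in> {\<alpha> \<in> alt_forms k F. alt_form_pullback k E P \<alpha> \<in> T}"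
    then obtain B \<epsilon> where B: "bounded_in E B" "0 < \<epsilon>"
      "\<forall>\<beta>\<in>alt_forms k E. (\<forall>vs\<in>tuples k B. \<bar>\<beta> vs - alt_form_pullback k E P \<alpha> vs\<bar> < \<epsilon>) \<longrightarrow> \<beta> \<in> T"
      using T unfolding alt_forms_open_def by blast
    have "alt_form_pullback k E P \<beta> \<in> T"
      if \<beta>: "\<beta> \<in> alt_forms k F" "\<forall>vs\<in>tuples k (P ` B). \<bar>\<beta> vs - \<alpha> vs\<bar> < \<epsilon>" for \<beta>
    proof -
      have "\<bar>alt_form_pullback k E P \<beta> vs - alt_form_pullback k E P \<alpha> vs\<bar> < \<epsilon>"
        if "vs \<in> tuples k B" for vs
        using \<beta>(2) tuples_map[OF that, of P] B(2) by (simp add: alt_form_pullback_def)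
      then show ?thesis
        using B(3) alt_form_pullback_mem[OF \<beta>(1)] by blast
    qed
    then show "\<exists>B \<epsilon>. bounded_in F B \<and> 0 < \<epsilon> \<and>
        (\<forall>\<beta>\<in>alt_forms k F. (\<forall>vs\<in>tuples k B. \<bar>\<beta> vs - \<alpha> vs\<bar> < \<epsilon>) \<longrightarrow>
          \<beta> \<in> {\<alpha> \<in> alt_forms k F. alt_form_pullback k E P \<alpha> \<in> T})"
      using bounded_in_image[OF B(1)] B(2) by blast
  qed auto
qed

end

section \<open>Forms on manifolds and exterior derivatives\<close>

lemma form_atD:
  assumes "form_at M k p \<alpha>"
  shows "Xs \<in> tuples k (tangent_space M p) \<Longrightarrow> i < k \<Longrightarrow> tangent_lincomb M p X a Y b Z \<Longrightarrow>
      \<alpha> (Xs[i := X]) = a * \<alpha> (Xs[i := Y]) + b * \<alpha> (Xs[i := Z])"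
    and "Xs \<in> tuples k (tangent_space M p) \<Longrightarrow> \<not> distinct Xs \<Longrightarrow> \<alpha> Xs = 0"
    and "u \<in> charts_at M p \<Longrightarrow> chart_form M u k p \<alpha> \<in> alt_forms k (chart_model u)"
  using assms unfolding form_at_def by blast+

lemma chart_form_add:
  "chart_form M u k p (\<lambda>Xs. \<alpha> Xs + \<beta> Xs) = chart_form M u k p \<alpha> + chart_form M u k p \<beta>"
  by (auto simp: chart_form_def)

lemma chart_form_scaleR:
  "chart_form M u k p (\<lambda>Xs. r * \<alpha> Xs) = r *\<^sub>R chart_form M u k p \<alpha>"
  by (auto simp: chart_form_def scaleR_fun_def)

lemma form_at_add:
  assumes "form_at M k p \<alpha>" "form_at M k p \<beta>"
  shows "form_at M k p (\<lambda>Xs. \<alpha> Xs + \<beta> Xs)"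
  using form_atD[OF assms(1)] form_atD[OF assms(2)]
  by (auto simp: form_at_def chart_form_add alt_forms_add algebra_simps)

lemma form_at_scaleR:
  assumes "form_at M k p \<alpha>"
  shows "form_at M k p (\<lambda>Xs. r * \<alpha> Xs)"
  using form_atD[OF assms]
  by (auto simp: form_at_def chart_form_scaleR alt_forms_scaleR algebra_simps)

lemma local_form_add:
  "local_form M u k (\<lambda>p Xs. \<omega> p Xs + \<tau> p Xs) x = local_form M u k \<omega> x + local_form M u k \<tau> x"
  by (simp add: local_form_def chart_form_add)

lemma Forms_add:
  assumes "\<omega> \<in> Forms M k" "\<tau> \<in> Forms M k"
  shows "(\<lambda>p Xs. \<omega> p Xs + \<tau> p Xs) \<in> Forms M k"
  using assms smooth_curve_on_alt_forms_add
  by (fastforce simp: Forms_def form_at_add smooth_map_on_def local_form_add o_def)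

text \<open>\<open>deriv\<close> is a choice among the derivatives and makes sense for any function.
  The two functions have the same derivatives at \<open>x\<close>, if any, so the choices agree
  without a proof of differentiability.\<close>

lemma deriv_const_add:
  fixes f :: "real \<Rightarrow> real"
  shows "deriv (\<lambda>t. c + f t) x = deriv f x"
proof -
  have "DERIV f x :> D" if "DERIV (\<lambda>t. c + f t) x :> D" for D
    using DERIV_diff[OF that DERIV_const[of c]] by simp
  moreover have "DERIV (\<lambda>t. c + f t) x :> D" if "DERIV f x :> D" for D
    using DERIV_add[OF DERIV_const[of c] that] by simp
  ultimately show ?thesis
    unfolding deriv_def by metis
qed

lemma chart_line_eventually:
  assumes "is_manifold M" "u \<in> atlas M" "x \<in> chart_map u ` chart_dom u" "v \<in> topspace (chart_model u)"
  shows "\<forall>\<^sub>F t in nhds 0. x + t *\<^sub>R v \<in> chart_map u ` chart_dom u"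
  using is_manifold_chart_on[OF assms(1,2)] assms(3,4)
  by (auto intro!: cinf_open_line_eventually intro: chart_onD)

text \<open>In each chart \<open>\<tau>\<close> only adds a number to the function differentiated in
  every term; the number depends on the chart and the remaining vectors, not on the base point. This
  is the form in which dz enters.\<close>

lemma has_ext_derivative_add_const:
  assumes M: "is_manifold M" and \<omega>: "has_ext_derivative M k \<omega> \<zeta>"
    and \<tau>: "\<And>u. u \<in> atlas M \<Longrightarrow> \<exists>\<kappa>. \<forall>x \<in> chart_map u ` chart_dom u. local_form M u k \<tau> x = \<kappa>"
  shows "has_ext_derivative M k (\<lambda>p Xs. \<tau> p Xs + \<omega> p Xs) \<zeta>"
  unfolding has_ext_derivative_def
proof (intro ballI)
  fix u x vs
  assume u: "u \<in> atlas M" and x: "x \<in> chart_map u ` chart_dom u"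
    and vs: "vs \<in> tuples (Suc k) (topspace (chart_model u))"
  obtain \<kappa> where \<kappa>: "\<forall>x \<in> chart_map u ` chart_dom u. local_form M u k \<tau> x = \<kappa>"
    using \<tau>[OF u] by blast
  have "deriv (\<lambda>t. local_form M u k (\<lambda>p Xs. \<tau> p Xs + \<omega> p Xs) (x + t *\<^sub>R vs ! i) ws) 0 =
      deriv (\<lambda>t. local_form M u k \<omega> (x + t *\<^sub>R vs ! i) ws) 0" if "i \<le> k" for i ws
  proof -
    have "\<forall>\<^sub>F t in nhds 0. x + t *\<^sub>R vs ! i \<in> chart_map u ` chart_dom u"
      using chart_line_eventually[OF M u x] tuplesD(2)[OF vs, of i] that by simp
    then have "\<forall>\<^sub>F t in nhds 0. local_form M u k (\<lambda>p Xs. \<tau> p Xs + \<omega> p Xs) (x + t *\<^sub>R vs ! i) ws =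
        \<kappa> ws + local_form M u k \<omega> (x + t *\<^sub>R vs ! i) ws"
      by (rule eventually_mono) (simp add: \<kappa> local_form_add)
    from deriv_cong_ev[OF this refl] show ?thesis
      by (simp add: deriv_const_add)
  qed
  then show "local_form M u (Suc k) \<zeta> x vs =
      (\<Sum>i\<le>k. (-1) ^ i * deriv (\<lambda>t. local_form M u k (\<lambda>p Xs. \<tau> p Xs + \<omega> p Xs) (x + t *\<^sub>R vs ! i)
        (take i vs @ drop (Suc i) vs)) 0)"
    using \<omega>[unfolded has_ext_derivative_def, rule_format, OF u x vs] by simp
qed

lemma chart_projection_image:
  assumes "chart_projection f P U v" "x \<in> chart_map U ` chart_dom U"
  shows "P x \<in> chart_map v ` chart_dom v"
proof -
  obtain q where q: "q \<in> chart_dom U" "x = chart_map U q"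
    using assms(2) by blast
  then have "P x = chart_map v (f q)" "f q \<in> chart_dom v"
    using assms(1) by (auto simp: chart_projection_def)
  then show ?thesis
    by simp
qed

section \<open>Pullback of forms along maps that are linear in charts\<close>

context
  fixes N :: "('n, 'f::real_vector) manifold" and M :: "('m, 'e::real_vector) manifold"
    and f :: "'n \<Rightarrow> 'm"
  assumes N: "is_manifold N" and M: "is_manifold M" and f: "linear_in_charts N M f"
begin

lemma chart_projection_obtain:
  assumes "U \<in> atlas N"
  obtains v P where "v \<in> atlas M" "chart_projection f P U v" "linear P"
    "continuous_map (chart_model U) (chart_model v) P" "topological_vector_space (chart_model U)"
    "P ` topspace (chart_model U) \<subseteq> topspace (chart_model v)"
proof -
  obtain v P where "v \<in> atlas M" "chart_projection f P U v"
    using assms f unfolding linear_in_charts_def by blast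
  then show ?thesis
    using that is_manifold_chart_on[OF N assms] chart_on_topological_vector_space
    by (auto simp: chart_projection_def continuous_map_image_subset_topspace)
qed

lemma chart_form_tangent_map:
  assumes U: "U \<in> charts_at N p" and v: "v \<in> atlas M" and P: "chart_projection f P U v"
  shows "chart_form N U k p (\<lambda>Xs. \<alpha> (map (tangent_map M f) Xs)) =
    alt_form_pullback k (chart_model U) P (chart_form M v k (f p) \<alpha>)"
proof
  fix vs
  have v': "v \<in> charts_at M (f p)"
    using chart_projection_charts_at[OF P U v] .
  show "chart_form N U k p (\<lambda>Xs. \<alpha> (map (tangent_map M f) Xs)) vs =
    alt_form_pullback k (chart_model U) P (chart_form M v k (f p) \<alpha>) vs"
  proof (cases "vs \<in> tuples k (topspace (chart_model U))")
    case True
    moreover have "P ` topspace (chart_model U) \<subseteq> topspace (chart_model v)"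
      using P by (simp add: chart_projection_def continuous_map_image_subset_topspace)
    then have "map P vs \<in> tuples k (topspace (chart_model v))"
      using tuples_map[OF True] by blast
    moreover have "map (tangent_map M f) (map (chart_tangent N U p) vs) =
        map (chart_tangent M v (f p)) (map P vs)"
      using True tangent_map_chart_tangent[OF N M f U v' P] by (auto simp: tuples_def)
    ultimately show ?thesis
      unfolding chart_form_def alt_form_pullback_def by presburger
  qed (simp add: chart_form_def alt_form_pullback_def)
qed

lemma form_at_tangent_map:
  assumes \<alpha>: "form_at M k (f p) \<alpha>"
  shows "form_at N k p (\<lambda>Xs. \<alpha> (map (tangent_map M f) Xs))"
  unfolding form_at_def
proof (intro conjI ballI allI impI)
  have tup: "map (tangent_map M f) Xs \<in> tuples k (tangent_space M (f p))"
    if "Xs \<in> tuples k (tangent_space N p)" for Xs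
    by (rule tuples_map[OF that]) (auto intro: tangent_map_mem(1)[OF N M f])
  fix Xs assume Xs: "Xs \<in> tuples k (tangent_space N p)"
  show "\<alpha> (map (tangent_map M f) (Xs[i := X])) =
      a * \<alpha> (map (tangent_map M f) (Xs[i := Y])) + b * \<alpha> (map (tangent_map M f) (Xs[i := Z]))"
    if "i < k" "tangent_lincomb N p X a Y b Z" for i X a Y b Z
    using form_atD(1)[OF \<alpha> tup[OF Xs] that(1) tangent_lincomb_tangent_map[OF N M f that(2)]]
    by (simp add: map_update)
  show "\<alpha> (map (tangent_map M f) Xs) = 0" if "\<not> distinct Xs"
    using form_atD(2)[OF \<alpha> tup[OF Xs]] that by (simp add: distinct_map)
next
  fix U assume U: "U \<in> charts_at N p"
  then have "U \<in> atlas N"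
    by (simp add: charts_at_def)
  then obtain v P where vP: "v \<in> atlas M" "chart_projection f P U v" "linear P"
    "continuous_map (chart_model U) (chart_model v) P" "topological_vector_space (chart_model U)"
    by (rule chart_projection_obtain)
  show "chart_form N U k p (\<lambda>Xs. \<alpha> (map (tangent_map M f) Xs)) \<in> alt_forms k (chart_model U)"
    unfolding chart_form_tangent_map[OF U vP(1,2)]
    using alt_form_pullback_mem[OF vP(5,3,4)] form_atD(3)[OF \<alpha>] chart_projection_charts_at[OF vP(2) U vP(1)]
    by blast
qed

lemma local_form_pullback:
  assumes U: "U \<in> atlas N" and v: "v \<in> atlas M" and P: "chart_projection f P U v"
    and x: "x \<in> chart_map U ` chart_dom U"
  shows "local_form N U k (pullback M f \<omega>) x =
    alt_form_pullback k (chart_model U) P (local_form M v k \<omega> (P x))"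
proof -
  obtain p where p: "p \<in> chart_dom U" "x = chart_map U p"
    using x by blast
  then have "chart_inv U x = p" "U \<in> charts_at N p"
    using chart_on_inv[OF is_manifold_chart_on[OF N U]] U by (auto simp: charts_at_def)
  moreover have "chart_inv v (P x) = f p"
    using p P chart_on_inv[OF is_manifold_chart_on[OF M v], of "f p"] by (auto simp: chart_projection_def)
  ultimately show ?thesis
    using chart_form_tangent_map[OF _ v P] by (simp add: local_form_def pullback_def)
qed

text \<open>In charts the local form is \<open>P\<close>, followed by the given local form, followed
  by \<open>alt_form_pullback\<close>. The outer maps are continuous and linear, hence preserve
  smooth curves by \<open>smooth_curve_on_linear\<close>; the middle one preserves them by
  hypothesis.\<close>

lemma Forms_pullback:
  assumes \<omega>: "\<omega> \<in> Forms M k"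
  shows "pullback M f \<omega> \<in> Forms N k"
  unfolding Forms_def
proof (intro CollectI conjI ballI)
  fix p assume "p \<in> points N"
  then show "form_at N k p (pullback M f \<omega> p)"
    using \<omega> linear_in_charts_points[OF N M f] form_at_tangent_map by (simp add: Forms_def pullback_def)
next
  fix U assume U: "U \<in> atlas N"
  obtain v P where vP: "v \<in> atlas M" "chart_projection f P U v" "linear P"
    "continuous_map (chart_model U) (chart_model v) P" "topological_vector_space (chart_model U)"
    by (rule chart_projection_obtain[OF U])
  show "smooth_map_on (chart_map U ` chart_dom U) (chart_model U)
      (alt_forms_topology k (chart_model U)) (local_form N U k (pullback M f \<omega>))"
    unfolding smooth_map_on_def
  proof (intro allI impI, elim conjE)
    fix c assume c: "smooth_curve_on UNIV (chart_model U) c" "range c \<subseteq> chart_map U ` chart_dom U"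
    have "smooth_curve_on UNIV (chart_model v) (P \<circ> c)"
      by (rule smooth_curve_on_linear[OF c(1) vP(3,4)])
    moreover have "range (P \<circ> c) \<subseteq> chart_map v ` chart_dom v"
      using c(2) chart_projection_image[OF vP(2)] by auto
    ultimately have "smooth_curve_on UNIV (alt_forms_topology k (chart_model v))
        (local_form M v k \<omega> \<circ> (P \<circ> c))"
      using \<omega> vP(1) unfolding Forms_def smooth_map_on_def by blast
    then have "smooth_curve_on UNIV (alt_forms_topology k (chart_model U))
        (alt_form_pullback k (chart_model U) P \<circ> (local_form M v k \<omega> \<circ> (P \<circ> c)))"
      by (rule smooth_curve_on_linear[OF _ linear_alt_form_pullback
            continuous_map_alt_form_pullback[OF vP(5,3,4)]])
    moreover have "local_form N U k (pullback M f \<omega>) \<circ> c =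
        alt_form_pullback k (chart_model U) P \<circ> (local_form M v k \<omega> \<circ> (P \<circ> c))"
    proof
      fix t
      have "c t \<in> chart_map U ` chart_dom U"
        using c(2) by blast
      then show "(local_form N U k (pullback M f \<omega>) \<circ> c) t =
          (alt_form_pullback k (chart_model U) P \<circ> (local_form M v k \<omega> \<circ> (P \<circ> c))) t"
        unfolding o_def by (rule local_form_pullback[OF U vP(1,2)])
    qed
    ultimately show "smooth_curve_on UNIV (alt_forms_topology k (chart_model U))
        (local_form N U k (pullback M f \<omega>) \<circ> c)"
      by simp
  qed
qed

text \<open>\<open>P\<close> takes the line through \<open>x\<close> along the i-th vector to the
  line through \<open>P x\<close> along its image, so near \<open>0\<close> each term differentiates
  the same real function on both sides.\<close>

lemma has_ext_derivative_pullback: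
  assumes \<omega>: "has_ext_derivative M k \<omega> \<zeta>"
  shows "has_ext_derivative N k (pullback M f \<omega>) (pullback M f \<zeta>)"
  unfolding has_ext_derivative_def
proof (intro ballI)
  fix U x vs
  assume U: "U \<in> atlas N" and x: "x \<in> chart_map U ` chart_dom U"
    and vs: "vs \<in> tuples (Suc k) (topspace (chart_model U))"
  obtain v P where vP: "v \<in> atlas M" "chart_projection f P U v" "linear P"
    "continuous_map (chart_model U) (chart_model v) P" "topological_vector_space (chart_model U)"
    "P ` topspace (chart_model U) \<subseteq> topspace (chart_model v)"
    by (rule chart_projection_obtain[OF U])
  have vs': "map P vs \<in> tuples (Suc k) (topspace (chart_model v))"
    by (rule tuples_map[OF vs vP(6)])
  have "deriv (\<lambda>t. local_form N U k (pullback M f \<omega>) (x + t *\<^sub>R vs ! i)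
        (take i vs @ drop (Suc i) vs)) 0 =
      deriv (\<lambda>t. local_form M v k \<omega> (P x + t *\<^sub>R map P vs ! i)
        (take i (map P vs) @ drop (Suc i) (map P vs))) 0" if i: "i \<le> k" for i
  proof (rule deriv_cong_ev[OF _ refl])
    have "\<forall>\<^sub>F t in nhds 0. x + t *\<^sub>R vs ! i \<in> chart_map U ` chart_dom U"
      using chart_line_eventually[OF N U x] tuplesD(2)[OF vs, of i] i by simp
    then show "\<forall>\<^sub>F t in nhds 0. local_form N U k (pullback M f \<omega>) (x + t *\<^sub>R vs ! i)
          (take i vs @ drop (Suc i) vs) =
        local_form M v k \<omega> (P x + t *\<^sub>R map P vs ! i) (take i (map P vs) @ drop (Suc i) (map P vs))"
    proof (rule eventually_mono)
      fix t assume "x + t *\<^sub>R vs ! i \<in> chart_map U ` chart_dom U"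
      moreover have "i < length vs"
        using vs i by (simp add: tuples_def)
      ultimately show "local_form N U k (pullback M f \<omega>) (x + t *\<^sub>R vs ! i)
          (take i vs @ drop (Suc i) vs) =
        local_form M v k \<omega> (P x + t *\<^sub>R map P vs ! i) (take i (map P vs) @ drop (Suc i) (map P vs))"
        using local_form_pullback[OF U vP(1,2)] tuples_delete[OF vs i]
        by (simp add: alt_form_pullback_def linear_add[OF vP(3)] linear_cmul[OF vP(3)] take_map drop_map)
    qed
  qed
  then show "local_form N U (Suc k) (pullback M f \<zeta>) x vs =
      (\<Sum>i\<le>k. (-1) ^ i * deriv (\<lambda>t. local_form N U k (pullback M f \<omega>) (x + t *\<^sub>R vs ! i)
        (take i vs @ drop (Suc i) vs)) 0)"
    using \<omega>[unfolded has_ext_derivative_def, rule_format, OF vP(1) chart_projection_image[OF vP(2) x] vs']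
      vs local_form_pullback[OF U vP(1,2) x]
    by (simp add: alt_form_pullback_def)
qed

end

section \<open>Products with a one-dimensional manifold\<close>

lemma tangent_map_tangent_zero:
  assumes "is_manifold N" "is_manifold M" "linear_in_charts N M f" "p \<in> points N"
  shows "tangent_map M f (tangent_zero N p) = tangent_zero M (f p)"
proof -
  have "(\<lambda>_. p) \<in> tangent_zero N p"
    unfolding tangent_zero_def
    using tangent_rel_refl[OF manifold_curve_const[OF assms(1,4)]] by simp
  from tangent_map_eq[OF assms(1-3) tangent_zero_mem[OF assms(1,4)] this] show ?thesis
    by (simp add: tangent_zero_def o_def)
qed

lemma tangent_lincombI:
  assumes "X \<in> tangent_space M p" "Y \<in> tangent_space M p" "Z \<in> tangent_space M p"
    and "\<And>u. u \<in> charts_at M p \<Longrightarrow>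
      chart_velocity u X = a *\<^sub>R chart_velocity u Y + b *\<^sub>R chart_velocity u Z"
  shows "tangent_lincomb M p X a Y b Z"
  using assms by (simp add: tangent_lincomb_def)

lemma tangent_lincombD:
  assumes "tangent_lincomb M p X a Y b Z"
  shows "X \<in> tangent_space M p" "Y \<in> tangent_space M p" "Z \<in> tangent_space M p"
    and "u \<in> charts_at M p \<Longrightarrow>
      chart_velocity u X = a *\<^sub>R chart_velocity u Y + b *\<^sub>R chart_velocity u Z"
  using assms by (simp_all add: tangent_lincomb_def)

text \<open>\<open>form_at\<close> expresses linearity only through \<open>tangent_lincomb\<close>;
  this instance yields that a form vanishes as soon as one argument is the zero vector.\<close>

lemma tangent_lincomb_zero:
  assumes "is_manifold M" "p \<in> points M"
  shows "tangent_lincomb M p (tangent_zero M p) 0 (tangent_zero M p) 0 (tangent_zero M p)"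
  using tangent_zero_mem[OF assms] chart_velocity_tangent_zero[OF assms]
  by (intro tangent_lincombI) auto

lemma tangent_lincomb_add_zero:
  assumes "is_manifold M" "X \<in> tangent_space M p"
  shows "tangent_lincomb M p X 1 X 1 (tangent_zero M p)"
  using assms(2) tangent_zero_mem[OF assms(1) tangent_space_points[OF assms]]
    chart_velocity_tangent_zero[OF assms(1) tangent_space_points[OF assms]]
  by (intro tangent_lincombI) auto

section \<open>The tangent spaces of a product\<close>

context
  fixes L :: "('l, 'd::real_vector) manifold" and M :: "('m, 'e::real_vector) manifold"
  assumes L: "is_manifold L" and M: "is_manifold M"
begin

lemma chart_velocity_prod_chart:
  assumes X: "X \<in> tangent_space (prod_manifold L M) (p, q)"
    and u: "u \<in> charts_at L p" and v: "v \<in> charts_at M q"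
  shows "chart_velocity (prod_chart u v) X =
    (chart_velocity u (tangent_map L fst X), chart_velocity v (tangent_map M snd X))"
proof -
  have U: "prod_chart u v \<in> charts_at (prod_manifold L M) (p, q)"
    using u v unfolding charts_at_prod_manifold by blast
  note N = is_manifold_prod[OF L M]
  have "chart_velocity u (tangent_map L fst X) = fst (chart_velocity (prod_chart u v) X)"
    by (rule chart_velocity_tangent_map[OF N L linear_in_charts_fst[OF M] X U])
      (simp_all add: u chart_projection_fst)
  moreover have "chart_velocity v (tangent_map M snd X) = snd (chart_velocity (prod_chart u v) X)"
    by (rule chart_velocity_tangent_map[OF N M linear_in_charts_snd[OF L] X U])
      (simp_all add: v chart_projection_snd)
  ultimately show ?thesis
    by simp
qed

text \<open>Two representing curves are paired; the projections of the pair are these curves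
  themselves.\<close>

lemma prod_tangent_exists:
  assumes X: "X \<in> tangent_space L p" and Y: "Y \<in> tangent_space M q"
  obtains Z where "Z \<in> tangent_space (prod_manifold L M) (p, q)"
    "tangent_map L fst Z = X" "tangent_map M snd Z = Y"
proof -
  obtain c where c: "manifold_curve L c" "c 0 = p" "X = tangent_rel L `` {c}"
    by (rule tangent_space_obtain[OF L X])
  obtain d where d: "manifold_curve M d" "d 0 = q" "Y = tangent_rel M `` {d}"
    by (rule tangent_space_obtain[OF M Y])
  define e where "e t = (c t, d t)" for t
  have proj: "fst \<circ> e = c" "snd \<circ> e = d"
    by (simp_all add: e_def o_def)
  have "manifold_curve (prod_manifold L M) e"
    unfolding manifold_curve_def
  proof (intro conjI ballI)
    show "range e \<subseteq> points (prod_manifold L M)"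
      using c(1) d(1) by (auto simp: manifold_curve_def e_def)
    fix U assume "U \<in> atlas (prod_manifold L M)"
    then obtain u v where U: "U = prod_chart u v" "u \<in> atlas L" "v \<in> atlas M"
      by (auto simp: prod_manifold_def)
    have vimage: "e -` chart_dom U = c -` chart_dom u \<inter> d -` chart_dom v"
      by (auto simp: U(1) e_def)
    show "open (e -` chart_dom U)"
      unfolding vimage
      using manifold_curve_open_vimage[OF c(1) U(2)] manifold_curve_open_vimage[OF d(1) U(3)] by blast
    have "fst \<circ> (chart_map U \<circ> e) = chart_map u \<circ> c" "snd \<circ> (chart_map U \<circ> e) = chart_map v \<circ> d"
      by (simp_all add: U(1) e_def o_def)
    then show "smooth_curve_on (e -` chart_dom U) (chart_model U) (chart_map U \<circ> e)"
      unfolding vimage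
      using smooth_curve_on_subset[OF manifold_curve_smooth_curve_on[OF c(1) U(2)]]
        smooth_curve_on_subset[OF manifold_curve_smooth_curve_on[OF d(1) U(3)]]
      by (simp add: U(1) smooth_curve_on_prod_iff)
  qed
  note Z = tangent_spaceI[OF is_manifold_prod[OF L M] this] and e = tangent_rel_refl[OF this]
  have e: "e \<in> tangent_rel (prod_manifold L M) `` {e}" "e 0 = (p, q)"
    using e c(2) d(2) by (auto simp: e_def)
  show ?thesis
  proof
    show "tangent_rel (prod_manifold L M) `` {e} \<in> tangent_space (prod_manifold L M) (p, q)"
      using Z e(2) by simp
    show "tangent_map L fst (tangent_rel (prod_manifold L M) `` {e}) = X"
      unfolding tangent_map_eq[OF is_manifold_prod[OF L M] L linear_in_charts_fst[OF M] Z e(1)]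
      by (simp add: proj c(3))
    show "tangent_map M snd (tangent_rel (prod_manifold L M) `` {e}) = Y"
      unfolding tangent_map_eq[OF is_manifold_prod[OF L M] M linear_in_charts_snd[OF L] Z e(1)]
      by (simp add: proj d(3))
  qed
qed

lemma prod_tangent_eqI:
  assumes X: "X \<in> tangent_space (prod_manifold L M) (p, q)"
    and Y: "Y \<in> tangent_space (prod_manifold L M) (p, q)"
    and "tangent_map L fst X = tangent_map L fst Y" "tangent_map M snd X = tangent_map M snd Y"
  shows "X = Y"
  by (rule tangent_space_eqI[OF is_manifold_prod[OF L M] X Y])
    (auto simp: charts_at_prod_manifold chart_velocity_prod_chart[OF X] chart_velocity_prod_chart[OF Y]
      assms(3,4))

lemma prod_tangent_lincombI:
  assumes X: "X \<in> tangent_space (prod_manifold L M) (p, q)"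
    and Y: "Y \<in> tangent_space (prod_manifold L M) (p, q)"
    and Z: "Z \<in> tangent_space (prod_manifold L M) (p, q)"
    and "tangent_lincomb L p (tangent_map L fst X) a (tangent_map L fst Y) b (tangent_map L fst Z)"
    and "tangent_lincomb M q (tangent_map M snd X) a (tangent_map M snd Y) b (tangent_map M snd Z)"
  shows "tangent_lincomb (prod_manifold L M) (p, q) X a Y b Z"
  by (rule tangent_lincombI[OF X Y Z])
    (auto simp: charts_at_prod_manifold chart_velocity_prod_chart[OF X] chart_velocity_prod_chart[OF Y]
      chart_velocity_prod_chart[OF Z] tangent_lincombD(4)[OF assms(4)] tangent_lincombD(4)[OF assms(5)])

end

text \<open>The local expression of dz in every chart: the identity of the real line, written as an
  alternating 1-form on lists.\<close>

definition first_entry :: "real list \<Rightarrow> real" where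
  "first_entry vs = (if vs \<in> tuples 1 UNIV then vs ! 0 else 0)"

lemma first_entry_mem: "first_entry \<in> alt_forms 1 euclideanreal"
proof -
  have "continuous_map (product_topology (\<lambda>_. euclideanreal) {..<1::nat}) euclideanreal
      (\<lambda>f. first_entry (map f [0..<1]))"
    using continuous_map_product_projection[of 0 "{..<1::nat}" "\<lambda>_. euclideanreal"]
    by (simp add: first_entry_def tuples_def)
  then show ?thesis
    by (auto simp: alt_forms_def first_entry_def tuples_def length_Suc_conv)
qed

text \<open>What the line and the circle share. The last assumption expresses in terms of velocities
  that changes of coordinates have derivative \<open>1\<close>; it gives the definite description in
  \<open>coord_form\<close> its meaning.\<close>

locale coordinate_line =
  fixes L :: "('l, real) manifold"
  assumes manifold: "is_manifold L"
    and chart_model_real: "u \<in> atlas L \<Longrightarrow> chart_model u = euclideanreal"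
    and chart_velocity_indep: "X \<in> tangent_space L p \<Longrightarrow> u \<in> charts_at L p \<Longrightarrow> v \<in> charts_at L p \<Longrightarrow>
      chart_velocity u X = chart_velocity v X"
begin

lemma coord_form_eq:
  assumes "X \<in> tangent_space L p" "u \<in> charts_at L p"
  shows "coord_form L p [X] = chart_velocity u X"
  unfolding coord_form_def nth_Cons_0
proof (rule the_equality)
  show "\<forall>z\<in>charts_at L p. chart_velocity z X = chart_velocity u X"
    by (intro ballI chart_velocity_indep[OF assms(1)] assms(2))
  show "r = chart_velocity u X" if "\<forall>z\<in>charts_at L p. chart_velocity z X = r" for r
    using that assms(2) by simp
qed

lemma charts_at_obtain:
  assumes "p \<in> points L"
  obtains u where "u \<in> charts_at L p" "chart_model u = euclideanreal"
  using charts_at_nonempty[OF manifold assms] chart_model_real by (auto simp: charts_at_def)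

text \<open>The velocities of a vector in all charts equal its value under dz, so this one number
  determines the vector.\<close>

lemma coord_form_eq_iff:
  assumes X: "X \<in> tangent_space L p" and Y: "Y \<in> tangent_space L p"
  shows "coord_form L p [X] = coord_form L p [Y] \<longleftrightarrow> X = Y"
proof
  assume "coord_form L p [X] = coord_form L p [Y]"
  then show "X = Y"
    by (intro tangent_space_eqI[OF manifold X Y]) (simp flip: coord_form_eq[OF X] coord_form_eq[OF Y])
qed simp

lemma coord_form_lincomb_iff:
  assumes X: "X \<in> tangent_space L p" and Y: "Y \<in> tangent_space L p" and Z: "Z \<in> tangent_space L p"
  shows "tangent_lincomb L p X a Y b Z \<longleftrightarrow>
    coord_form L p [X] = a * coord_form L p [Y] + b * coord_form L p [Z]"
proof -
  obtain u where "u \<in> charts_at L p"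
    using charts_at_obtain[OF tangent_space_points[OF manifold X]] by blast
  then show ?thesis
    using X Y Z coord_form_eq[OF X, symmetric] coord_form_eq[OF Y, symmetric] coord_form_eq[OF Z, symmetric]
    by (auto simp: tangent_lincomb_def)
qed

lemma coord_form_surj:
  assumes "p \<in> points L"
  obtains X where "X \<in> tangent_space L p" "coord_form L p [X] = r"
proof -
  obtain u where u: "u \<in> charts_at L p" "chart_model u = euclideanreal"
    by (rule charts_at_obtain[OF assms])
  show ?thesis
    using that[OF chart_tangent_mem[OF manifold u(1), of r]]
      coord_form_eq[OF chart_tangent_mem[OF manifold u(1), of r] u(1)]
      chart_velocity_chart_tangent[OF manifold u(1), of r] u(2) by simp
qed

lemma coord_form_tangent_zero: "p \<in> points L \<Longrightarrow> coord_form L p [tangent_zero L p] = 0"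
  using coord_form_lincomb_iff[of "tangent_zero L p" p "tangent_zero L p" "tangent_zero L p" 0 0]
    tangent_lincomb_zero[OF manifold] tangent_zero_mem[OF manifold] by simp

lemma chart_form_coord_form:
  assumes "u \<in> charts_at L p"
  shows "chart_form L u 1 p (coord_form L p) = first_entry"
proof
  fix vs
  have m: "chart_model u = euclideanreal"
    using assms chart_model_real by (simp add: charts_at_def)
  show "chart_form L u 1 p (coord_form L p) vs = first_entry vs"
  proof (cases "vs \<in> tuples 1 UNIV")
    case True
    then obtain r where vs: "vs = [r]"
      by (auto simp: tuples_Suc_0)
    have r: "r \<in> topspace (chart_model u)"
      by (simp add: m)
    have "coord_form L p [chart_tangent L u p r] = r"
      using coord_form_eq[OF chart_tangent_mem[OF manifold assms r] assms]
        chart_velocity_chart_tangent[OF manifold assms r] by simp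
    then show ?thesis
      using True by (simp add: chart_form_def first_entry_def m vs)
  qed (simp add: chart_form_def first_entry_def m)
qed

lemma local_form_coord_form:
  assumes u: "u \<in> atlas L" and x: "x \<in> chart_map u ` chart_dom u"
  shows "local_form L u 1 (coord_form L) x = first_entry"
proof -
  have "u \<in> charts_at L (chart_inv u x)"
    using x u chart_on_inv[OF is_manifold_chart_on[OF manifold u]] by (auto simp: charts_at_def)
  then show ?thesis
    unfolding local_form_def by (rule chart_form_coord_form)
qed

lemma coord_form_Forms: "coord_form L \<in> Forms L 1"
  unfolding Forms_def
proof (intro CollectI conjI ballI)
  fix p assume "p \<in> points L"
  show "form_at L 1 p (coord_form L p)"
    unfolding form_at_def
  proof (intro conjI ballI allI impI)
    fix Xs i X a Y b Z
    assume "Xs \<in> tuples 1 (tangent_space L p)" "i < (1::nat)" and lin: "tangent_lincomb L p X a Y b Z"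
    then obtain W where "Xs = [W]" "i = 0"
      by (auto simp: tuples_Suc_0)
    then show "coord_form L p (Xs[i := X]) =
        a * coord_form L p (Xs[i := Y]) + b * coord_form L p (Xs[i := Z])"
      using lin coord_form_lincomb_iff[OF tangent_lincombD(1-3)[OF lin]] by simp
  next
    fix Xs assume "Xs \<in> tuples 1 (tangent_space L p)" "\<not> distinct Xs"
    then show "coord_form L p Xs = 0"
      by (auto simp: tuples_Suc_0)
  next
    fix u assume u: "u \<in> charts_at L p"
    then show "chart_form L u 1 p (coord_form L p) \<in> alt_forms 1 (chart_model u)"
      unfolding chart_form_coord_form[OF u]
      using first_entry_mem chart_model_real by (simp add: charts_at_def)
  qed
next
  fix u assume u: "u \<in> atlas L"
  have const: "smooth_curve_on UNIV (alt_forms_topology 1 euclideanreal) (\<lambda>_. first_entry)"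
    unfolding smooth_curve_on_def topspace_alt_forms_topology has_curve_derivative_def
    using first_entry_mem
    by (intro exI[of _ "\<lambda>n _. if n = 0 then first_entry else 0"])
      (auto simp: zero_in_alt_forms topspace_alt_forms_topology)
  show "smooth_map_on (chart_map u ` chart_dom u) (chart_model u)
      (alt_forms_topology 1 (chart_model u)) (local_form L u 1 (coord_form L))"
    unfolding smooth_map_on_def
  proof (intro allI impI, elim conjE)
    fix c :: "real \<Rightarrow> real" assume "range c \<subseteq> chart_map u ` chart_dom u"
    then have "c t \<in> chart_map u ` chart_dom u" for t
      by blast
    then have "local_form L u 1 (coord_form L) \<circ> c = (\<lambda>_. first_entry)"
      using local_form_coord_form[OF u] by (simp add: o_def)
    then show "smooth_curve_on UNIV (alt_forms_topology 1 (chart_model u)) (local_form L u 1 (coord_form L) \<circ> c)"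
      using const chart_model_real[OF u] by simp
  qed
qed

theorem contact_manifold_contactization:
  fixes M :: "('m, 'e::real_vector) manifold"
  assumes \<theta>: "\<theta> \<in> Forms M 1" and d\<theta>: "has_ext_derivative M 1 \<theta> \<omega>"
    and sympl: "weakly_symplectic M \<omega>"
  shows "contact_manifold (prod_manifold L M) (contactization_form L M \<theta>)"
proof -
  note L = manifold
  have M: "is_manifold M" and \<omega>: "\<omega> \<in> Forms M 2"
    using sympl by (simp_all add: weakly_symplectic_def)
  define N where "N = prod_manifold L M"
  define \<eta> where "\<eta> = contactization_form L M \<theta>"
  define \<zeta> :: "('l \<times> 'm) form" where "\<zeta> = pullback M snd \<omega>"
  have N: "is_manifold N" and fstN: "linear_in_charts N L fst" and sndN: "linear_in_charts N M snd"
    unfolding N_def by (rule is_manifold_prod[OF L M] linear_in_charts_fst[OF M] linear_in_charts_snd[OF L])+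
  have \<eta>_Forms: "\<eta> \<in> Forms N 1"
    unfolding \<eta>_def contactization_form_def
    by (rule Forms_add[OF Forms_pullback[OF N L fstN coord_form_Forms] Forms_pullback[OF N M sndN \<theta>]])
  have \<zeta>_Forms: "\<zeta> \<in> Forms N 2"
    unfolding \<zeta>_def by (rule Forms_pullback[OF N M sndN \<omega>])
  have ext: "has_ext_derivative N 1 \<eta> \<zeta>"
    unfolding \<eta>_def \<zeta>_def contactization_form_def
  proof (rule has_ext_derivative_add_const[OF N has_ext_derivative_pullback[OF N M sndN d\<theta>]])
    fix U assume U: "U \<in> atlas N"
    then obtain u P where u: "u \<in> atlas L" "chart_projection fst P U u"
      using fstN unfolding linear_in_charts_def by blast
    show "\<exists>\<kappa>. \<forall>x\<in>chart_map U ` chart_dom U. local_form N U 1 (pullback L fst (coord_form L)) x = \<kappa>"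
      using local_form_pullback[OF N L fstN U u] local_form_coord_form[OF u(1) chart_projection_image[OF u(2)]]
      by (intro exI[of _ "alt_form_pullback 1 (chart_model U) P first_entry"]) simp
  qed
  have pointwise: "vertical N \<zeta> P - {tangent_zero N P} \<noteq> {} \<and> splits_tangent N \<eta> \<zeta> P \<and>
      nondegenerate_on_horizontal N \<eta> \<zeta> P \<and> flat_injective N \<eta> \<zeta> P"
    if P: "P \<in> points N" for P
  proof -
    obtain p q where pq: "P = (p, q)" "p \<in> points L" "q \<in> points M"
      using P by (auto simp: N_def)
    define T where "T = tangent_space N P"
    define T2 where "T2 = tangent_space M q"
    define z where "z X = coord_form L p [tangent_map L fst X]" for X :: "('l \<times> 'm) tangent"
    define \<pi> where "\<pi> X = tangent_map M snd X" for X :: "('l \<times> 'm) tangent"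
    define O2 where "O2 = tangent_zero M q"
    define ON where "ON = tangent_zero N P"
    have \<eta>: "\<eta> P [X] = z X + \<theta> q [\<pi> X]" for X
      by (simp add: \<eta>_def contactization_form_def pullback_def z_def \<pi>_def pq)
    have \<zeta>: "\<zeta> P [X, Y] = \<omega> q [\<pi> X, \<pi> Y]" for X Y
      by (simp add: \<zeta>_def pullback_def \<pi>_def pq)
    have \<pi>_mem: "\<pi> X \<in> T2" if "X \<in> T" for X
      using tangent_map_mem(1)[OF N M sndN that[unfolded T_def]] by (simp add: \<pi>_def T2_def pq)
    have fst_mem: "tangent_map L fst X \<in> tangent_space L p" if "X \<in> T" for X
      using tangent_map_mem(1)[OF N L fstN that[unfolded T_def]] by (simp add: pq)
    \<comment> \<open>With \<open>\<pi>_mem\<close>, the facts \<open>eqI\<close> and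
      \<open>lift\<close> make X \<mapsto> (z X, \<pi> X) a bijection from \<open>T\<close> onto the
      pairs of a real number and an element of \<open>T2\<close>; \<open>lincombI\<close>,
      \<open>lincomb_\<pi>\<close> and \<open>lincomb_z\<close> say that linear combinations
      correspond.\<close>
    have eqI: "X = Y" if "X \<in> T" "Y \<in> T" "z X = z Y" "\<pi> X = \<pi> Y" for X Y
      using that coord_form_eq_iff[OF fst_mem fst_mem, of X Y]
      by (intro prod_tangent_eqI[OF L M, of X p q Y]) (auto simp: T_def z_def \<pi>_def N_def pq)
    have lincombI: "tangent_lincomb N P X a Y b Z"
      if "X \<in> T" "Y \<in> T" "Z \<in> T" "z X = a * z Y + b * z Z" "tangent_lincomb M q (\<pi> X) a (\<pi> Y) b (\<pi> Z)"
      for X a Y b Z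
      using that coord_form_lincomb_iff[OF fst_mem fst_mem fst_mem, of X Y Z a b]
      by (auto simp: T_def z_def \<pi>_def N_def pq intro!: prod_tangent_lincombI[OF L M])
    have lincomb_\<pi>: "tangent_lincomb M q (\<pi> X) a (\<pi> Y) b (\<pi> Z)"
      if "tangent_lincomb N P X a Y b Z" for X a Y b Z
      using tangent_lincomb_tangent_map[OF N M sndN that] by (simp add: \<pi>_def pq)
    have lincomb_z: "z X = a * z Y + b * z Z" if "tangent_lincomb N P X a Y b Z" for X a Y b Z
      using tangent_lincomb_tangent_map[OF N L fstN that] coord_form_lincomb_iff[OF fst_mem fst_mem fst_mem]
        tangent_lincombD(1-3)[OF that] by (simp add: z_def pq T_def)
    have lift: "\<exists>X \<in> T. z X = r \<and> \<pi> X = Y" if Y: "Y \<in> T2" for r Y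
    proof -
      obtain X where X: "X \<in> tangent_space L p" "coord_form L p [X] = r"
        by (rule coord_form_surj[OF pq(2)])
      obtain Z where "Z \<in> tangent_space N (p, q)" "tangent_map L fst Z = X" "tangent_map M snd Z = Y"
        unfolding N_def by (rule prod_tangent_exists[OF L M X(1) Y[unfolded T2_def]])
      then show ?thesis
        using X(2) by (auto simp: T_def z_def \<pi>_def pq)
    qed
    have O2: "O2 \<in> T2" and ON: "ON \<in> T" and \<pi>_ON: "\<pi> ON = O2" and z_ON: "z ON = 0"
      using tangent_zero_mem[OF M pq(3)] tangent_zero_mem[OF N P] coord_form_tangent_zero[OF pq(2)]
        tangent_map_tangent_zero[OF N M sndN P] tangent_map_tangent_zero[OF N L fstN P]
      by (simp_all add: O2_def ON_def T_def T2_def \<pi>_def z_def pq)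
    have form\<omega>: "form_at M 2 q (\<omega> q)" and form\<theta>: "form_at M 1 q (\<theta> q)" and form\<eta>: "form_at N 1 P (\<eta> P)"
      using \<omega> \<theta> \<eta>_Forms pq P by (auto simp: Forms_def)
    \<comment> \<open>The entry of \<open>[W, W]\<close> at position \<open>0\<close> is overwritten
      by each of the three vectors, while the other \<open>W\<close> stays as second
      argument.\<close>
    have \<omega>_lin1: "\<omega> q [X, W] = a * \<omega> q [Y, W] + b * \<omega> q [Z, W]"
      if "tangent_lincomb M q X a Y b Z" "W \<in> T2" for X a Y b Z W
      using form_atD(1)[OF form\<omega> _ _ that(1), of "[W, W]" 0] that(2) by (simp add: tuples_def T2_def)
    have \<omega>_lin2: "\<omega> q [W, X] = a * \<omega> q [W, Y] + b * \<omega> q [W, Z]"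
      if "tangent_lincomb M q X a Y b Z" "W \<in> T2" for X a Y b Z W
      using form_atD(1)[OF form\<omega> _ _ that(1), of "[W, W]" 1] that(2) by (simp add: tuples_def T2_def)
    have \<theta>_lin: "\<theta> q [X] = a * \<theta> q [Y] + b * \<theta> q [Z]" if "tangent_lincomb M q X a Y b Z" for X a Y b Z
      using form_atD(1)[OF form\<theta> _ _ that, of "[O2]" 0] O2 by (simp add: tuples_def T2_def)
    note zero = tangent_lincomb_zero[OF M pq(3), folded O2_def]
    have \<omega>_O1: "\<omega> q [O2, W] = 0" and \<omega>_O2: "\<omega> q [W, O2] = 0" if "W \<in> T2" for W
      using \<omega>_lin1[OF zero that] \<omega>_lin2[OF zero that] by simp_all
    have \<theta>_O: "\<theta> q [O2] = 0"
      using \<theta>_lin[OF zero] by simp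
    have \<omega>_inj: "X = Y" if "X \<in> T2" "Y \<in> T2" "\<And>W. W \<in> T2 \<Longrightarrow> \<omega> q [X, W] = \<omega> q [Y, W]" for X Y
      using sympl that pq(3) unfolding weakly_symplectic_def T2_def by blast
    have vertical_iff: "X \<in> vertical N \<zeta> P \<longleftrightarrow> X \<in> T \<and> \<pi> X = O2" for X
    proof
      assume X: "X \<in> vertical N \<zeta> P"
      then have "X \<in> T"
        by (simp add: vertical_def T_def)
      moreover have "\<omega> q [\<pi> X, W] = \<omega> q [O2, W]" if W: "W \<in> T2" for W
      proof -
        obtain Y where "Y \<in> T" "\<pi> Y = W"
          using lift[OF W] by blast
        then show ?thesis
          using X \<omega>_O1[OF W] by (auto simp: vertical_def T_def \<zeta>)
      qed
      ultimately show "X \<in> T \<and> \<pi> X = O2"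
        using \<omega>_inj \<pi>_mem O2 by blast
    qed (auto simp: vertical_def \<zeta> \<omega>_O1 \<pi>_mem simp flip: T_def)
    have horizontal_iff: "X \<in> horizontal N \<eta> P \<longleftrightarrow> X \<in> T \<and> z X = - \<theta> q [\<pi> X]" for X
      by (auto simp: horizontal_def \<eta> T_def)
    \<comment> \<open>A vector along the line or circle only: vertical and non-zero, it shows that
      the kernel is non-trivial, and it is the test vector for \<open>flat\<close> below.\<close>
    obtain V where V: "V \<in> T" "z V = 1" "\<pi> V = O2"
      using lift[OF O2] by blast
    have "V \<noteq> ON"
      using V z_ON by auto
    then have kernel: "vertical N \<zeta> P - {tangent_zero N P} \<noteq> {}"
      using V vertical_iff by (auto simp: ON_def)
    have splits: "splits_tangent N \<eta> \<zeta> P"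
      unfolding splits_tangent_def
    proof
      fix X assume "X \<in> tangent_space N P"
      then have X: "X \<in> T"
        by (simp add: T_def)
      \<comment> \<open>The values are forced: a horizontal \<open>Y\<close> with the same component
        in \<open>T2\<close> as \<open>X\<close> must have z Y = -\<theta>(\<pi> X), and the
        vertical \<open>Z\<close> takes up the difference z X - z Y = \<eta>(X).\<close>
      obtain Y where Y: "Y \<in> T" "z Y = - \<theta> q [\<pi> X]" "\<pi> Y = \<pi> X"
        using lift[OF \<pi>_mem[OF X]] by blast
      obtain Z where Z: "Z \<in> T" "z Z = z X + \<theta> q [\<pi> X]" "\<pi> Z = O2"
        using lift[OF O2] by blast
      show "\<exists>!(Y, Z). Y \<in> horizontal N \<eta> P \<and> Z \<in> vertical N \<zeta> P \<and> tangent_lincomb N P X 1 Y 1 Z"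
      proof (rule ex1I[of _ "(Y, Z)"], unfold prod.case)
        have "tangent_lincomb M q (\<pi> X) 1 (\<pi> Y) 1 (\<pi> Z)"
          using tangent_lincomb_add_zero[OF M \<pi>_mem[OF X, unfolded T2_def]] by (simp add: Y Z O2_def)
        then have "tangent_lincomb N P X 1 Y 1 Z"
          using X Y Z by (intro lincombI) auto
        then show "Y \<in> horizontal N \<eta> P \<and> Z \<in> vertical N \<zeta> P \<and> tangent_lincomb N P X 1 Y 1 Z"
          by (simp add: horizontal_iff vertical_iff Y Z)
      next
        fix YZ
        assume *: "case YZ of (Y, Z) \<Rightarrow>
          Y \<in> horizontal N \<eta> P \<and> Z \<in> vertical N \<zeta> P \<and> tangent_lincomb N P X 1 Y 1 Z"
        obtain Y' Z' where YZ: "YZ = (Y', Z')"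
          by (cases YZ)
        have Y': "Y' \<in> T" "z Y' = - \<theta> q [\<pi> Y']" and Z': "Z' \<in> T" "\<pi> Z' = O2"
          and lin: "tangent_lincomb N P X 1 Y' 1 Z'"
          using * by (simp_all add: YZ horizontal_iff vertical_iff)
        \<comment> \<open>The vertical summand has zero component in \<open>T2\<close>. As tangent
          spaces carry no addition, the conclusion is read off the velocities.\<close>
        have "\<pi> X = \<pi> Y'"
        proof (rule tangent_space_eqI[OF M])
          show "\<pi> X \<in> tangent_space M q" "\<pi> Y' \<in> tangent_space M q"
            using \<pi>_mem X Y'(1) by (auto simp: T2_def)
          show "chart_velocity v (\<pi> X) = chart_velocity v (\<pi> Y')" if "v \<in> charts_at M q" for v
            using tangent_lincombD(4)[OF lincomb_\<pi>[OF lin] that] chart_velocity_tangent_zero[OF M pq(3) that]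
            by (simp add: Z'(2) O2_def)
        qed
        then have "Y' = Y"
          using Y Y' by (intro eqI) simp_all
        moreover have "Z' = Z"
          using \<open>\<pi> X = \<pi> Y'\<close> lincomb_z[OF lin] Z Y' Z' by (intro eqI) simp_all
        ultimately show "YZ = (Y, Z)"
          by (simp add: YZ)
      qed
    qed
    have nondeg: "nondegenerate_on_horizontal N \<eta> \<zeta> P"
      unfolding nondegenerate_on_horizontal_def
    proof (intro ballI impI)
      fix X assume "X \<in> horizontal N \<eta> P" and orth: "\<forall>Y\<in>horizontal N \<eta> P. \<zeta> P [X, Y] = 0"
      then have X: "X \<in> T" "z X = - \<theta> q [\<pi> X]"
        by (simp_all add: horizontal_iff)
      \<comment> \<open>Every \<open>W\<close> is the component of a horizontal vector, the one with
        z-value -\<theta>(W), so testing on horizontal vectors tests \<omega> on all of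
        \<open>T2\<close>.\<close>
      have "\<omega> q [\<pi> X, W] = \<omega> q [O2, W]" if W: "W \<in> T2" for W
      proof -
        obtain Y where "Y \<in> T" "z Y = - \<theta> q [W]" "\<pi> Y = W"
          using lift[OF W] by blast
        then show ?thesis
          using orth \<omega>_O1[OF W] by (auto simp: horizontal_iff \<zeta>)
      qed
      then have "\<pi> X = O2"
        using \<omega>_inj[OF \<pi>_mem[OF X(1)] O2] by blast
      then have "X = ON"
        using X \<theta>_O by (intro eqI) (auto simp: ON z_ON \<pi>_ON)
      then show "X = tangent_zero N P"
        by (simp add: ON_def)
    qed
    have flat: "flat \<eta> \<zeta> P X [W] = \<omega> q [\<pi> X, \<pi> W] + \<eta> P [X] * \<eta> P [W]" for X W
      by (simp add: flat_def \<zeta>)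
    have "flat_injective N \<eta> \<zeta> P"
      unfolding flat_injective_def
    proof (intro conjI ballI allI impI)
      fix X assume X: "X \<in> tangent_space N P"
      \<comment> \<open>The contraction of the pulled back \<omega> with \<open>X\<close> is the
        pullback of the contraction of \<omega> with \<open>\<pi> X\<close>, a continuous form since
        \<omega> is weakly symplectic; to it the multiple \<eta>(X) of \<eta> is added.\<close>
      then have "form_at M 1 (snd P) (\<lambda>Ys. \<omega> q (\<pi> X # Ys))"
        using sympl pq \<pi>_mem[of X] by (simp add: weakly_symplectic_def T_def T2_def)
      from form_at_add[OF form_at_tangent_map[OF N M sndN this] form_at_scaleR[OF form\<eta>, of "\<eta> P [X]"]]
      show "form_at N 1 P (flat \<eta> \<zeta> P X)"
        by (simp add: flat_def \<zeta>_def pullback_def \<pi>_def pq)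
    next
      fix X a Y b Z W assume lin: "tangent_lincomb N P X a Y b Z" and "W \<in> tangent_space N P"
      then have W: "\<pi> W \<in> T2"
        by (simp add: \<pi>_mem T_def)
      show "flat \<eta> \<zeta> P X [W] = a * flat \<eta> \<zeta> P Y [W] + b * flat \<eta> \<zeta> P Z [W]"
        unfolding flat \<omega>_lin1[OF lincomb_\<pi>[OF lin] W] \<eta>[of X] \<eta>[of Y] \<eta>[of Z]
          lincomb_z[OF lin] \<theta>_lin[OF lincomb_\<pi>[OF lin]]
        by (simp add: algebra_simps)
    next
      fix X Y assume "X \<in> tangent_space N P" "Y \<in> tangent_space N P"
        and eq: "\<forall>W\<in>tangent_space N P. flat \<eta> \<zeta> P X [W] = flat \<eta> \<zeta> P Y [W]"
      then have X: "X \<in> T" and Y: "Y \<in> T"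
        by (simp_all add: T_def)
      have eq: "\<omega> q [\<pi> X, \<pi> W] + \<eta> P [X] * \<eta> P [W] = \<omega> q [\<pi> Y, \<pi> W] + \<eta> P [Y] * \<eta> P [W]"
        if "W \<in> T" for W
        using eq that by (simp add: flat T_def)
      \<comment> \<open>Tested on \<open>V\<close>, the \<omega>-terms vanish since
        \<open>\<pi> V\<close> is the zero vector, and \<eta>(V) = 1 leaves \<eta>(X) and
        \<eta>(Y).\<close>
      have \<eta>_eq: "\<eta> P [X] = \<eta> P [Y]"
        using eq[OF V(1)] V \<omega>_O2[OF \<pi>_mem[OF X]] \<omega>_O2[OF \<pi>_mem[OF Y]] \<theta>_O \<eta>[of V] by simp
      have "\<omega> q [\<pi> X, W] = \<omega> q [\<pi> Y, W]" if W: "W \<in> T2" for W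
        using lift[OF W] eq \<eta>_eq by fastforce
      then have "\<pi> X = \<pi> Y"
        by (intro \<omega>_inj \<pi>_mem X Y)
      then show "X = Y"
        using \<eta>_eq by (intro eqI X Y) (simp_all add: \<eta>)
    qed
    then show ?thesis
      using kernel splits nondeg by blast
  qed
  show ?thesis
    using N \<eta>_Forms \<zeta>_Forms ext pointwise
    unfolding contact_manifold_def contact_form_def N_def[symmetric] \<eta>_def[symmetric] by blast
qed

end

section \<open>The line and the circle\<close>

lemma coordinate_line_real_line: "coordinate_line real_line"
proof
  let ?u = "\<lparr>chart_dom = UNIV, chart_map = (\<lambda>z. z), chart_model = euclideanreal\<rparr> :: (real, real) chart"
  have inv: "the_inv_into UNIV (\<lambda>z. z) x = x" for x :: real
    using the_inv_into_f_f[of "\<lambda>z::real. z" UNIV x] by simp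
  have open': "open A \<Longrightarrow> manifold_open real_line A" for A
    by (simp add: manifold_open_def real_line_def cinf_open_euclideanreal)
  have "chart_on UNIV ?u" "charts_compatible ?u ?u"
    by (simp_all add: chart_on_def charts_compatible_def convenient_space_euclideanreal
        cinf_open_euclideanreal smooth_map_on_def o_def inv)
  moreover have "\<exists>A B. manifold_open real_line A \<and> manifold_open real_line B \<and> x \<in> A \<and> y \<in> B \<and> A \<inter> B = {}"
    if "x \<noteq> y" for x y :: real
    using hausdorff[OF that] open' by blast
  ultimately show "is_manifold real_line"
    by (simp add: is_manifold_def real_line_def)
qed (auto simp: real_line_def charts_at_def)

section \<open>The angle charts of the circle\<close>

lemma cis_eq_iff: "cis x = cis y \<longleftrightarrow> (\<exists>n::int. x = y + 2 * pi * n)"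
  using sin_cos_eq_iff[of x y] by (auto simp: complex_eq_iff)

lemma inj_on_cis: "inj_on cis {a<..<a + 2 * pi}"
proof (rule inj_onI)
  fix x y assume xy: "x \<in> {a<..<a + 2 * pi}" "y \<in> {a<..<a + 2 * pi}" and "cis x = cis y"
  then obtain n :: int where n: "x = y + 2 * pi * n"
    by (auto simp: cis_eq_iff)
  have "2 * pi * n < 2 * pi * 1" "2 * pi * (- 1) < 2 * pi * n"
    using xy unfolding n greaterThanLessThan_iff by linarith+
  then have "real_of_int n < 1" "- 1 < real_of_int n"
    using mult_less_cancel_left_pos[of "2 * pi" "real_of_int n" 1]
      mult_less_cancel_left_pos[of "2 * pi" "- 1" "real_of_int n"] pi_gt_zero by linarith+
  then have "n = 0"
    by linarith
  then show "x = y"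
    using n by simp
qed

lemma angle_chart_simps [simp]:
  "chart_dom (angle_chart a) = cis ` {a<..<a + 2 * pi}"
  "chart_model (angle_chart a) = euclideanreal"
  by (simp_all add: angle_chart_def)

lemma angle_chart_cis: "x \<in> {a<..<a + 2 * pi} \<Longrightarrow> chart_map (angle_chart a) (cis x) = x"
  by (simp add: angle_chart_def the_inv_into_f_f[OF inj_on_cis])

lemma inj_on_angle_chart: "inj_on (chart_map (angle_chart a)) (chart_dom (angle_chart a))"
  by (auto simp: inj_on_def angle_chart_cis)

lemma angle_chart_inv: "x \<in> {a<..<a + 2 * pi} \<Longrightarrow> chart_inv (angle_chart a) x = cis x"
  using the_inv_into_f_f[OF inj_on_angle_chart, of "cis x" a] by (simp add: angle_chart_cis)

lemma angle_chart_image: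
  "chart_map (angle_chart a) ` (A \<inter> chart_dom (angle_chart a)) = {a<..<a + 2 * pi} \<inter> cis -` A"
proof -
  have "A \<inter> chart_dom (angle_chart a) = cis ` ({a<..<a + 2 * pi} \<inter> cis -` A)"
    by auto
  then show ?thesis
    by (simp only: image_image) (simp add: angle_chart_cis)
qed

lemma open_vimage_cis: "open A \<Longrightarrow> open (cis -` A)"
  by (rule open_vimage) (auto intro: continuous_on_cis continuous_on_id)

lemma angle_charts_shift:
  assumes "cis x \<in> chart_dom (angle_chart b)"
  obtains n :: int where "x + 2 * pi * n \<in> {b<..<b + 2 * pi}"
proof -
  obtain y where "y \<in> {b<..<b + 2 * pi}" "cis x = cis y"
    using assms by auto
  moreover then obtain n :: int where "x = y + 2 * pi * n"
    by (auto simp: cis_eq_iff)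
  ultimately show ?thesis
    using that[of "- n"] by simp
qed

lemma angle_chart_shift:
  "x + 2 * pi * of_int n \<in> {b<..<b + 2 * pi} \<Longrightarrow>
    cis x \<in> chart_dom (angle_chart b) \<and> chart_map (angle_chart b) (cis x) = x + 2 * pi * of_int n"
proof -
  assume *: "x + 2 * pi * of_int n \<in> {b<..<b + 2 * pi}"
  have "cis x = cis (x + 2 * pi * of_int n)"
    using cis_eq_iff[of "x + 2 * pi * of_int n" x] by auto
  then show ?thesis
    using angle_chart_cis[OF *] * by (metis angle_chart_simps(1) imageI)
qed

text \<open>The preimage is the union of the translates of the interval by multiples of
  \<open>2 * pi\<close>; each of its points lies in one of these open translates.\<close>

lemma open_vimage_cis_angle_chart: "open (cis -` chart_dom (angle_chart b))"
proof (subst open_subopen, rule ballI)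
  fix x assume "x \<in> cis -` chart_dom (angle_chart b)"
  then obtain n :: int where n: "x + 2 * pi * n \<in> {b<..<b + 2 * pi}"
    using angle_charts_shift by blast
  have "open ((\<lambda>y. y + 2 * pi * n) -` {b<..<b + 2 * pi})"
    by (intro open_vimage continuous_intros open_greaterThanLessThan)
  then show "\<exists>T. open T \<and> x \<in> T \<and> T \<subseteq> cis -` chart_dom (angle_chart b)"
    using n angle_chart_shift by (intro exI[of _ "(\<lambda>y. y + 2 * pi * n) -` {b<..<b + 2 * pi}"]) blast
qed

text \<open>The transition map is locally a translation by a multiple of \<open>2 * pi\<close>, but
  the multiple may differ between the arcs of the overlap. Hence smoothness is shown around each
  time, on the set \<open>J\<close> of times for which the same integer serves.\<close>

lemma charts_compatible_angle_chart: "charts_compatible (angle_chart a) (angle_chart b)"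
  unfolding charts_compatible_def
proof
  let ?I = "{a<..<a + 2 * pi}" and ?f = "chart_map (angle_chart b) \<circ> chart_inv (angle_chart a)"
  have img: "chart_map (angle_chart a) ` (chart_dom (angle_chart a) \<inter> chart_dom (angle_chart b)) =
      ?I \<inter> cis -` chart_dom (angle_chart b)"
    using angle_chart_image[of a "chart_dom (angle_chart b)"] by (simp only: Int_commute)
  show "cinf_open (chart_model (angle_chart a))
      (chart_map (angle_chart a) ` (chart_dom (angle_chart a) \<inter> chart_dom (angle_chart b)))"
    unfolding img using open_Int[OF open_greaterThanLessThan open_vimage_cis_angle_chart]
    by (simp add: cinf_open_euclideanreal)
  show "smooth_map_on (chart_map (angle_chart a) ` (chart_dom (angle_chart a) \<inter> chart_dom (angle_chart b)))
      (chart_model (angle_chart a)) (chart_model (angle_chart b)) ?f"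
    unfolding smooth_map_on_def img angle_chart_simps(2)
  proof (intro allI impI, elim conjE)
    fix c assume c: "smooth_curve_on UNIV euclideanreal c"
      "range c \<subseteq> ?I \<inter> cis -` chart_dom (angle_chart b)"
    show "smooth_curve_on UNIV euclideanreal (?f \<circ> c)"
    proof (rule smooth_curve_on_local)
      fix t
      have "cis (c t) \<in> chart_dom (angle_chart b)"
        using c(2) by blast
      then obtain n :: int where n: "c t + 2 * pi * n \<in> {b<..<b + 2 * pi}"
        by (rule angle_charts_shift)
      define J where "J = (\<lambda>s. c s + 2 * pi * n) -` {b<..<b + 2 * pi}"
      have "times_differentiable k euclideanreal (\<lambda>s. c s + 2 * pi * n)" for k
        by (rule times_differentiable_real_add[OF smooth_curve_times_differentiable[OF c(1)]
              times_differentiable_const])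
      then have smooth: "smooth_curve_on UNIV euclideanreal (\<lambda>s. c s + 2 * pi * n)"
        by (intro times_differentiable_smooth_curve) auto
      have "t \<in> J"
        using n by (simp add: J_def)
      have "open J"
        unfolding J_def
        by (intro continuous_open_vimage smooth_curve_on_real_isCont[OF smooth]) auto
      have eq: "c s + 2 * pi * n = (?f \<circ> c) s" if "s \<in> J" for s
      proof -
        have "c s \<in> ?I"
          using c(2) by blast
        then show ?thesis
          using angle_chart_shift[of "c s" n b] that by (simp add: J_def angle_chart_inv del: angle_chart_simps(1))
      qed
      show "\<exists>I c'. open I \<and> t \<in> I \<and> smooth_curve_on I euclideanreal c' \<and>
          (\<forall>s\<in>I. c' s = (?f \<circ> c) s)"
        by (intro exI[of _ J] exI[of _ "\<lambda>s. c s + 2 * pi * n"] conjI ballI eq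
            smooth_curve_on_subset[OF smooth] subset_UNIV) fact+
    qed auto
  qed
qed

lemma is_manifold_circle: "is_manifold circle"
proof -
  have openI: "manifold_open circle (sphere 0 1 \<inter> A)" if "open A" for A
  proof -
    have "sphere 0 1 \<inter> A \<inter> chart_dom (angle_chart a) = A \<inter> chart_dom (angle_chart a)" for a
      by auto
    then have "chart_map (angle_chart a) ` (sphere 0 1 \<inter> A \<inter> chart_dom (angle_chart a)) =
        {a<..<a + 2 * pi} \<inter> cis -` A" for a
      by (simp only: angle_chart_image)
    then show ?thesis
      using open_Int[OF open_greaterThanLessThan open_vimage_cis[OF that]]
      by (auto simp: manifold_open_def circle_def simp del: angle_chart_simps(1)
          intro!: cinf_open_euclideanreal)
  qed
  have "\<exists>A B. manifold_open circle A \<and> manifold_open circle B \<and> p \<in> A \<and> q \<in> B \<and> A \<inter> B = {}"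
    if pq: "p \<in> sphere 0 1" "q \<in> sphere 0 1" "p \<noteq> q" for p q
  proof -
    obtain A B where "open A" "open B" "p \<in> A" "q \<in> B" "A \<inter> B = {}"
      using hausdorff[OF pq(3)] by blast
    then show ?thesis
      using openI pq
      by (intro exI[of _ "sphere 0 1 \<inter> A"] exI[of _ "sphere 0 1 \<inter> B"]) auto
  qed
  moreover have "chart_on (sphere 0 1) (angle_chart a)" for a
    using inj_on_angle_chart[of a] angle_chart_image[of a UNIV]
    by (auto simp: chart_on_def convenient_space_euclideanreal intro!: cinf_open_euclideanreal)
  \<comment> \<open>Starting the branch at \<open>Arg p - pi\<close> puts the angle of
    \<open>p\<close> in the middle of the open interval, away from the excluded point.\<close>
  moreover have "p \<in> chart_dom (angle_chart (Arg p - pi))" if "p \<in> sphere 0 1" for p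
  proof -
    have "p = cis (Arg p)"
      using that rcis_cmod_Arg[of p] by (simp add: rcis_def)
    moreover have "Arg p \<in> {Arg p - pi<..<Arg p - pi + 2 * pi}"
      by simp
    ultimately show ?thesis
      unfolding angle_chart_simps(1) by (metis imageI)
  qed
  then have "sphere 0 1 \<subseteq> (\<Union>a. chart_dom (angle_chart a))"
    by blast
  then have "(\<Union>a. chart_dom (angle_chart a)) = sphere 0 1"
    by (intro antisym) auto
  ultimately show ?thesis
    unfolding is_manifold_def
    by (simp add: circle_def charts_compatible_angle_chart del: angle_chart_simps)
qed

text \<open>By continuity the angles of a curve in two charts differ by one fixed multiple of
  \<open>2 * pi\<close> near time \<open>0\<close>, so their derivatives there agree.\<close>

lemma coordinate_line_circle: "coordinate_line circle"
proof
  show M: "is_manifold circle"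
    by (rule is_manifold_circle)
  show "chart_model u = euclideanreal" if "u \<in> atlas circle" for u
    using that by (auto simp: circle_def)
  fix X p u v
  assume X: "X \<in> tangent_space circle p" and u: "u \<in> charts_at circle p" and v: "v \<in> charts_at circle p"
  obtain a b where ab: "u = angle_chart a" "v = angle_chart b"
    using u v by (auto simp: charts_at_def circle_def)
  obtain c where c: "c \<in> X" "manifold_curve circle c" "c 0 = p"
    using tangent_space_obtain[OF M X] by metis
  define x where "x = chart_map u \<circ> c"
  have dx: "(x has_real_derivative chart_velocity u X) (at 0)"
    using has_curve_derivative_chart_velocity[OF M X c(1) u]
    by (simp add: x_def ab has_curve_derivative_real_iff)
  have cis_x: "cis (x t) = c t" if "c t \<in> chart_dom u" for t
    using that by (auto simp: x_def ab angle_chart_cis)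
  have p: "cis (x 0) = p" "p \<in> chart_dom v"
    using cis_x[of 0] u v c(3) by (auto simp: charts_at_def)
  then obtain n :: int where n: "x 0 + 2 * pi * n \<in> {b<..<b + 2 * pi}"
    using angle_charts_shift[of "x 0" b] ab by metis
  have "isCont (\<lambda>t. x t + 2 * pi * n) 0"
    by (intro continuous_intros DERIV_isCont[OF dx])
  then have "\<forall>\<^sub>F t in nhds 0. x t + 2 * pi * n \<in> {b<..<b + 2 * pi}"
    using n topological_tendstoD[of "\<lambda>t. x t + 2 * pi * n" _ "nhds 0" "{b<..<b + 2 * pi}"]
    by (simp only: isCont_def tendsto_nhds_iff open_greaterThanLessThan)
  moreover have "\<forall>\<^sub>F t in nhds 0. c t \<in> chart_dom u"
    using manifold_curve_eventually[OF c(2), of u 0] u c(3) by simp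
  ultimately have ev: "\<forall>\<^sub>F t in nhds 0. x t + 2 * pi * n = (chart_map v \<circ> c) t"
  proof eventually_elim
    case (elim t)
    then show ?case
      using angle_chart_shift[of "x t" n b] cis_x[of t] by (simp add: ab(2))
  qed
  have "has_curve_derivative euclideanreal (\<lambda>t. x t + 2 * pi * n) (chart_velocity u X) 0"
    using DERIV_add[OF dx DERIV_const[of "2 * pi * n"]] by (simp add: has_curve_derivative_real_iff)
  from has_curve_derivative_cong[OF this ev]
  have "has_curve_derivative (chart_model v) (chart_map v \<circ> c) (chart_velocity u X) 0"
    by (simp add: ab(2) o_def)
  from chart_velocity_eqI[OF M X c(1) v this]
  show "chart_velocity u X = chart_velocity v X"
    by simp
qed

theorem theorem4p1:
  fixes M :: "('m, 'e::real_vector) manifold" and \<theta> d\<theta> :: "'m form"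
  assumes "is_manifold M" and "infinite_dimensional M"
    and "\<theta> \<in> Forms M 1" and "has_ext_derivative M 1 \<theta> d\<theta>"
    and "weakly_symplectic M d\<theta>"
  shows "contact_manifold (prod_manifold real_line M) (contactization_form real_line M \<theta>) \<and>
    contact_manifold (prod_manifold circle M) (contactization_form circle M \<theta>)"
  using coordinate_line.contact_manifold_contactization[OF coordinate_line_real_line assms(3-5)]
    coordinate_line.contact_manifold_contactization[OF coordinate_line_circle assms(3-5)] by blast

end
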